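(* Let $u\in[0,1]$, $\theta>0$, and $c_{\theta,u}:=1+\theta\max\{u,1-u\}$. Let $G=(V,E)$ be a finite simple graph with $|V|=n$, and assume that for some $\eta,\varepsilon>0$ one has $e_G(S)\le(1+\varepsilon)|S|$ for every $S\subset V$ with $|S|\le\eta n$. Then for every $t\ge0$, $$D_{\theta,u}(t)\le\bigl(c_{\theta,u}(1+\varepsilon)n-|E|\bigr)+\bigl((1+\theta)|E|-c_{\theta,u}(1+\varepsilon)n\bigr)\,\mathbb P^G_{\theta,t,u}(A_\eta),$$ where $$D_{\theta,u}(t)=\begin{cases}\dfrac{\mathrm d}{\mathrm dt}\,\mathbb E^G_{1,t,u}[\lambda(\omega)],&\theta=1,\\[1ex]\dfrac{\theta}{\theta-1}\,\dfrac{\mathrm d}{\mathrm dt}\log Z_G(\theta,t,u),&\theta\ne1.\end{cases}$$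
   Context: For a set $S\subset V$, $e_G(S)$ is the number of edges of $G$ with both endpoints in $S$. Derivatives in $t$ at $t=0$ are right derivatives. Random loop model. Let $G=(V,E)$ be a finite simple graph with $|V|=n$, and $S^1=\mathbb R/\mathbb Z$. For $t\ge0$ and $u\in[0,1]$, let $\omega=(\omega_e)_{e\in E}$ be independent marked Poisson point processes on $S^1\times\{\times,\mid\}$ with intensity measure $t\,\mathrm ds\otimes(u\,\delta_\times+(1-u)\,\delta_\mid)$; the law of $\omega$ is $\rho^G_{t,u}$. A point $(s,\times)\in\omega_e$ is a cross, and a point $(s,\mid)\in\omega_e$ a bar, on the edge $e$ at time $s$. Almost surely there are finitely many marks, at distinct times. Loops: a particle moves in $G\times S^1\times\{-1,+1\}$, the third coordinate being its vertical direction. Between marks it moves vertically (in the $S^1$ coordinate) at unit speed in its current direction; when at vertex $x$ it meets a mark on an edge $\{x,y\}$, it jumps instantaneously from $x$ to $y$, keeping its direction if the mark is a cross and reversing it if the mark is a bar. All trajectories are closed; the resulting closed trajectories, regarded as (unoriented) subsets of $V\times S^1$, are the loops. $\mathcal L(\omega)$ is the set of loops and $\lambda(\omega)=|\mathcal L(\omega)|$. For a loop $\gamma$, $\operatorname{supp}_V(\gamma)=\{x\in V:\exists s\in S^1,\ (x,s)\in\gamma\}$. For $\theta>0$, the weighted measure is $\mathbb P^G_{\theta,t,u}(\mathrm d\omega)=Z_G(\theta,t,u)^{-1}\theta^{\lambda(\omega)}\rho^G_{t,u}(\mathrm d\omega)$ with $Z_G(\theta,t,u)=\int\theta^{\lambda(\omega)}\rho^G_{t,u}(\mathrm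 d\omega)$, and $\mathbb E^G_{\theta,t,u}$ is its expectation. For $\eta>0$, $A_\eta=\{\exists\gamma\in\mathcal L(\omega):|\operatorname{supp}_V(\gamma)|>\eta n\}$. *)

theory Defs
  imports "HOL-Probability.Probability"
begin

definition simple_graph :: "'v set \<Rightarrow> 'v set set \<Rightarrow> bool" where
  "simple_graph V E \<longleftrightarrow> finite V \<and> (\<forall>e\<in>E. e \<subseteq> V \<and> card e = 2)"

definition edges_within :: "'v set set \<Rightarrow> 'v set \<Rightarrow> nat" where
  "edges_within E S = card {e \<in> E. e \<subseteq> S}"

datatype mark = Cross | Bar

text \<open>The circle \<open>\<real>/\<int>\<close> is represented by \<open>{0..<1}\<close>, with \<open>frac\<close> as the projection
  from the real line.\<close>

definition circle :: "real measure" where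
  "circle = restrict_space lborel {0..<1}"

definition mark_law :: "real \<Rightarrow> (real \<times> mark) measure" where
  "mark_law u = circle \<Otimes>\<^sub>M measure_pmf (map_pmf (\<lambda>b. if b then Cross else Bar) (bernoulli_pmf u))"

text \<open>Finite point configurations, with the sigma-algebra generated by the counting maps
  \<open>\<lambda>A. card (A \<inter> B)\<close>.\<close>

definition configurations :: "'b measure \<Rightarrow> 'b set measure" where
  "configurations M = sigma {A. finite A \<and> A \<subseteq> space M}
     {{A. finite A \<and> A \<subseteq> space M \<and> card (A \<inter> B) = k} | B k. B \<in> sets M}"

definition is_poisson_process :: "'b measure \<Rightarrow> 'b set measure \<Rightarrow> bool" where
  "is_poisson_process \<mu> P \<longleftrightarrow> prob_space P \<and> space P = space (configurations \<mu>) \<and>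
     sets P = sets (configurations \<mu>) \<and>
     (\<forall>(I :: nat set) B k. finite I \<longrightarrow> B ` I \<subseteq> sets \<mu> \<longrightarrow> disjoint_family_on B I \<longrightarrow>
        measure P {A \<in> space P. \<forall>i\<in>I. card (A \<inter> B i) = k i} =
        (\<Prod>i\<in>I. measure \<mu> (B i) ^ k i / fact (k i) * exp (- measure \<mu> (B i))))"

text \<open>\<open>poisson_pmf\<close> is only specified for a positive rate.\<close>

definition poisson_number :: "real \<Rightarrow> nat pmf" where
  "poisson_number r = (if r = 0 then return_pmf 0 else poisson_pmf r)"

text \<open>The Poisson process with intensity \<open>r * Q\<close>, for a probability measure \<open>Q\<close>: a Poisson number
  of independent points with law \<open>Q\<close>.  Forgetting multiplicities is harmless if \<open>Q\<close> is diffuse;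
  see \<open>is_poisson_process_marks\<close> below for the case in question.\<close>

definition poisson_process :: "real \<Rightarrow> 'b measure \<Rightarrow> 'b set measure" where
  "poisson_process r Q =
     distr (measure_pmf (poisson_number r) \<Otimes>\<^sub>M (\<Pi>\<^sub>M i\<in>(UNIV :: nat set). Q)) (configurations Q)
       (\<lambda>(N, X). X ` {..<N})"

type_synonym 'v config = "'v set \<Rightarrow> (real \<times> mark) set"

definition loop_law :: "'v set set \<Rightarrow> real \<Rightarrow> real \<Rightarrow> 'v config measure" where
  "loop_law E t u = (\<Pi>\<^sub>M e\<in>E. poisson_process t (mark_law u))"

text \<open>Position in \<open>V\<close>, position in the circle, and vertical direction (\<open>1\<close> or \<open>-1\<close>).\<close>

type_synonym 'v state = "'v \<times> real \<times> real"

definition marked :: "'v set set \<Rightarrow> 'v config \<Rightarrow> 'v \<Rightarrow> real \<Rightarrow> bool" where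
  "marked E \<omega> x s \<longleftrightarrow> (\<exists>y m. {x, y} \<in> E \<and> (s, m) \<in> \<omega> {x, y})"

text \<open>Motion for a time \<open>r\<close> during which no mark is met, except possibly on arrival.\<close>

fun vertical :: "'v set set \<Rightarrow> 'v config \<Rightarrow> 'v state \<Rightarrow> 'v state \<Rightarrow> bool" where
  "vertical E \<omega> (x, s, d) (x', s', d') \<longleftrightarrow> x' = x \<and> d' = d \<and>
     (\<exists>r>0. s' = frac (s + d * r) \<and> (\<forall>h. 0 < h \<and> h < r \<longrightarrow> \<not> marked E \<omega> x (frac (s + d * h))))"

text \<open>The effect of the mark present at the current position, if any.\<close>

fun jump :: "'v set set \<Rightarrow> 'v config \<Rightarrow> 'v state \<Rightarrow> 'v state \<Rightarrow> bool" where
  "jump E \<omega> (x, s, d) (x', s', d') \<longleftrightarrow> s' = s \<and>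
     (if marked E \<omega> x s
      then \<exists>m. {x, x'} \<in> E \<and> (s, m) \<in> \<omega> {x, x'} \<and> d' = (case m of Cross \<Rightarrow> d | Bar \<Rightarrow> - d)
      else x' = x \<and> d' = d)"

text \<open>The points visited by the particle that leaves from state \<open>p\<close>.  States reached by
  \<open>vertical OO jump\<close> are those after a possible jump; adding the states reached by a further
  \<open>vertical\<close> makes both end points of every jump belong to the loop, so that the loop does not
  depend on the orientation in which it is traversed.\<close>

definition trajectory :: "'v set set \<Rightarrow> 'v config \<Rightarrow> 'v state \<Rightarrow> ('v \<times> real) set" where
  "trajectory E \<omega> p = {(x, s). \<exists>q d. (vertical E \<omega> OO jump E \<omega>)\<^sup>*\<^sup>* p q \<and>
     (q = (x, s, d) \<or> vertical E \<omega> q (x, s, d))}"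

definition loops :: "'v set \<Rightarrow> 'v set set \<Rightarrow> 'v config \<Rightarrow> ('v \<times> real) set set" where
  "loops V E \<omega> = {trajectory E \<omega> (x, s, d) | x s d. x \<in> V \<and> s \<in> {0..<1} \<and> d \<in> {-1, 1}}"

definition num_loops :: "'v set \<Rightarrow> 'v set set \<Rightarrow> 'v config \<Rightarrow> nat" where
  "num_loops V E \<omega> = card (loops V E \<omega>)"

definition loop_support :: "'v set \<Rightarrow> ('v \<times> real) set \<Rightarrow> 'v set" where
  "loop_support V \<gamma> = {x \<in> V. \<exists>s\<in>{0..<1}. (x, s) \<in> \<gamma>}"

definition partition_function :: "'v set \<Rightarrow> 'v set set \<Rightarrow> real \<Rightarrow> real \<Rightarrow> real \<Rightarrow> real" where
  "partition_function V E \<theta> t u = (\<integral>\<omega>. \<theta> ^ num_loops V E \<omega> \<partial>loop_law E t u)"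

definition weighted_law :: "'v set \<Rightarrow> 'v set set \<Rightarrow> real \<Rightarrow> real \<Rightarrow> real \<Rightarrow> 'v config measure" where
  "weighted_law V E \<theta> t u =
     density (loop_law E t u) (\<lambda>\<omega>. ennreal (\<theta> ^ num_loops V E \<omega> / partition_function V E \<theta> t u))"

definition large_loop_event ::
    "'v set \<Rightarrow> 'v set set \<Rightarrow> real \<Rightarrow> real \<Rightarrow> real \<Rightarrow> real \<Rightarrow> 'v config set" where
  "large_loop_event V E \<theta> t u \<eta> = {\<omega> \<in> space (weighted_law V E \<theta> t u).
     \<exists>\<gamma>\<in>loops V E \<omega>. real (card (loop_support V \<gamma>)) > \<eta> * real (card V)}"

definition mean_loops :: "'v set \<Rightarrow> 'v set set \<Rightarrow> real \<Rightarrow> real \<Rightarrow> real" where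
  "mean_loops V E t u = (\<integral>\<omega>. real (num_loops V E \<omega>) \<partial>weighted_law V E 1 t u)"

text \<open>\<open>D\<close> is the value of \<open>D\<^bsub>\<theta>,u\<^esub>(t)\<close>; the relational form includes the existence of the derivative,
  which is one-sided at \<open>t = 0\<close>.\<close>

definition has_loop_derivative ::
    "'v set \<Rightarrow> 'v set set \<Rightarrow> real \<Rightarrow> real \<Rightarrow> real \<Rightarrow> real \<Rightarrow> bool" where
  "has_loop_derivative V E \<theta> u t D \<longleftrightarrow>
     (if \<theta> = 1
      then ((\<lambda>t. mean_loops V E t u) has_real_derivative D) (at t within {0..})
      else \<exists>D'. ((\<lambda>t. ln (partition_function V E \<theta> t u)) has_real_derivative D') (at t within {0..})
             \<and> D = \<theta> / (\<theta> - 1) * D')"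

text \<open>Justification of \<open>poisson_process\<close>: on the space of marks it has the counting statistics that
  characterise a Poisson point process with intensity \<open>t * mark_law u\<close>.\<close>

lemma pmf_poisson_number:
  assumes "0 \<le> r"
  shows "pmf (poisson_number r) n = r ^ n / fact n * exp (- r)"
  using assms by (cases "r = 0") (auto simp: poisson_number_def indicator_def power_0_left)

lemma prob_space_mark_law: "prob_space (mark_law u)"
proof -
  interpret prob_space circle
    by (auto simp: circle_def emeasure_restrict_space space_restrict_space intro!: prob_spaceI)
  interpret M: prob_space "measure_pmf (map_pmf (\<lambda>b. if b then Cross else Bar) (bernoulli_pmf u))"
    by (rule prob_space_measure_pmf)
  interpret pair_prob_space circle
    "measure_pmf (map_pmf (\<lambda>b. if b then Cross else Bar) (bernoulli_pmf u))" ..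
  show ?thesis unfolding mark_law_def by (rule prob_space_axioms)
qed

lemma measurable_fst_mark_law [measurable]: "fst \<in> mark_law u \<rightarrow>\<^sub>M borel"
proof -
  have "(\<lambda>x. x) \<in> circle \<rightarrow>\<^sub>M borel"
    unfolding circle_def by (rule measurable_restrict_space1) simp
  from measurable_compose[OF measurable_fst this] show ?thesis
    unfolding mark_law_def by (simp cong: measurable_cong)
qed

lemma measurable_snd_mark_law [measurable]: "snd \<in> mark_law u \<rightarrow>\<^sub>M count_space UNIV"
  unfolding mark_law_def
  using measurable_snd[of circle "measure_pmf (map_pmf (\<lambda>b. if b then Cross else Bar) (bernoulli_pmf u))"]
  by (simp cong: measurable_cong_sets)

lemma mark_law_time_null: "AE z in mark_law u. fst z \<noteq> a"
proof -
  let ?M = "measure_pmf (map_pmf (\<lambda>b. if b then Cross else Bar) (bernoulli_pmf u))"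
  interpret prob_space circle
    by (auto simp: circle_def emeasure_restrict_space space_restrict_space intro!: prob_spaceI)
  interpret M: prob_space ?M
    by (rule prob_space_measure_pmf)
  interpret P: pair_prob_space circle ?M ..
  have "AE s in circle. s \<noteq> a"
    unfolding circle_def by (subst AE_restrict_space_iff) (auto intro: AE_mp[OF AE_lborel_singleton[of a]])
  hence "AE s in circle. AE m in ?M. fst (s, m) \<noteq> a" by auto
  moreover have "{z \<in> space (mark_law u). fst z \<noteq> a} \<in> sets (mark_law u)"
    by measurable
  ultimately show ?thesis unfolding mark_law_def
    by (intro P.AE_pair_measure) auto
qed

lemma mark_sequence_distinct:
  assumes "i \<noteq> j"
  shows "AE X in (\<Pi>\<^sub>M i\<in>(UNIV :: nat set). mark_law u). X i \<noteq> X j"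
proof -
  let ?Q = "mark_law u"
  let ?P = "\<Pi>\<^sub>M i\<in>(UNIV :: nat set). ?Q"
  interpret Q: prob_space ?Q by (rule prob_space_mark_law)
  interpret product_prob_space "\<lambda>_. ?Q" "UNIV :: nat set" ..
  interpret QQ: pair_prob_space ?Q ?Q ..
  have eq: "?Q \<Otimes>\<^sub>M ?Q = distr ?P (?Q \<Otimes>\<^sub>M ?Q) (\<lambda>X. (X i, X j))"
  proof (rule pair_measure_eqI)
    fix A B assume A: "A \<in> sets ?Q" and B: "B \<in> sets ?Q"
    have "emeasure (distr ?P (?Q \<Otimes>\<^sub>M ?Q) (\<lambda>X. (X i, X j))) (A \<times> B)
        = emeasure ?P {X \<in> space ?P. \<forall>l\<in>{i, j}. X l \<in> (if l = i then A else B)}"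
      using A B assms by (subst emeasure_distr) (auto intro!: arg_cong[where f = "emeasure ?P"])
    also have "\<dots> = (\<Prod>l\<in>{i, j}. emeasure ?Q (if l = i then A else B))"
      using A B by (intro emeasure_PiM_Collect) auto
    also have "\<dots> = emeasure ?Q A * emeasure ?Q B" using assms by simp
    finally show "emeasure ?Q A * emeasure ?Q B
        = emeasure (distr ?P (?Q \<Otimes>\<^sub>M ?Q) (\<lambda>X. (X i, X j))) (A \<times> B)" ..
  qed (auto intro: Q.sigma_finite_measure_axioms)
  have "{z \<in> space (?Q \<Otimes>\<^sub>M ?Q). fst (fst z) \<noteq> fst (snd z)} \<in> sets (?Q \<Otimes>\<^sub>M ?Q)"
    by measurable
  moreover have "AE x in ?Q. AE y in ?Q. fst (fst (x, y)) \<noteq> fst (snd (x, y))"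
  proof (rule AE_I2)
    fix x show "AE y in ?Q. fst (fst (x, y)) \<noteq> fst (snd (x, y))"
      using mark_law_time_null[where u = u and a = "fst x"] by (auto elim!: eventually_mono)
  qed
  ultimately have "AE z in ?Q \<Otimes>\<^sub>M ?Q. fst (fst z) \<noteq> fst (snd z)"
    by (rule QQ.AE_pair_measure)
  hence "AE X in ?P. fst (X i) \<noteq> fst (X j)"
    by (subst (asm) eq, subst (asm) AE_distr_iff) auto
  thus ?thesis by (auto elim!: eventually_mono)
qed

lemma measurable_mark_eq [measurable (raw)]:
  assumes [measurable]: "f \<in> M \<rightarrow>\<^sub>M mark_law u" "g \<in> M \<rightarrow>\<^sub>M mark_law u"
  shows "Measurable.pred M (\<lambda>x. f x = g x)"
proof -
  have "(\<lambda>x. f x = g x) = (\<lambda>x. fst (f x) = fst (g x) \<and> (snd (f x) = Cross \<longleftrightarrow> snd (g x) = Cross))"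
  proof
    fix x show "(f x = g x) = (fst (f x) = fst (g x) \<and> (snd (f x) = Cross \<longleftrightarrow> snd (g x) = Cross))"
      by (cases "snd (f x)"; cases "snd (g x)"; simp add: prod_eq_iff)
  qed
  moreover have "Measurable.pred M (\<lambda>x. fst (f x) = fst (g x) \<and> (snd (f x) = Cross \<longleftrightarrow> snd (g x) = Cross))"
    by measurable
  ultimately show ?thesis by simp
qed

lemma card_image_first_occurrences:
  "card (X ` {..<n::nat} \<inter> B) = (\<Sum>i<n. if X i \<in> B \<and> (\<forall>j<i. X j \<noteq> X i) then 1 else 0)"
proof (induction n)
  case (Suc n)
  have "X ` {..<Suc n} \<inter> B = (if X n \<in> B then insert (X n) (X ` {..<n} \<inter> B) else X ` {..<n} \<inter> B)"
    by (auto simp: lessThan_Suc)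
  moreover have "X n \<in> X ` {..<n} \<longleftrightarrow> \<not> (\<forall>j<n. X j \<noteq> X n)" by (auto simp: image_iff) (metis lessThan_iff)
  ultimately show ?case using Suc by (auto simp: card_insert_if)
qed simp

lemma space_configurations: "space (configurations M) = {A. finite A \<and> A \<subseteq> space M}"
  unfolding configurations_def by (intro space_measure_of) auto

lemma sets_configurations:
  "sets (configurations M) = sigma_sets {A. finite A \<and> A \<subseteq> space M}
     {{A. finite A \<and> A \<subseteq> space M \<and> card (A \<inter> B) = k} | B k. B \<in> sets M}"
  unfolding configurations_def by (intro sets_measure_of) auto

lemma measurable_count_configurations:
  assumes "B \<in> sets M"
  shows "(\<lambda>A. card (A \<inter> B)) \<in> configurations M \<rightarrow>\<^sub>M count_space UNIV"
proof -
  have "(\<lambda>A. card (A \<inter> B)) -` {k} \<inter> space (configurations M) \<in> sets (configurations M)" for k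
  proof -
    have "(\<lambda>A. card (A \<inter> B)) -` {k} \<inter> space (configurations M)
        = {A. finite A \<and> A \<subseteq> space M \<and> card (A \<inter> B) = k}"
      by (auto simp: space_configurations)
    thus ?thesis using assms unfolding sets_configurations by (auto intro!: sigma_sets.Basic)
  qed
  thus ?thesis by (simp add: measurable_count_space_eq2_countable)
qed

lemma measurable_mark_sample:
  "(\<lambda>(N, X). X ` {..<N}) \<in>
     measure_pmf p \<Otimes>\<^sub>M (\<Pi>\<^sub>M i\<in>(UNIV :: nat set). mark_law u) \<rightarrow>\<^sub>M configurations (mark_law u)"
proof -
  let ?Q = "mark_law u"
  let ?P = "\<Pi>\<^sub>M i\<in>(UNIV :: nat set). ?Q"
  have "(\<lambda>(N, X). X ` {..<N}) \<in> count_space UNIV \<Otimes>\<^sub>M ?P \<rightarrow>\<^sub>M configurations ?Q"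
  proof (rule measurable_pair_measure_countable1)
    show "countable (UNIV :: nat set)" by simp
    fix n :: nat
    have "(\<lambda>X. X ` {..<n}) \<in> ?P \<rightarrow>\<^sub>M configurations ?Q"
      unfolding configurations_def
    proof (rule measurable_measure_of)
      show "(\<lambda>X. X ` {..<n}) \<in> space ?P \<rightarrow> {A. finite A \<and> A \<subseteq> space ?Q}"
        by (auto simp: space_PiM)
      fix Y assume "Y \<in> {{A. finite A \<and> A \<subseteq> space ?Q \<and> card (A \<inter> B) = k} | B k. B \<in> sets ?Q}"
      then obtain B k where B [measurable]: "B \<in> sets ?Q"
        and Y: "Y = {A. finite A \<and> A \<subseteq> space ?Q \<and> card (A \<inter> B) = k}" by auto
      have "(\<lambda>X. X ` {..<n}) -` Y \<inter> space ?P
          = {X \<in> space ?P. (\<Sum>i<n. if X i \<in> B \<and> (\<forall>j<i. X j \<noteq> X i) then 1 else 0) = k}"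
        unfolding Y by (auto simp: space_PiM card_image_first_occurrences[symmetric])
      also have "\<dots> \<in> sets ?P" by measurable
      finally show "(\<lambda>X. X ` {..<n}) -` Y \<inter> space ?P \<in> sets ?P" .
    qed auto
    thus "(\<lambda>y. case (n, y) of (N, X) \<Rightarrow> X ` {..<N}) \<in> ?P \<rightarrow>\<^sub>M configurations ?Q" by simp
  qed
  thus ?thesis by (simp cong: measurable_cong_sets add: sets_pair_measure_cong)
qed

lemma sum_labellings:
  fixes p :: "'j \<Rightarrow> real"
  assumes J: "finite J"
  shows "(\<Sum>j\<in>J. k j) = n \<Longrightarrow>
    (\<Sum>f | f \<in> {..<n::nat} \<rightarrow>\<^sub>E J \<and> (\<forall>j\<in>J. card {i\<in>{..<n}. f i = j} = k j). \<Prod>i<n. p (f i))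
      = fact n * (\<Prod>j\<in>J. p j ^ k j / fact (k j))"
proof (induction n arbitrary: k)
  case 0
  hence "\<forall>j\<in>J. k j = 0" using J by simp
  thus ?case by (simp cong: conj_cong)
next
  case (Suc n)
  let ?S = "\<lambda>n k. {f. f \<in> {..<n::nat} \<rightarrow>\<^sub>E J \<and> (\<forall>j\<in>J. card {i\<in>{..<n}. f i = j} = k j)}"
  let ?k = "\<lambda>l. k(l := k l - 1)"
  let ?L = "{l \<in> J. k l > 0}"
  have cnt: "card {i\<in>{..<Suc n}. (g(n := l)) i = j}
      = card {i\<in>{..<n}. g i = j} + (if j = l then 1 else 0)" for g :: "nat \<Rightarrow> 'j" and l j
  proof -
    have "{i\<in>{..<Suc n}. (g(n := l)) i = j} = {i\<in>{..<n}. g i = j} \<union> (if j = l then {n} else {})"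
      by (auto simp: less_Suc_eq)
    thus ?thesis by (simp add: card_insert_if)
  qed
  have bij: "bij_betw (\<lambda>(l, g). g(n := l)) (SIGMA l:?L. ?S n (?k l)) (?S (Suc n) k)"
  proof (rule bij_betw_imageI)
    have "inj_on (\<lambda>(l, g). g(n := l)) (J \<times> ({..<n} \<rightarrow>\<^sub>E J))" by (rule inj_combinator) simp
    thus "inj_on (\<lambda>(l, g). g(n := l)) (SIGMA l:?L. ?S n (?k l))"
      by (rule inj_on_subset) blast
    show "(\<lambda>(l, g). g(n := l)) ` (SIGMA l:?L. ?S n (?k l)) = ?S (Suc n) k" (is "?A = ?B")
    proof
      show "?A \<subseteq> ?B"
      proof
        fix f assume "f \<in> ?A"
        then obtain z where z: "z \<in> (SIGMA l:?L. ?S n (?k l))" "f = (\<lambda>(l, g). g(n := l)) z"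
          by (rule imageE)
        obtain l g where lg: "z = (l, g)" by (cases z)
        have f: "f = g(n := l)" using z(2) unfolding lg by simp
        have l: "l \<in> J" "k l > 0" and gS: "g \<in> ?S n (?k l)"
          using z(1) unfolding lg mem_Sigma_iff by blast+
        have g: "g \<in> {..<n} \<rightarrow>\<^sub>E J" and c: "\<forall>j\<in>J. card {i\<in>{..<n}. g i = j} = ?k l j"
          using gS unfolding mem_Collect_eq by blast+
        have "g(n := l) \<in> {..<Suc n} \<rightarrow>\<^sub>E J"
          unfolding lessThan_Suc using l(1) g by (rule PiE_fun_upd)
        moreover have "card {i\<in>{..<Suc n}. (g(n := l)) i = j} = k j" if "j \<in> J" for j
          using l c[rule_format, OF that] unfolding cnt by simp
        ultimately show "f \<in> ?B" unfolding f mem_Collect_eq by blast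
      qed
      show "?B \<subseteq> ?A"
      proof
        fix f assume "f \<in> ?B"
        hence "f \<in> {..<Suc n} \<rightarrow>\<^sub>E J \<and> (\<forall>j\<in>J. card {i\<in>{..<Suc n}. f i = j} = k j)"
          unfolding mem_Collect_eq .
        hence f: "f \<in> {..<Suc n} \<rightarrow>\<^sub>E J" and c: "\<forall>j\<in>J. card {i\<in>{..<Suc n}. f i = j} = k j" by blast+
        define g where "g = f(n := undefined)"
        have fg: "f = g(n := f n)" by (simp add: g_def)
        have fn: "f n \<in> J" using f by auto
        have g: "g \<in> {..<n} \<rightarrow>\<^sub>E J"
          using f unfolding g_def by (auto simp: PiE_iff extensional_def)
        have c': "\<forall>j\<in>J. card {i\<in>{..<n}. g i = j} + (if j = f n then 1 else 0) = k j"
          using c unfolding cnt[of g "f n", folded fg] .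
        have "k (f n) > 0" using c'[rule_format, OF fn] by simp
        moreover have "card {i\<in>{..<n}. g i = j} = ?k (f n) j" if "j \<in> J" for j
          using c'[rule_format, OF that] by (cases "j = f n") auto
        ultimately have "(f n, g) \<in> (SIGMA l:?L. ?S n (?k l))"
          unfolding mem_Sigma_iff mem_Collect_eq using fn g by blast
        thus "f \<in> ?A" by (rule image_eqI[rotated]) (simp add: fg[symmetric])
      qed
    qed
  qed
  have fin: "finite (?S n k')" for k'
    by (rule finite_subset[of _ "{..<n} \<rightarrow>\<^sub>E J"]) (auto intro!: finite_PiE J)
  have "(\<Sum>f\<in>?S (Suc n) k. \<Prod>i<Suc n. p (f i))
      = (\<Sum>(l, g)\<in>(SIGMA l:?L. ?S n (?k l)). \<Prod>i<Suc n. p ((g(n := l)) i))"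
    by (subst sum.reindex_bij_betw[OF bij, symmetric]) (simp add: case_prod_beta)
  also have "\<dots> = (\<Sum>l\<in>?L. \<Sum>g\<in>?S n (?k l). \<Prod>i<Suc n. p ((g(n := l)) i))"
    by (rule sum.Sigma[symmetric]) (use J fin in auto)
  also have "\<dots> = (\<Sum>l\<in>?L. p l * (\<Sum>g\<in>?S n (?k l). \<Prod>i<n. p (g i)))"
    by (simp add: sum_distrib_left mult.commute)
  also have "\<dots> = (\<Sum>l\<in>?L. real (k l) * (fact n * (\<Prod>j\<in>J. p j ^ k j / fact (k j))))"
  proof (rule sum.cong[OF refl])
    fix l assume l: "l \<in> ?L"
    have "(\<Sum>j\<in>J. ?k l j) = n"
    proof -
      have "(\<Sum>j\<in>J. k j) = k l + (\<Sum>j\<in>J-{l}. k j)" using l J by (intro sum.remove) auto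
      moreover have "(\<Sum>j\<in>J. ?k l j) = ?k l l + (\<Sum>j\<in>J-{l}. ?k l j)" using l J by (intro sum.remove) auto
      moreover have "(\<Sum>j\<in>J-{l}. ?k l j) = (\<Sum>j\<in>J-{l}. k j)" by (intro sum.cong) auto
      ultimately show ?thesis using l Suc.prems by simp
    qed
    hence "(\<Sum>g\<in>?S n (?k l). \<Prod>i<n. p (g i)) = fact n * (\<Prod>j\<in>J. p j ^ ?k l j / fact (?k l j))"
      by (rule Suc.IH)
    moreover have "p l * (\<Prod>j\<in>J. p j ^ ?k l j / fact (?k l j))
        = real (k l) * (\<Prod>j\<in>J. p j ^ k j / fact (k j))"
    proof -
      obtain m where m: "k l = Suc m" using l by (auto simp: gr0_conv_Suc)
      have "(\<Prod>j\<in>J-{l}. p j ^ ?k l j / fact (?k l j)) = (\<Prod>j\<in>J-{l}. p j ^ k j / fact (k j))"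
        by (intro prod.cong) auto
      moreover have "p l * (p l ^ m / fact m) = real (Suc m) * (p l ^ Suc m / fact (Suc m))"
        by (simp add: fact_Suc del: of_nat_Suc)
      ultimately have "p l * (p l ^ m / fact m) * (\<Prod>j\<in>J-{l}. p j ^ ?k l j / fact (?k l j))
          = real (Suc m) * (p l ^ Suc m / fact (Suc m)) * (\<Prod>j\<in>J-{l}. p j ^ k j / fact (k j))"
        by (simp only:)
      thus ?thesis using l J m
        by (simp only: prod.remove[of J l] mem_Collect_eq fun_upd_same diff_Suc_1 mult.assoc)
    qed
    ultimately show "p l * (\<Sum>g\<in>?S n (?k l). \<Prod>i<n. p (g i))
        = real (k l) * (fact n * (\<Prod>j\<in>J. p j ^ k j / fact (k j)))" by simp
  qed
  also have "\<dots> = real (\<Sum>l\<in>?L. k l) * (fact n * (\<Prod>j\<in>J. p j ^ k j / fact (k j)))"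
    by (simp add: sum_distrib_right)
  also have "(\<Sum>l\<in>?L. k l) = (\<Sum>l\<in>J. k l)"
    by (rule sum.mono_neutral_left) (use J in auto)
  also have "\<dots> = Suc n" by (rule Suc.prems)
  finally show ?case by (simp add: algebra_simps)
qed

lemma mark_counts_prob:
  fixes J :: "nat set" and k :: "nat \<Rightarrow> nat" and u :: real
  defines "Q \<equiv> mark_law u"
  defines "P \<equiv> \<Pi>\<^sub>M i\<in>(UNIV :: nat set). Q"
  assumes J: "finite J" and B: "\<And>j. j \<in> J \<Longrightarrow> B j \<in> sets Q"
    and disj: "disjoint_family_on B J" and cover: "(\<Union>j\<in>J. B j) = space Q"
    and n: "(\<Sum>j\<in>J. k j) = n"
  shows "measure P {X \<in> space P. \<forall>j\<in>J. card (X ` {..<n} \<inter> B j) = k j}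
    = fact n * (\<Prod>j\<in>J. measure Q (B j) ^ k j / fact (k j))"
proof -
  interpret Q: prob_space Q unfolding Q_def by (rule prob_space_mark_law)
  interpret PS: product_prob_space "\<lambda>_. Q" "UNIV :: nat set" ..
  interpret P: prob_space P unfolding P_def by (rule prob_space_PiM) (rule Q.prob_space_axioms)
  let ?S = "{f. f \<in> {..<n} \<rightarrow>\<^sub>E J \<and> (\<forall>j\<in>J. card {i\<in>{..<n}. f i = j} = k j)}"
  define E where "E f = {X \<in> space P. \<forall>i\<in>{..<n}. X i \<in> B (f i)}" for f
  have fin: "finite ?S"
    by (rule finite_subset[of _ "{..<n} \<rightarrow>\<^sub>E J"]) (auto intro!: finite_PiE J)
  have fJ: "f i \<in> J" if "f \<in> ?S" "i < n" for f i using that by (auto simp: PiE_iff)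
  have E_sets: "E f \<in> sets P" if "f \<in> ?S" for f
  proof -
    have "{X \<in> space P. X i \<in> B (f i)} \<in> sets P" if "i < n" for i
      unfolding P_def by (rule sets_Collect_single') (use B fJ[OF \<open>f \<in> ?S\<close> that] in \<open>auto\<close>)
    thus ?thesis unfolding E_def by (intro sets.sets_Collect_finite_All) auto
  qed
  have E_prob: "measure P (E f) = (\<Prod>i<n. measure Q (B (f i)))" if "f \<in> ?S" for f
  proof -
    have "emeasure P (E f) = (\<Prod>i<n. emeasure Q (B (f i)))"
      unfolding E_def P_def by (rule PS.emeasure_PiM_Collect) (use B fJ[OF that] in auto)
    thus ?thesis
      by (simp add: P.emeasure_eq_measure Q.emeasure_eq_measure prod_ennreal prod_nonneg)
  qed
  have E_disj: "disjoint_family_on E ?S"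
    unfolding disjoint_family_on_def
  proof (intro ballI impI)
    fix f g assume f: "f \<in> ?S" and g: "g \<in> ?S" and ne: "f \<noteq> g"
    have "f \<in> {..<n} \<rightarrow>\<^sub>E J" "g \<in> {..<n} \<rightarrow>\<^sub>E J" using f g by blast+
    then obtain i where i: "i < n" "f i \<noteq> g i" using ne by (metis PiE_ext lessThan_iff)
    hence "B (f i) \<inter> B (g i) = {}"
      using disj fJ[OF f] fJ[OF g] by (auto simp: disjoint_family_on_def)
    thus "E f \<inter> E g = {}" using i(1) unfolding E_def by blast
  qed
  have count: "(\<forall>j\<in>J. card (X ` {..<n} \<inter> B j) = k j) \<longleftrightarrow> X \<in> (\<Union>f\<in>?S. E f)"
    if X: "X \<in> space P" and inj: "inj_on X {..<n}" for X
  proof -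
    have XQ: "X i \<in> space Q" for i using X by (auto simp: P_def space_PiM)
    have c: "card (X ` {..<n} \<inter> B j) = card {i\<in>{..<n}. X i \<in> B j}" for j
    proof -
      have "X ` {..<n} \<inter> B j = X ` {i\<in>{..<n}. X i \<in> B j}" by auto
      moreover have "inj_on X {i\<in>{..<n}. X i \<in> B j}" using inj by (rule inj_on_subset) auto
      ultimately show ?thesis by (simp only: card_image)
    qed
    have eq: "{i\<in>{..<n}. X i \<in> B j} = {i\<in>{..<n}. f i = j}"
      if f: "\<forall>i<n. f i \<in> J \<and> X i \<in> B (f i)" and j: "j \<in> J" for f j
    proof -
      have "X i \<in> B j \<longleftrightarrow> f i = j" if "i < n" for i
        using f[rule_format, OF that] j disj by (auto simp: disjoint_family_on_def)
      thus ?thesis by blast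
    qed
    show ?thesis
    proof
      assume cnt: "\<forall>j\<in>J. card (X ` {..<n} \<inter> B j) = k j"
      have "\<forall>i. \<exists>j. j \<in> J \<and> X i \<in> B j" using XQ cover by blast
      then obtain h where h: "\<And>i. h i \<in> J \<and> X i \<in> B (h i)" by metis
      define f where "f = restrict h {..<n}"
      have f: "\<forall>i<n. f i \<in> J \<and> X i \<in> B (f i)" using h by (simp add: f_def)
      have "f \<in> {..<n} \<rightarrow>\<^sub>E J" using h by (auto simp: f_def)
      moreover have "\<forall>j\<in>J. card {i\<in>{..<n}. f i = j} = k j"
        using cnt eq[OF f] unfolding c by simp
      moreover have "X \<in> E f" using f X by (simp add: E_def)
      ultimately show "X \<in> (\<Union>f\<in>?S. E f)" by blast
    next
      assume "X \<in> (\<Union>f\<in>?S. E f)"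
      then obtain f where fS: "f \<in> ?S" and XE: "X \<in> E f" by blast
      have f: "\<forall>i<n. f i \<in> J \<and> X i \<in> B (f i)"
        using XE fJ[OF fS] by (simp add: E_def)
      show "\<forall>j\<in>J. card (X ` {..<n} \<inter> B j) = k j"
        using fS eq[OF f] unfolding c by simp
    qed
  qed
  have "AE X in P. \<forall>i\<in>{..<n}. \<forall>j\<in>{..<n}. i \<noteq> j \<longrightarrow> X i \<noteq> X j"
    unfolding P_def Q_def
    by (intro AE_finite_allI finite_lessThan AE_impI mark_sequence_distinct)
  hence inj: "AE X in P. inj_on X {..<n}"
    by (rule AE_mp) (auto simp: inj_on_def intro!: AE_I2)
  have meas: "{X \<in> space P. \<forall>j\<in>J. card (X ` {..<n} \<inter> B j) = k j} \<in> sets P"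
  proof (rule sets.sets_Collect_finite_All[OF _ J])
    fix j assume "j \<in> J"
    hence [measurable]: "B j \<in> sets (mark_law u)" using B by (simp add: Q_def)
    have "{X \<in> space P. (\<Sum>i<n. if X i \<in> B j \<and> (\<forall>l<i. X l \<noteq> X i) then 1 else 0) = k j} \<in> sets P"
      unfolding P_def Q_def by measurable
    thus "{X \<in> space P. card (X ` {..<n} \<inter> B j) = k j} \<in> sets P"
      unfolding card_image_first_occurrences .
  qed
  have "measure P {X \<in> space P. \<forall>j\<in>J. card (X ` {..<n} \<inter> B j) = k j} = measure P (\<Union>f\<in>?S. E f)"
  proof (rule P.finite_measure_eq_AE)
    show "AE X in P. X \<in> {X \<in> space P. \<forall>j\<in>J. card (X ` {..<n} \<inter> B j) = k j} \<longleftrightarrow> X \<in> (\<Union>f\<in>?S. E f)"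
      using inj by (rule AE_mp) (intro AE_I2 impI, simp only: mem_Collect_eq count, simp)
    show "(\<Union>f\<in>?S. E f) \<in> sets P" using fin E_sets by (intro sets.finite_UN) blast+
  qed (rule meas)
  also have "\<dots> = (\<Sum>f\<in>?S. measure P (E f))"
    using fin E_sets E_disj by (intro P.finite_measure_finite_Union) blast+
  also have "\<dots> = (\<Sum>f\<in>?S. \<Prod>i<n. measure Q (B (f i)))"
    by (rule sum.cong[OF refl], rule E_prob)
  also have "\<dots> = fact n * (\<Prod>j\<in>J. measure Q (B j) ^ k j / fact (k j))"
    by (rule sum_labellings[OF J n])
  finally show ?thesis .
qed

lemma prob_space_poisson_process_marks: "prob_space (poisson_process t (mark_law u))"
proof -
  interpret Q: prob_space "mark_law u" by (rule prob_space_mark_law)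
  interpret N: prob_space "measure_pmf (poisson_number t)" by (rule prob_space_measure_pmf)
  interpret X: prob_space "\<Pi>\<^sub>M i\<in>(UNIV :: nat set). mark_law u"
    by (rule prob_space_PiM) (rule Q.prob_space_axioms)
  interpret NX: pair_prob_space "measure_pmf (poisson_number t)" "\<Pi>\<^sub>M i\<in>(UNIV :: nat set). mark_law u" ..
  show ?thesis unfolding poisson_process_def
    by (rule NX.prob_space_distr) (rule measurable_mark_sample)
qed

lemma poisson_process_marks_sums:
  fixes t u :: real
  defines "Q \<equiv> mark_law u"
  defines "P \<equiv> \<Pi>\<^sub>M i\<in>(UNIV :: nat set). Q"
  assumes t: "0 \<le> t" and A: "A \<in> sets (configurations Q)"
  shows "(\<lambda>n. t ^ n / fact n * exp (- t) * measure P {X \<in> space P. X ` {..<n} \<in> A})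
    sums measure (poisson_process t Q) A"
proof -
  interpret Q: prob_space Q unfolding Q_def by (rule prob_space_mark_law)
  interpret PS: product_prob_space "\<lambda>_. Q" "UNIV :: nat set" ..
  interpret P: prob_space P unfolding P_def by (rule prob_space_PiM) (rule Q.prob_space_axioms)
  interpret PP: prob_space "poisson_process t Q"
    unfolding Q_def by (rule prob_space_poisson_process_marks)
  let ?N = "measure_pmf (poisson_number t)"
  let ?h = "\<lambda>(N :: nat, X). X ` {..<N}"
  have h: "?h \<in> ?N \<Otimes>\<^sub>M P \<rightarrow>\<^sub>M configurations Q"
    unfolding P_def Q_def by (rule measurable_mark_sample)
  have "emeasure (poisson_process t Q) A = emeasure (?N \<Otimes>\<^sub>M P) (?h -` A \<inter> space (?N \<Otimes>\<^sub>M P))"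
    unfolding poisson_process_def P_def[symmetric] by (rule emeasure_distr[OF h A])
  also have "\<dots> = (\<integral>\<^sup>+n. emeasure P (Pair n -` (?h -` A \<inter> space (?N \<Otimes>\<^sub>M P))) \<partial>?N)"
    by (rule P.emeasure_pair_measure_alt) (rule measurable_sets[OF h A])
  also have "\<dots> = (\<integral>\<^sup>+n. ennreal (measure P {X \<in> space P. X ` {..<n} \<in> A}) \<partial>?N)"
    by (intro nn_integral_cong)
       (auto simp: P.emeasure_eq_measure space_pair_measure intro!: arg_cong[where f = "measure P"])
  also have "\<dots> = (\<Sum>n. ennreal (pmf (poisson_number t) n * measure P {X \<in> space P. X ` {..<n} \<in> A}))"
    by (simp add: nn_integral_measure_pmf nn_integral_count_space_nat ennreal_mult')
  finally have "(\<Sum>n. ennreal (t ^ n / fact n * exp (- t) * measure P {X \<in> space P. X ` {..<n} \<in> A}))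
      = ennreal (measure (poisson_process t Q) A)"
    by (simp add: pmf_poisson_number[OF t] PP.emeasure_eq_measure)
  hence "(\<lambda>n. ennreal (t ^ n / fact n * exp (- t) * measure P {X \<in> space P. X ` {..<n} \<in> A}))
      sums ennreal (measure (poisson_process t Q) A)"
    using summable_sums[OF summableI,
        of "\<lambda>n. ennreal (t ^ n / fact n * exp (- t) * measure P {X \<in> space P. X ` {..<n} \<in> A})"]
    by (simp only:)
  thus ?thesis using t by (subst (asm) sums_ennreal) auto
qed

theorem is_poisson_process_marks:
  assumes t: "0 \<le> t"
  shows "is_poisson_process (scale_measure (ennreal t) (mark_law u)) (poisson_process t (mark_law u))"
proof -
  define Q where "Q = mark_law u"
  define P where "P = (\<Pi>\<^sub>M i\<in>(UNIV :: nat set). Q)"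
  interpret Q: prob_space Q unfolding Q_def by (rule prob_space_mark_law)
  have conf: "configurations (scale_measure (ennreal t) Q) = configurations Q"
    by (simp add: configurations_def space_scale_measure)
  have space_PP: "space (poisson_process t Q) = space (configurations Q)"
    and sets_PP: "sets (poisson_process t Q) = sets (configurations Q)"
    by (simp_all add: poisson_process_def)
  have main: "measure (poisson_process t Q) {A \<in> space (poisson_process t Q). \<forall>i\<in>I. card (A \<inter> B i) = k i}
      = (\<Prod>i\<in>I. (t * measure Q (B i)) ^ k i / fact (k i) * exp (- (t * measure Q (B i))))"
    if I: "finite I" and B: "B ` I \<subseteq> sets Q" and disj: "disjoint_family_on B I"
    for I :: "nat set" and B k
  proof -
    let ?A = "{A \<in> space (configurations Q). \<forall>i\<in>I. card (A \<inter> B i) = k i}"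
    define K where "K = (\<Sum>i\<in>I. k i)"
    obtain c where c: "c \<notin> I" using I ex_new_if_finite infinite_UNIV_nat by blast
    define D where "D = B(c := space Q - (\<Union>i\<in>I. B i))"
    have DB: "D i = B i" if "i \<in> I" for i using that c by (auto simp: D_def)
    have UB: "(\<Union>i\<in>I. B i) \<in> sets Q" using I B by (intro sets.finite_UN) auto
    have D_sets: "D j \<in> sets Q" if "j \<in> insert c I" for j
      using that B UB by (auto simp: D_def)
    have D_disj: "disjoint_family_on D (insert c I)"
      using disj c by (auto simp: disjoint_family_on_def D_def)
    have D_cover: "(\<Union>j\<in>insert c I. D j) = space Q"
    proof -
      have "(\<Union>j\<in>insert c I. D j) = D c \<union> (\<Union>i\<in>I. B i)" using DB by simp
      thus ?thesis using sets.sets_into_space[OF UB] by (auto simp: D_def)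
    qed
    have A: "?A \<in> sets (configurations Q)"
    proof (rule sets.sets_Collect_finite_All[OF _ I])
      fix i assume "i \<in> I"
      hence "B i \<in> sets Q" using B by blast
      from measurable_sets[OF measurable_count_configurations[OF this], of "{k i}"]
      show "{A \<in> space (configurations Q). card (A \<inter> B i) = k i} \<in> sets (configurations Q)"
        by (simp add: vimage_def Int_def conj_commute)
    qed
    let ?q = "\<lambda>n. measure P {X \<in> space P. X ` {..<n} \<in> ?A}"
    have XA: "X ` {..<n} \<in> ?A \<longleftrightarrow> (\<forall>i\<in>I. card (X ` {..<n} \<inter> B i) = k i)" if "X \<in> space P" for X n
      using that by (auto simp: space_configurations P_def space_PiM)
    have q_small: "?q n = 0" if n: "n < K" for n
    proof -
      have "{X \<in> space P. X ` {..<n} \<in> ?A} = {}"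
      proof (intro equals0I)
        fix X assume X: "X \<in> {X \<in> space P. X ` {..<n} \<in> ?A}"
        hence "\<forall>i\<in>I. card (X ` {..<n} \<inter> B i) = k i" using XA by blast
        hence "K = (\<Sum>i\<in>I. card (X ` {..<n} \<inter> B i))" by (simp add: K_def)
        also have "\<dots> = card (\<Union>i\<in>I. X ` {..<n} \<inter> B i)"
          using I disj by (intro card_UN_disjoint[symmetric]) (auto simp: disjoint_family_on_def)
        also have "\<dots> \<le> card (X ` {..<n})" by (intro card_mono) auto
        also have "\<dots> \<le> n" using card_image_le[of "{..<n}" X] by simp
        finally show False using n by simp
      qed
      thus ?thesis by (simp only: measure_empty)
    qed
    define p where "p i = measure Q (B i)" for i
    define r where "r = measure Q (D c)"
    have AE_count: "AE X in P. (\<forall>i\<in>I. card (X ` {..<m + K} \<inter> B i) = k i) \<longleftrightarrow>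
        (\<forall>j\<in>insert c I. card (X ` {..<m + K} \<inter> D j) = (k(c := m)) j)" for m
    proof -
      have "AE X in P. \<forall>i\<in>{..<m+K}. \<forall>j\<in>{..<m+K}. i \<noteq> j \<longrightarrow> X i \<noteq> X j"
        unfolding P_def Q_def
        by (intro AE_finite_allI finite_lessThan AE_impI mark_sequence_distinct)
      thus ?thesis
      proof (rule AE_mp, intro AE_I2 impI)
        fix X assume X: "X \<in> space P" and "\<forall>i\<in>{..<m+K}. \<forall>j\<in>{..<m+K}. i \<noteq> j \<longrightarrow> X i \<noteq> X j"
        hence "inj_on X {..<m+K}" by (auto simp: inj_on_def)
        hence "m + K = card (X ` {..<m+K})" by (simp add: card_image)
        also have "X ` {..<m+K} = (\<Union>j\<in>insert c I. X ` {..<m+K} \<inter> D j)"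
        proof -
          have "X ` {..<m+K} \<subseteq> space Q" using X by (auto simp: P_def space_PiM)
          thus ?thesis unfolding D_cover[symmetric] by blast
        qed
        also have "card \<dots> = (\<Sum>j\<in>insert c I. card (X ` {..<m+K} \<inter> D j))"
        proof (rule card_UN_disjoint)
          show "\<forall>i\<in>insert c I. \<forall>j\<in>insert c I. i \<noteq> j \<longrightarrow>
              (X ` {..<m+K} \<inter> D i) \<inter> (X ` {..<m+K} \<inter> D j) = {}"
            using D_disj unfolding disjoint_family_on_def by blast
        qed (use I in simp_all)
        also have "\<dots> = card (X ` {..<m+K} \<inter> D c) + (\<Sum>i\<in>I. card (X ` {..<m+K} \<inter> B i))"
          using I c DB by simp
        finally have tot: "m + K = card (X ` {..<m+K} \<inter> D c) + (\<Sum>i\<in>I. card (X ` {..<m+K} \<inter> B i))" .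
        have ki: "(k(c := m)) i = k i" if "i \<in> I" for i using that c by auto
        show "(\<forall>i\<in>I. card (X ` {..<m + K} \<inter> B i) = k i) \<longleftrightarrow>
          (\<forall>j\<in>insert c I. card (X ` {..<m + K} \<inter> D j) = (k(c := m)) j)" (is "?l \<longleftrightarrow> ?r")
        proof
          assume l: ?l
          hence "(\<Sum>i\<in>I. card (X ` {..<m+K} \<inter> B i)) = K" by (simp add: K_def)
          hence "card (X ` {..<m+K} \<inter> D c) = m" using tot by simp
          thus ?r using l ki DB by simp
        next
          assume ?r thus ?l using ki DB by simp
        qed
      qed
    qed
    have q_big: "?q (m + K) = fact (m + K) * (r ^ m / fact m * (\<Prod>i\<in>I. p i ^ k i / fact (k i)))" for m
    proof -
      have sum: "(\<Sum>j\<in>insert c I. (k(c := m)) j) = m + K"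
        using I c by (simp add: K_def) (intro sum.cong, auto)
      interpret PS: product_prob_space "\<lambda>_. Q" "UNIV :: nat set" ..
      interpret P: prob_space P unfolding P_def by (rule prob_space_PiM) (rule Q.prob_space_axioms)
      have meas: "{X \<in> space P. \<forall>j\<in>J. card (X ` {..<n} \<inter> F j) = l j} \<in> sets P"
        if J: "finite J" and F: "\<And>j. j \<in> J \<Longrightarrow> F j \<in> sets Q" for J :: "nat set" and F l n
      proof (rule sets.sets_Collect_finite_All[OF _ J])
        fix j assume "j \<in> J"
        hence [measurable]: "F j \<in> sets (mark_law u)" using F by (simp add: Q_def)
        have "{X \<in> space P. (\<Sum>i<n. if X i \<in> F j \<and> (\<forall>l<i. X l \<noteq> X i) then 1 else 0) = l j} \<in> sets P"
          unfolding P_def Q_def by measurable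
        thus "{X \<in> space P. card (X ` {..<n} \<inter> F j) = l j} \<in> sets P"
          unfolding card_image_first_occurrences .
      qed
      have "?q (m + K) = measure P {X \<in> space P. \<forall>i\<in>I. card (X ` {..<m + K} \<inter> B i) = k i}"
        using XA by (intro arg_cong[where f = "measure P"]) blast
      also have "\<dots> = measure P {X \<in> space P. \<forall>j\<in>insert c I. card (X ` {..<m + K} \<inter> D j) = (k(c := m)) j}"
      proof (rule P.finite_measure_eq_AE)
        show "AE X in P. X \<in> {X \<in> space P. \<forall>i\<in>I. card (X ` {..<m + K} \<inter> B i) = k i} \<longleftrightarrow>
            X \<in> {X \<in> space P. \<forall>j\<in>insert c I. card (X ` {..<m + K} \<inter> D j) = (k(c := m)) j}"
          using AE_count[of m] by (rule AE_mp) (intro AE_I2 impI, simp only: mem_Collect_eq)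
      qed (use I B D_sets in \<open>(intro meas; blast)+\<close>)
      also have "\<dots> = fact (m + K) * (\<Prod>j\<in>insert c I. measure Q (D j) ^ (k(c := m)) j / fact ((k(c := m)) j))"
        unfolding P_def Q_def
        by (rule mark_counts_prob) (use I D_sets D_disj D_cover sum in \<open>simp_all add: Q_def del: fun_upd_apply\<close>)
      also have "(\<Prod>j\<in>insert c I. measure Q (D j) ^ (k(c := m)) j / fact ((k(c := m)) j))
          = r ^ m / fact m * (\<Prod>j\<in>I. measure Q (D j) ^ (k(c := m)) j / fact ((k(c := m)) j))"
        using I c by (simp add: r_def)
      also have "(\<Prod>j\<in>I. measure Q (D j) ^ (k(c := m)) j / fact ((k(c := m)) j)) = (\<Prod>i\<in>I. p i ^ k i / fact (k i))"
        using c DB by (intro prod.cong) (auto simp: p_def)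
      finally show ?thesis .
    qed
    define C where "C = exp (- t) * (\<Prod>i\<in>I. (t * p i) ^ k i / fact (k i))"
    have tK: "(\<Prod>i\<in>I. (t * p i) ^ k i / fact (k i)) = t ^ K * (\<Prod>i\<in>I. p i ^ k i / fact (k i))"
      unfolding K_def by (simp add: power_mult_distrib prod.distrib power_sum flip: times_divide_eq_right)
    have summand: "t ^ (m + K) / fact (m + K) * exp (- t) * ?q (m + K) = C * ((t * r) ^ m / fact m)" for m
      unfolding q_big C_def tK by (simp add: power_add power_mult_distrib)
    have "(\<lambda>m. (t * r) ^ m / fact m) sums exp (t * r)"
      using exp_converges[of "t * r"] by (simp add: divide_inverse mult.commute)
    hence "(\<lambda>m. t ^ (m + K) / fact (m + K) * exp (- t) * ?q (m + K)) sums (C * exp (t * r))"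
      unfolding summand by (rule sums_mult)
    hence "(\<lambda>n. t ^ n / fact n * exp (- t) * ?q n) sums (C * exp (t * r))"
      by (subst (asm) sums_zero_iff_shift) (simp_all only: q_small mult_zero_right)
    moreover have "(\<lambda>n. t ^ n / fact n * exp (- t) * ?q n) sums measure (poisson_process t Q) ?A"
      using poisson_process_marks_sums[OF t, of ?A u] A unfolding P_def Q_def by simp
    ultimately have "measure (poisson_process t Q) ?A = C * exp (t * r)"
      using sums_unique2 by blast
    also have "r = 1 - (\<Sum>i\<in>I. p i)"
    proof -
      have "measure Q (\<Union>i\<in>I. B i) = (\<Sum>i\<in>I. p i)"
        unfolding p_def using I B disj by (intro Q.finite_measure_finite_Union) auto
      thus ?thesis unfolding r_def D_def using UB by (simp add: Q.prob_compl)
    qed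
    also have "C * exp (t * (1 - (\<Sum>i\<in>I. p i)))
        = (\<Prod>i\<in>I. (t * p i) ^ k i / fact (k i)) * exp (- t + t * (1 - (\<Sum>i\<in>I. p i)))"
      unfolding C_def exp_add by (simp only: mult_ac)
    also have "- t + t * (1 - (\<Sum>i\<in>I. p i)) = (\<Sum>i\<in>I. - (t * p i))"
      by (simp add: algebra_simps sum_distrib_left sum_negf)
    also have "exp \<dots> = (\<Prod>i\<in>I. exp (- (t * p i)))" using I by (rule exp_sum)
    finally show ?thesis unfolding space_PP p_def prod.distrib .
  qed
  have "measure (scale_measure (ennreal t) Q) S = t * measure Q S" for S
    using t by (simp add: measure_scale_measure)
  thus ?thesis
    using main prob_space_poisson_process_marks[of t u] space_PP sets_PP
    unfolding is_poisson_process_def Q_def[symmetric] conf by (simp add: Q_def)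
qed

end

theory Submission
  imports Defs
begin

text \<open>The derivative of an expectation in the intensity of a Poisson process is the mean effect of
  one extra mark, placed on each edge at a uniform time (\<open>has_derivative_loop_law\<close>).  Both cases of
  the theorem ask for the same derivative: put \<open>\<kappa> k = \<theta> + \<theta>\<^sup>2 + \<dots> + \<theta>\<^sup>k\<close>, which is \<open>k\<close> for \<open>\<theta> = 1\<close> and
  otherwise satisfies \<open>\<theta>\<^sup>k = 1 + (\<theta> - 1) / \<theta> * \<kappa> k\<close>.  Then the quantity to be bounded is the derivative
  of the mean of \<open>\<kappa>\<close> at the number \<open>\<lambda>\<close> of loops, divided by the partition function.  One more loop
  raises \<open>\<kappa> \<lambda>\<close> by \<open>\<theta> * \<theta>\<^sup>\<lambda>\<close>, and one loop less lowers it by \<open>\<theta>\<^sup>\<lambda>\<close>.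

  A mark at time \<open>s\<close> on the edge \<open>{x, y}\<close> merges the loops through \<open>(x, s)\<close> and \<open>(y, s)\<close> if they differ
  (\<open>merge_loops\<close>).  If they agree, one of the two kinds of mark may split the loop, and the other does
  not raise the number of loops (\<open>split_loop\<close>).  So for a given configuration and time the mean effect
  of a mark, summed over the edges, is at most \<open>\<theta>\<^sup>\<lambda> * (c * J - |E|)\<close>, where \<open>J\<close> counts the edges whose
  two ends lie on one loop at time \<open>s\<close>.  If no loop is large, the loops divide the vertices at time \<open>s\<close>
  into small sets, and the sparsity assumption gives \<open>J \<le> (1 + \<epsilon>) * |V|\<close>; otherwise \<open>J \<le> |E|\<close> and
  \<open>c - 1 \<le> \<theta>\<close>.  This is \<open>add_mark_sum_bound\<close>; integrating it gives the theorem.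

  Loops are given as sets of visited points.  To count them, the circle is cut at finitely many times,
  among them all times of marks, which turns \<open>V \<times> circle\<close> into arcs.  The ends of arcs are matched in two
  ways, along the arcs and across the cuts, and loops correspond to the classes of the equivalence
  relation generated by the two matchings (\<open>num_loops_eq\<close>).  A new mark replaces the matching of
  four ends only, the rest of the structure pairs these four up by parity (\<open>four_ends_paired\<close>), and
  comparing the three ways to match them shows the effect of the mark (\<open>rematch_four_ends\<close>).

  Measurability concerns all configurations, also those with coinciding times, for which the number of
  loops is not given by matchings.  It rests on an invariance: the loops are carried along by
  any increasing reparametrisation of the circle, so all times may be moved to finitely many
  places on a fine grid, which leaves finitely many configurations to distinguish (\<open>time_invariant_measurable\<close>).\<close>

section \<open>Finite equivalence relations and matchings\<close>

text \<open>An intersection rather than a transitive closure, so that inclusions between generated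
  relations follow from leastness without induction along chains.\<close>

definition gen_equiv :: "'a set \<Rightarrow> ('a \<times> 'a) set \<Rightarrow> ('a \<times> 'a) set" where
  "gen_equiv P R = \<Inter>{r. equiv P r \<and> R \<subseteq> r}"

lemma equiv_gen_equiv:
  assumes "R \<subseteq> P \<times> P"
  shows "equiv P (gen_equiv P R)"
proof (rule equivI)
  have top: "P \<times> P \<in> {r. equiv P r \<and> R \<subseteq> r}"
    using assms by (auto simp: equiv_def refl_on_def sym_def trans_def)
  show "gen_equiv P R \<subseteq> P \<times> P" using top unfolding gen_equiv_def by blast
  show "refl_on P (gen_equiv P R)"
    by (auto simp: gen_equiv_def refl_on_def equiv_def)
  show "sym (gen_equiv P R)"
    unfolding gen_equiv_def by (rule symI) (auto dest: equivE symD)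
  show "trans (gen_equiv P R)"
    unfolding gen_equiv_def by (rule transI) (blast dest: equivE transD)
qed

lemma gen_equiv_incl: "R \<subseteq> gen_equiv P R"
  by (auto simp: gen_equiv_def)

lemma gen_equiv_least: "equiv P r \<Longrightarrow> R \<subseteq> r \<Longrightarrow> gen_equiv P R \<subseteq> r"
  by (auto simp: gen_equiv_def)

lemma gen_equiv_eqI:
  assumes "R \<subseteq> P \<times> P" "R \<subseteq> gen_equiv P S" "S \<subseteq> P \<times> P" "S \<subseteq> gen_equiv P R"
  shows "gen_equiv P R = gen_equiv P S"
  using assms by (intro equalityI gen_equiv_least equiv_gen_equiv)

text \<open>Leastness, applied to the equivalence relation \<open>p \<in> S \<longleftrightarrow> q \<in> S\<close>.\<close>

lemma gen_equiv_invariant: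
  assumes "\<And>p q. (p, q) \<in> R \<Longrightarrow> p \<in> S \<longleftrightarrow> q \<in> S" "R \<subseteq> P \<times> P" "(p, q) \<in> gen_equiv P R"
  shows "p \<in> S \<longleftrightarrow> q \<in> S"
proof -
  let ?r = "{(p, q) \<in> P \<times> P. p \<in> S \<longleftrightarrow> q \<in> S}"
  have "equiv P ?r" by (rule equivI) (auto simp: refl_on_def sym_def trans_def)
  moreover have "R \<subseteq> ?r" using assms(1,2) by blast
  ultimately have "gen_equiv P R \<subseteq> ?r" by (rule gen_equiv_least)
  thus ?thesis using assms(3) by blast
qed

text \<open>The classes of \<open>a\<close> and \<open>b\<close> are replaced by their union \<open>U\<close>; all other classes survive.\<close>

lemma card_quotient_insert_unrelated:
  assumes P: "finite P" and R: "R \<subseteq> P \<times> P" and ab: "a \<in> P" "b \<in> P"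
    and new: "(a, b) \<notin> gen_equiv P R"
  shows "card (P // gen_equiv P R) = card (P // gen_equiv P (insert (a, b) R)) + 1"
proof -
  define r where "r = gen_equiv P R"
  have r: "equiv P r" unfolding r_def by (rule equiv_gen_equiv[OF R])
  have rP: "r \<subseteq> P \<times> P" and re: "\<And>p. p \<in> P \<Longrightarrow> (p, p) \<in> r"
    and rs: "\<And>p q. (p, q) \<in> r \<Longrightarrow> (q, p) \<in> r"
    and rt: "\<And>p q s. (p, q) \<in> r \<Longrightarrow> (q, s) \<in> r \<Longrightarrow> (p, s) \<in> r"
    using r by (auto elim!: equivE dest: refl_onD symD transD)
  define U where "U = r `` {a} \<union> r `` {b}"
  define r' where "r' = r \<union> U \<times> U"
  have UP: "U \<subseteq> P" using rP by (auto simp: U_def)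
  have Ucl: "p \<in> U \<longleftrightarrow> q \<in> U" if "(p, q) \<in> r" for p q
    using that rt rs unfolding U_def by blast
  have r': "equiv P r'"
  proof (rule equivI)
    show "r' \<subseteq> P \<times> P" using rP UP by (auto simp: r'_def)
    show "refl_on P r'" using re by (auto simp: refl_on_def r'_def)
    show "sym r'" using rs by (auto simp: sym_def r'_def)
    show "trans r'" unfolding r'_def trans_def using rt Ucl by blast
  qed
  have gen: "gen_equiv P (insert (a, b) R) = r'"
  proof (rule equalityI)
    have "insert (a, b) R \<subseteq> r'"
      using gen_equiv_incl[of R P] ab re by (auto simp: r'_def r_def[symmetric] U_def)
    thus "gen_equiv P (insert (a, b) R) \<subseteq> r'" by (rule gen_equiv_least[OF r'])
    let ?g = "gen_equiv P (insert (a, b) R)"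
    have g: "equiv P ?g" using R ab by (intro equiv_gen_equiv) auto
    have gs: "\<And>p q. (p, q) \<in> ?g \<Longrightarrow> (q, p) \<in> ?g"
      and gt: "\<And>p q s. (p, q) \<in> ?g \<Longrightarrow> (q, s) \<in> ?g \<Longrightarrow> (p, s) \<in> ?g"
      using g by (auto elim!: equivE dest: symD transD)
    have "r \<subseteq> ?g" unfolding r_def
      by (rule gen_equiv_least[OF g]) (use gen_equiv_incl[of "insert (a, b) R" P] in blast)
    moreover have "(a, b) \<in> ?g" using gen_equiv_incl[of "insert (a, b) R" P] by blast
    ultimately have "(a, p) \<in> ?g" if "p \<in> U" for p using that gt unfolding U_def by blast
    hence "U \<times> U \<subseteq> ?g" using gs gt by blast
    thus "r' \<subseteq> ?g" using \<open>r \<subseteq> ?g\<close> by (simp add: r'_def)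
  qed
  have img: "r' `` {p} = (if p \<in> U then U else r `` {p})" for p
    using Ucl by (auto simp: r'_def)
  have new': "(a, b) \<notin> r" using new by (simp add: r_def)
  have aU: "a \<in> U" using ab re by (auto simp: U_def)
  have q: "P // r = (\<lambda>p. r `` {p}) ` (P - U) \<union> {r `` {a}, r `` {b}}"
  proof -
    have "r `` {p} = r `` {a} \<or> r `` {p} = r `` {b}" if "p \<in> U" for p
      using that equiv_class_eq[OF r] unfolding U_def by blast
    thus ?thesis using ab unfolding quotient_def by blast
  qed
  have q': "P // r' = (\<lambda>p. r `` {p}) ` (P - U) \<union> {U}"
    using aU UP by (auto simp: quotient_def img split: if_splits)
  have d: "r `` {a} \<noteq> r `` {b}" using new' re ab by blast
  have n1: "r `` {a} \<notin> (\<lambda>p. r `` {p}) ` (P - U)" "r `` {b} \<notin> (\<lambda>p. r `` {p}) ` (P - U)"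
    using re ab unfolding U_def by (auto dest: rs)
  have n2: "U \<notin> (\<lambda>p. r `` {p}) ` (P - U)" using re by blast
  have "finite ((\<lambda>p. r `` {p}) ` (P - U))" using P by simp
  thus ?thesis unfolding gen r_def[symmetric] q q' using d n1 n2 by simp
qed

lemma gen_equiv_insert_related:
  assumes "R \<subseteq> P \<times> P" "(a, b) \<in> gen_equiv P R"
  shows "gen_equiv P (insert (a, b) R) = gen_equiv P R"
proof (rule gen_equiv_eqI)
  have "(a, b) \<in> P \<times> P" using equivE[OF equiv_gen_equiv[OF assms(1)]] assms(2) by blast
  thus "insert (a, b) R \<subseteq> P \<times> P" using assms(1) by blast
qed (use assms gen_equiv_incl[of R P] gen_equiv_incl[of "insert (a, b) R" P] in auto)

lemma even_card_involution:
  assumes "finite C" "\<And>x. x \<in> C \<Longrightarrow> i x \<in> C" "\<And>x. x \<in> C \<Longrightarrow> i x \<noteq> x"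
    "\<And>x. x \<in> C \<Longrightarrow> i (i x) = x"
  shows "even (card C)"
  using assms
proof (induction C rule: finite_psubset_induct)
  case (psubset C)
  show ?case
  proof (cases "C = {}")
    case False
    then obtain x where x: "x \<in> C" by blast
    let ?D = "C - {x, i x}"
    have "even (card ?D)"
    proof (rule psubset.IH)
      show "?D \<subset> C" using x by blast
      fix y assume "y \<in> ?D"
      thus "i y \<in> ?D" "i y \<noteq> y" "i (i y) = y" using psubset.prems x by (auto, metis+)
    qed
    moreover have "card C = card ?D + 2"
    proof -
      have "C = insert x (insert (i x) ?D)" using x psubset.prems by blast
      also have "card \<dots> = card ?D + 2" using psubset.prems(2)[OF x] psubset.hyps by simp
      finally show ?thesis .
    qed
    ultimately show ?thesis by simp
  qed simp
qed

text \<open>By parity: each class is a union of pairs \<open>{p, A p}\<close> and, outside the four special ends, a union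
  of pairs \<open>{p, B p}\<close>.  Both its size and the number of its ordinary ends are thus even, so it contains
  an even number of special ends.\<close>

lemma four_ends_paired:
  assumes P: "finite P" and A: "\<And>p. p \<in> P \<Longrightarrow> A p \<in> P \<and> A p \<noteq> p \<and> A (A p) = p"
    and B: "\<And>p. p \<in> P - {a, b, c, d} \<Longrightarrow> B p \<in> P - {a, b, c, d} \<and> B p \<noteq> p \<and> B (B p) = p"
    and abcd: "a \<in> P" "b \<in> P" "c \<in> P" "d \<in> P" "distinct [a, b, c, d]"
    and R: "R = {(p, A p) | p. p \<in> P} \<union> {(p, B p) | p. p \<in> P - {a, b, c, d}}"
  defines "r \<equiv> gen_equiv P R"
  shows "(a, b) \<in> r \<and> (c, d) \<in> r \<or> (a, c) \<in> r \<and> (b, d) \<in> r \<or> (a, d) \<in> r \<and> (b, c) \<in> r"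
proof -
  have RP: "R \<subseteq> P \<times> P" using A B unfolding R by blast
  have r: "equiv P r" unfolding r_def by (rule equiv_gen_equiv[OF RP])
  have rP: "r \<subseteq> P \<times> P" and re: "\<And>p. p \<in> P \<Longrightarrow> (p, p) \<in> r"
    and rs: "\<And>p q. (p, q) \<in> r \<Longrightarrow> (q, p) \<in> r"
    and rt: "\<And>p q s. (p, q) \<in> r \<Longrightarrow> (q, s) \<in> r \<Longrightarrow> (p, s) \<in> r"
    using r by (auto elim!: equivE dest: refl_onD symD transD)
  have rA: "(p, A p) \<in> r" if "p \<in> P" for p
    using that gen_equiv_incl[of R P] unfolding r_def R by blast
  have rB: "(p, B p) \<in> r" if "p \<in> P - {a, b, c, d}" for p
    using that gen_equiv_incl[of R P] unfolding r_def R by blast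
  have ev: "even (card (r `` {p} \<inter> {a, b, c, d}))" for p
  proof -
    let ?C = "r `` {p}"
    have CP: "?C \<subseteq> P" using rP by blast
    have fin: "finite ?C" using CP P by (rule finite_subset)
    have "even (card ?C)"
      by (rule even_card_involution[where i = A, OF fin]) (use A CP rA rt in blast)+
    moreover have "even (card (?C - {a, b, c, d}))"
      by (rule even_card_involution[where i = B]) (use fin B CP rB rt in blast)+
    moreover have "card ?C = card (?C \<inter> {a, b, c, d}) + card (?C - {a, b, c, d})"
      using fin by (metis card_Int_Diff)
    ultimately show ?thesis by simp
  qed
  have E: "r `` {p} \<inter> {a, b, c, d} = (if (p, a) \<in> r then {a} else {}) \<union> (if (p, b) \<in> r then {b} else {})
     \<union> (if (p, c) \<in> r then {c} else {}) \<union> (if (p, d) \<in> r then {d} else {})" for p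
    by auto
  have di: "a \<noteq> b" "a \<noteq> c" "a \<noteq> d" "b \<noteq> c" "b \<noteq> d" "c \<noteq> d" using abcd by auto
  note e = ev[unfolded E]
  have 1: "(a, b) \<in> r \<or> (a, c) \<in> r \<or> (a, d) \<in> r"
    using e[of a] re[OF abcd(1)] di by (auto split: if_splits)
  have 2: "(b, a) \<in> r \<or> (b, c) \<in> r \<or> (b, d) \<in> r"
    using e[of b] re[OF abcd(2)] di by (auto split: if_splits)
  have 3: "(c, a) \<in> r \<or> (c, b) \<in> r \<or> (c, d) \<in> r"
    using e[of c] re[OF abcd(3)] di by (auto split: if_splits)
  have 4: "(d, a) \<in> r \<or> (d, b) \<in> r \<or> (d, c) \<in> r"
    using e[of d] re[OF abcd(4)] di by (auto split: if_splits)
  show ?thesis using 1 2 3 4 rs rt by meson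
qed

text \<open>Here \<open>R\<close> is the structure away from the four ends, and \<open>r1\<close>, \<open>r2\<close>, \<open>r3\<close> arise from the three ways
  to match them.  A matching that agrees with the pairing in \<open>r\<close> adds nothing to \<open>r\<close>, while
  the other two both amount to one and the same extra pair, which merges at most two classes.\<close>

lemma rematch_four_ends:
  assumes P: "finite P" and R: "R \<subseteq> P \<times> P"
    and abcd: "a \<in> P" "b \<in> P" "c \<in> P" "d \<in> P"
  defines "r \<equiv> gen_equiv P R"
  assumes pair: "(a, b) \<in> r \<and> (c, d) \<in> r \<or> (a, c) \<in> r \<and> (b, d) \<in> r \<or> (a, d) \<in> r \<and> (b, c) \<in> r"
  defines "r1 \<equiv> gen_equiv P (insert (a, b) (insert (c, d) R))"
    and "r2 \<equiv> gen_equiv P (insert (a, d) (insert (b, c) R))"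
    and "r3 \<equiv> gen_equiv P (insert (a, c) (insert (b, d) R))"
  shows "(b, d) \<notin> r1 \<Longrightarrow> card (P // r2) + 1 \<le> card (P // r1) \<and> card (P // r3) + 1 \<le> card (P // r1)"
    and "(card (P // r2) \<le> card (P // r1) + 1 \<and> card (P // r3) \<le> card (P // r1)) \<or>
         (card (P // r2) \<le> card (P // r1) \<and> card (P // r3) \<le> card (P // r1) + 1)"
proof -
  let ?e = "\<lambda>x. gen_equiv P (insert x R)"
  have re: "(p, p) \<in> gen_equiv P S" if "p \<in> P" "S \<subseteq> P \<times> P" for p S
    using that equiv_gen_equiv[of S P] by (auto elim!: equivE dest: refl_onD)
  have rs: "(q, p) \<in> gen_equiv P S" if "(p, q) \<in> gen_equiv P S" "S \<subseteq> P \<times> P" for p q S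
    using that equiv_gen_equiv[of S P] by (auto elim!: equivE dest: symD)
  have rt: "(p, s) \<in> gen_equiv P S" if "(p, q) \<in> gen_equiv P S" "(q, s) \<in> gen_equiv P S" "S \<subseteq> P \<times> P" for p q s S
    using that equiv_gen_equiv[of S P] by (auto elim!: equivE dest: transD)
  have mono: "r \<subseteq> ?e x" if "x \<in> P \<times> P" for x
    unfolding r_def using that R
    by (intro gen_equiv_least equiv_gen_equiv) (use gen_equiv_incl[of "insert x R" P] in auto)
  have new: "x \<in> ?e x" for x using gen_equiv_incl[of "insert x R" P] by blast
  have ins: "?e x = r \<and> x \<in> r \<or> card (P // r) = card (P // ?e x) + 1"
    if "x \<in> P \<times> P" for x
    using card_quotient_insert_unrelated[OF P R, of "fst x" "snd x"]
      gen_equiv_insert_related[OF R, of "fst x" "snd x"] that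
    unfolding r_def by (cases x) auto
  have two: "gen_equiv P (insert x (insert y R)) = ?e y"
    if "x \<in> ?e y" "y \<in> P \<times> P" for x y
    using gen_equiv_insert_related[of "insert y R" P "fst x" "snd x"] that R by simp
  have two': "gen_equiv P (insert x (insert y R)) = ?e x"
    if "y \<in> ?e x" "x \<in> P \<times> P" for x y
    using two[OF that] by (simp add: insert_commute)
  have red: "?e y = r" if "y \<in> r" for y
    using gen_equiv_insert_related[OF R, of "fst y" "snd y"] that unfolding r_def by simp
  have both: "gen_equiv P (insert x (insert y R)) = r" if "x \<in> r" "y \<in> r" "y \<in> P \<times> P" for x y
    using two[of x y] red[of y] that by simp
  have step: "y \<in> ?e (p, q)"
    if "fst y \<in> P" "p \<in> P" "q \<in> P" "(fst y, p) \<in> r \<and> (q, snd y) \<in> r \<or> (fst y, q) \<in> r \<and> (p, snd y) \<in> r" for y p q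
  proof -
    let ?S = "insert (p, q) R"
    have S: "?S \<subseteq> P \<times> P" using that R by auto
    have m: "r \<subseteq> gen_equiv P ?S" using mono[of "(p, q)"] that by simp
    have n: "(p, q) \<in> gen_equiv P ?S" by (rule new)
    have n': "(q, p) \<in> gen_equiv P ?S" by (rule rs[OF n S])
    have "(fst y, snd y) \<in> gen_equiv P ?S"
      using that(4)
    proof (elim disjE conjE)
      assume "(fst y, p) \<in> r" "(q, snd y) \<in> r"
      thus ?thesis using rt[OF rt[OF _ n S] _ S] m by blast
    next
      assume "(fst y, q) \<in> r" "(p, snd y) \<in> r"
      thus ?thesis using rt[OF rt[OF _ n' S] _ S] m by blast
    qed
    thus ?thesis by simp
  qed
  have rs': "(q, p) \<in> r" if "(p, q) \<in> r" for p q using rs[OF that[unfolded r_def] R] unfolding r_def .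
  have PP: "(a, b) \<in> P \<times> P" "(c, d) \<in> P \<times> P" "(a, c) \<in> P \<times> P" "(b, d) \<in> P \<times> P" "(a, d) \<in> P \<times> P" "(b, c) \<in> P \<times> P"
    using abcd by auto
  let ?n = "\<lambda>r. card (P // r)"
  \<comment> \<open>One alternative for each pairing; in the first one \<open>r2\<close> and \<open>r3\<close> arise from the same extra pair.\<close>
  have key: "(r1 = r \<and> r2 = ?e (a, d) \<and> r3 = ?e (a, c)
       \<and> ?e (a, d) = ?e (b, d)
       \<and> ?e (a, c) = ?e (b, d)) \<or>
     (r3 = r \<and> r1 = ?e (a, b) \<and> r2 = ?e (a, b) \<and> (b, d) \<in> r1) \<or>
     (r2 = r \<and> r1 = ?e (a, b) \<and> r3 = ?e (a, b) \<and> (b, d) \<in> r1)"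
    using pair
  proof (elim disjE conjE)
    assume h: "(a, b) \<in> r" "(c, d) \<in> r"
    have "r1 = r" unfolding r1_def using both h PP by blast
    moreover have "r2 = ?e (a, d)" unfolding r2_def
      by (rule two') (use step[of "(b, c)" a d] h rs' abcd in auto)
    moreover have "r3 = ?e (a, c)" unfolding r3_def
      by (rule two') (use step[of "(b, d)" a c] h rs' abcd in auto)
    moreover have "?e (p, q) = ?e (b, d)"
      if "(p, b) \<in> r" "(q, d) \<in> r" "p \<in> P" "q \<in> P" for p q
      by (rule gen_equiv_eqI)
         (use R that abcd step[of "(p, q)" b d] step[of "(b, d)" p q] rs'
            gen_equiv_incl[of "insert (p, q) R" P] gen_equiv_incl[of "insert (b, d) R" P] in auto)
    moreover have "(d, d) \<in> r" using re[OF abcd(4) R] unfolding r_def .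
    ultimately show ?thesis using h abcd by blast
  next
    assume h: "(a, c) \<in> r" "(b, d) \<in> r"
    have "r3 = r" unfolding r3_def using both h PP by blast
    moreover have "r1 = ?e (a, b)" unfolding r1_def
      by (rule two') (use step[of "(c, d)" a b] h rs' abcd in auto)
    moreover have "r2 = ?e (a, d)" unfolding r2_def
      by (rule two') (use step[of "(b, c)" a d] h rs' abcd in auto)
    moreover have "?e (a, d) = ?e (a, b)"
      by (rule gen_equiv_eqI)
         (use R abcd h re[OF abcd(1) R, folded r_def] step[of "(a, b)" a d] step[of "(a, d)" a b] rs'
            gen_equiv_incl[of "insert (a, d) R" P] gen_equiv_incl[of "insert (a, b) R" P] in auto)
    moreover have "(b, d) \<in> ?e (a, b)" using mono[OF PP(1)] h by blast
    ultimately show ?thesis by simp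
  next
    assume h: "(a, d) \<in> r" "(b, c) \<in> r"
    have "r2 = r" unfolding r2_def using both h PP by blast
    moreover have "r1 = ?e (a, b)" unfolding r1_def
      by (rule two') (use step[of "(c, d)" a b] h rs' abcd in auto)
    moreover have "r3 = ?e (a, c)" unfolding r3_def
      by (rule two') (use step[of "(b, d)" a c] h rs' abcd in auto)
    moreover have "?e (a, c) = ?e (a, b)"
      by (rule gen_equiv_eqI)
         (use R abcd h re[OF abcd(1) R, folded r_def] step[of "(a, b)" a c] step[of "(a, c)" a b] rs'
            gen_equiv_incl[of "insert (a, c) R" P] gen_equiv_incl[of "insert (a, b) R" P] in auto)
    moreover have "(b, d) \<in> ?e (a, b)"
      using step[of "(b, d)" a b] h abcd re[OF abcd(2) R, folded r_def] by simp
    ultimately show ?thesis by simp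
  qed
  show "(b, d) \<notin> r1 \<Longrightarrow> ?n r2 + 1 \<le> ?n r1 \<and> ?n r3 + 1 \<le> ?n r1"
    using key ins[OF PP(4)] by auto
  show "(?n r2 \<le> ?n r1 + 1 \<and> ?n r3 \<le> ?n r1) \<or> (?n r2 \<le> ?n r1 \<and> ?n r3 \<le> ?n r1 + 1)"
    using key ins[OF PP(1)] ins[OF PP(4)] by auto
qed

section \<open>Cutting the circle at finitely many times\<close>

lemma frac_frac_shift [simp]:
  "frac (frac x - z) = frac (x - z :: real)"
  "frac (frac x + y - z) = frac (x + y - z :: real)"
  "frac (y + frac x - z) = frac (x + y - z :: real)"
  using frac_add_simps(1)[of x "- z"] frac_add_simps(1)[of x "y - z"] by (simp_all add: algebra_simps)

text \<open>Times on the circle are real numbers in \<open>{0..<1}\<close>, and motion in either direction is described by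
  \<open>d \<in> {-1, 1}\<close>, so that one proof serves both directions.\<close>

locale cut_circle =
  fixes T :: "real set"
  assumes finite_T: "finite T" and T_nonempty: "T \<noteq> {}" and T_circle: "T \<subseteq> {0..<1}"
begin

text \<open>\<open>1 - frac (d * (s - t))\<close> is the time in \<open>{0<..1}\<close> needed to go from \<open>s\<close> to \<open>t\<close> in
  direction \<open>d\<close>; a full turn if \<open>s = t\<close>.\<close>

definition gap :: "real \<Rightarrow> real \<Rightarrow> real" where
  "gap d s = Min ((\<lambda>t. 1 - frac (d * (s - t))) ` T)"

lemma travel_time:
  assumes "d \<in> {-1, 1}" "0 < r" "r \<le> 1" "t = frac (s + d * r)"
  shows "1 - frac (d * (s - t)) = r"
proof -
  have "s + d * r = t + of_int \<lfloor>s + d * r\<rfloor>" by (simp add: assms(4) frac_def)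
  hence "s - t = of_int \<lfloor>s + d * r\<rfloor> - d * r" by linarith
  hence "d * (s - t) = d * (of_int \<lfloor>s + d * r\<rfloor> - d * r)" by simp
  also have "\<dots> = (1 - r) + of_int ((if d = 1 then \<lfloor>s + d * r\<rfloor> else - \<lfloor>s + d * r\<rfloor>) - 1)"
    using assms(1) by auto
  finally have "frac (d * (s - t)) = frac (1 - r)" by (simp only: frac_add_of_int_right)
  also have "\<dots> = 1 - r" using assms(2,3) by (subst frac_eq) auto
  finally show ?thesis by simp
qed

lemma arrival:
  assumes "d \<in> {-1, 1}" "0 \<le> t" "t < 1"
  shows "frac (s + d * (1 - frac (d * (s - t)))) = t"
proof -
  have "s + d * (1 - frac (d * (s - t))) = t + of_int ((if d = 1 then \<lfloor>d * (s - t)\<rfloor> + 1 else - \<lfloor>d * (s - t)\<rfloor> - 1))"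
    using assms(1) by (auto simp: frac_def algebra_simps)
  hence "frac (s + d * (1 - frac (d * (s - t)))) = frac t" by (simp only: frac_add_of_int_right)
  thus ?thesis using assms by (simp add: frac_eq)
qed

context
  fixes d :: real
  assumes d: "d \<in> {-1, 1}"
begin

lemma gap_pos: "0 < gap d s" and gap_le_1: "gap d s \<le> 1"
proof -
  have "gap d s \<in> (\<lambda>t. 1 - frac (d * (s - t))) ` T"
    unfolding gap_def using finite_T T_nonempty by (intro Min_in) auto
  thus "0 < gap d s" "gap d s \<le> 1" using frac_lt_1 by (auto simp: less_diff_eq)
qed

lemma gap_hits: "frac (s + d * gap d s) \<in> T"
proof -
  have "gap d s \<in> (\<lambda>t. 1 - frac (d * (s - t))) ` T"
    unfolding gap_def using finite_T T_nonempty by (intro Min_in) auto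
  then obtain t where "t \<in> T" "gap d s = 1 - frac (d * (s - t))" by blast
  thus ?thesis using arrival[OF d, of t s] T_circle by auto
qed

lemma gap_first:
  assumes "0 < h" "h < gap d s"
  shows "frac (s + d * h) \<notin> T"
proof
  assume t: "frac (s + d * h) \<in> T"
  have "1 - frac (d * (s - frac (s + d * h))) = h"
    by (rule travel_time[OF d]) (use assms gap_le_1[of s] in auto)
  hence "h \<in> (\<lambda>t. 1 - frac (d * (s - t))) ` T" using t by force
  hence "gap d s \<le> h" unfolding gap_def using finite_T by (intro Min_le) auto
  thus False using assms by simp
qed

lemma gap_eqI:
  assumes "0 < r" "frac (s + d * r) \<in> T" "\<And>h. 0 < h \<Longrightarrow> h < r \<Longrightarrow> frac (s + d * h) \<notin> T"
  shows "gap d s = r"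
  using assms gap_first gap_hits gap_pos by (metis linorder_neqE_linordered_idom)

lemma gap_ahead:
  assumes "0 \<le> r" "r < gap d s"
  shows "gap d (frac (s + d * r)) = gap d s - r"
proof (rule gap_eqI)
  show "0 < gap d s - r" using assms by simp
  show "frac (frac (s + d * r) + d * (gap d s - r)) \<in> T"
    using gap_hits[of s] by (simp add: algebra_simps)
  fix h assume "0 < h" "h < gap d s - r"
  thus "frac (frac (s + d * r) + d * h) \<notin> T"
    using gap_first[of "r + h" s] assms by (simp add: algebra_simps)
qed

end

lemma gap_back:
  assumes d: "d \<in> {-1, 1}" and "s \<in> T" "0 < r" "r \<le> gap d s"
  shows "gap (- d) (frac (s + d * r)) = r"
proof (rule gap_eqI)
  show "- d \<in> {-1, 1}" using d by auto
  have "frac s = s" using assms T_circle by (auto simp: frac_eq)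
  thus "frac (frac (s + d * r) + - d * r) \<in> T" using assms by (simp)
  fix h assume h: "0 < h" "h < r"
  have "frac (s + d * (r - h)) \<notin> T"
    by (rule gap_first[OF d]) (use h assms in auto)
  thus "frac (frac (s + d * r) + - d * h) \<notin> T" by (simp add: algebra_simps)
qed (use assms in auto)

end

subsection \<open>Ends of arcs\<close>

definition states :: "'v set \<Rightarrow> 'v state set" where
  "states V = V \<times> {0..<1} \<times> {-1, 1}"

context cut_circle
begin

text \<open>For a cut \<open>t\<close>, the triple \<open>(x, t, d)\<close> has two readings: the state of a particle that leaves
  \<open>(x, t)\<close> in direction \<open>d\<close>, and the end at \<open>t\<close> of the arc through which it leaves.  A particle
  that arrives at \<open>(x, t)\<close> in direction \<open>d\<close> does so through the end \<open>(x, t, - d)\<close>.\<close>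

definition arc_ends :: "'v set \<Rightarrow> 'v state set" where
  "arc_ends V = V \<times> T \<times> {-1, 1}"

fun far_end :: "'v state \<Rightarrow> 'v state" where
  "far_end (x, s, d) = (x, frac (s + d * gap d s), - d)"

fun arc :: "'v state \<Rightarrow> ('v \<times> real) set" where
  "arc (x, s, d) = {(x, frac (s + d * r)) | r. 0 \<le> r \<and> r \<le> gap d s}"

lemma arc_ends_states: "arc_ends V \<subseteq> states V"
  using T_circle by (auto simp: arc_ends_def states_def)

lemma finite_arc_ends: "finite V \<Longrightarrow> finite (arc_ends V)"
  using finite_T by (simp add: arc_ends_def)

lemma card_arc_ends: "card (arc_ends V) = 2 * card V * card T"
  by (simp add: arc_ends_def card_cartesian_product)

lemma far_end_in: "p \<in> states V \<Longrightarrow> far_end p \<in> arc_ends V"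
  using gap_hits by (cases p) (auto simp: states_def arc_ends_def)

lemma far_end_far_end:
  assumes "p \<in> arc_ends V"
  shows "far_end (far_end p) = p"
proof (cases p)
  case (fields x s d)
  hence d: "d \<in> {-1, 1}" and s: "s \<in> T" using assms by (auto simp: arc_ends_def)
  have "frac s = s" using s T_circle by (auto simp: frac_eq)
  thus ?thesis
    using gap_back[OF d s gap_pos[OF d] order_refl] by (simp add: fields frac_frac_shift)
qed

lemma far_end_neq: "p \<in> arc_ends V \<Longrightarrow> far_end p \<noteq> p"
  by (cases p) (auto simp: arc_ends_def)

text \<open>A state between two cuts sees only a part of its arc; the way back from the far end sees all
  of it.\<close>

lemma arc_subset_far_end:
  assumes "p \<in> states V"
  shows "arc p \<subseteq> arc (far_end p)"
proof (cases p)
  case (fields x s d)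
  hence d: "d \<in> {-1, 1}" using assms by (auto simp: states_def)
  hence d': "- d \<in> {-1, 1}" by auto
  let ?g = "gap d s" let ?t = "frac (s + d * ?g)"
  have ge: "?g \<le> gap (- d) ?t"
  proof (rule ccontr)
    assume "\<not> ?g \<le> gap (- d) ?t"
    hence lt: "gap (- d) ?t < ?g" by simp
    have "frac (s + d * (?g - gap (- d) ?t)) \<notin> T"
      by (rule gap_first[OF d]) (use lt gap_pos[OF d', of ?t] in auto)
    moreover have "frac (?t + - d * gap (- d) ?t) \<in> T" by (rule gap_hits[OF d'])
    ultimately show False by (simp add: algebra_simps)
  qed
  show ?thesis
  proof
    fix q assume "q \<in> arc p"
    then obtain r where q: "q = (x, frac (s + d * r))" "0 \<le> r" "r \<le> ?g" by (auto simp: fields)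
    have "frac (s + d * r) = frac (?t + - d * (?g - r))" by (simp add: right_diff_distrib)
    moreover have "0 \<le> ?g - r" "?g - r \<le> gap (- d) ?t" using q ge by auto
    ultimately show "q \<in> arc (far_end p)" unfolding q(1) fields far_end.simps arc.simps by blast
  qed
qed

lemma arc_far_end:
  assumes "p \<in> arc_ends V"
  shows "arc (far_end p) = arc p"
  using arc_subset_far_end[of p V] arc_subset_far_end[of "far_end p" V] assms
    arc_ends_states far_end_in far_end_far_end[OF assms] by (metis subset_antisym subsetD)

text \<open>Neighbouring arcs, and arcs joined by a mark, share points at the cuts.  Inner points tell arcs
  apart: the far ends seen from there in the two directions are the ends of the arc.\<close>

lemma mid_arc_unique:
  fixes p :: "'v state"
  assumes p: "p \<in> arc_ends V"
  shows "\<exists>z \<in> arc p. \<forall>q \<in> arc_ends V. z \<in> arc q \<longrightarrow> q = p \<or> q = far_end p"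
proof (cases p)
  case (fields x s d)
  hence d: "d \<in> {-1, 1}" and s: "s \<in> T" using p by (auto simp: arc_ends_def)
  let ?g = "gap d s" let ?m = "frac (s + d * (?g / 2))"
  note g = gap_pos[OF d, of s]
  have m: "?m \<notin> T" by (rule gap_first[OF d]) (use g in auto)
  have pos: "far_end (x, frac (s + d * r), - d) = (x, s, d)" "far_end (x, frac (s + d * r), d) = far_end (x, s, d)"
    if "d \<in> {-1, 1}" "s \<in> T" "0 < r" "r < gap d s" for x :: 'v and s d r
  proof -
    have "frac s = s" using that T_circle by (auto simp: frac_eq)
    thus "far_end (x, frac (s + d * r), - d) = (x, s, d)"
      using gap_back[of d s r] that by (simp)
    show "far_end (x, frac (s + d * r), d) = far_end (x, s, d)"
      using gap_ahead[of d r s] that by (simp add: right_diff_distrib)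
  qed
  have "(x, ?m) \<in> arc p" using g by (auto simp: fields intro!: exI[of _ "?g / 2"])
  moreover have "q = p \<or> q = far_end p" if q: "q \<in> arc_ends V" and z: "(x, ?m) \<in> arc q" for q
  proof -
    obtain y t e where qe: "q = (y, t, e)" by (cases q)
    have e: "e \<in> {-1, 1}" and t: "t \<in> T" using q qe by (auto simp: arc_ends_def)
    from z obtain r where r: "y = x" "?m = frac (t + e * r)" "0 \<le> r" "r \<le> gap e t" by (auto simp: qe)
    have "frac t = t" using t T_circle by (auto simp: frac_eq)
    hence "r \<noteq> 0" "r \<noteq> gap e t" using m r(2) t gap_hits[OF e, of t] by auto
    hence r': "0 < r" "r < gap e t" using r by auto
    note P = pos[OF d s, of "?g / 2" x] and Q = pos[OF e t r', of x]
    have "e = d \<or> e = - d" using d e by auto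
    thus ?thesis
    proof
      assume "e = d"
      hence "q = far_end (x, ?m, - d)" using Q(1) r qe by simp
      thus ?thesis using P g fields by simp
    next
      assume "e = - d"
      hence "q = far_end (x, ?m, d)" using Q(1) r qe by simp
      thus ?thesis using P g fields by simp
    qed
  qed
  ultimately show ?thesis by blast
qed

end

section \<open>Loops as classes of arc ends\<close>

text \<open>This holds almost surely, and makes the motion deterministic.\<close>

definition distinct_times :: "'v set set \<Rightarrow> 'v config \<Rightarrow> bool" where
  "distinct_times E \<omega> \<longleftrightarrow> (\<forall>e\<in>E. \<forall>e'\<in>E. \<forall>s m m'. (s, m) \<in> \<omega> e \<longrightarrow> (s, m') \<in> \<omega> e' \<longrightarrow> e = e' \<and> m = m')"

definition mark_times :: "'v set set \<Rightarrow> 'v config \<Rightarrow> real set" where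
  "mark_times E \<omega> = fst ` (\<Union>e\<in>E. \<omega> e)"

lemma marked_in_mark_times: "marked E \<omega> x s \<Longrightarrow> s \<in> mark_times E \<omega>"
  by (force simp: marked_def mark_times_def)

text \<open>Cuts without a mark are admitted, so that a configuration can be compared with the one that
  has one more mark on the same set of ends.\<close>

locale cut_configuration = cut_circle +
  fixes V :: "'v set" and E :: "'v set set" and \<omega> :: "'v config"
  assumes graph: "simple_graph V E" and distinct: "distinct_times E \<omega>"
    and cuts: "mark_times E \<omega> \<subseteq> T"
begin

text \<open>The jump, read as a map from the end through which a particle arrives to the end through which it
  leaves; hence the reversed direction.\<close>

definition switch :: "'v state \<Rightarrow> 'v state" where
  "switch p = (THE q. jump E \<omega> (fst p, fst (snd p), - snd (snd p)) q)"

lemma edge_cases: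
  assumes "{x, y} \<in> E"
  shows "x \<in> V" "y \<in> V" "x \<noteq> y"
  using assms graph by (auto simp: simple_graph_def)

lemma finite_V: "finite V"
  using graph by (simp add: simple_graph_def)

lemma jump_iff_marked:
  assumes "{x, y} \<in> E" "(s, m) \<in> \<omega> {x, y}"
  shows "jump E \<omega> (x, s, d) q \<longleftrightarrow> q = (y, s, case m of Cross \<Rightarrow> d | Bar \<Rightarrow> - d)"
proof -
  have uniq: "y' = y \<and> m' = m" if "{x, y'} \<in> E" "(s, m') \<in> \<omega> {x, y'}" for y' m'
    using that assms distinct unfolding distinct_times_def by (metis doubleton_eq_iff)
  obtain y' s' d' where q: "q = (y', s', d')" by (cases q)
  have "marked E \<omega> x s" using assms by (auto simp: marked_def)
  hence "jump E \<omega> (x, s, d) q \<longleftrightarrow> s' = s \<and>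
      (\<exists>m'. {x, y'} \<in> E \<and> (s, m') \<in> \<omega> {x, y'} \<and> d' = (case m' of Cross \<Rightarrow> d | Bar \<Rightarrow> - d))"
    unfolding q jump.simps by simp
  also have "\<dots> \<longleftrightarrow> s' = s \<and> y' = y \<and> d' = (case m of Cross \<Rightarrow> d | Bar \<Rightarrow> - d)"
    using uniq assms by blast
  finally show ?thesis by (auto simp: q)
qed

lemma switch_marked:
  assumes "{x, y} \<in> E" "(s, m) \<in> \<omega> {x, y}"
  shows "switch (x, s, d) = (y, s, case m of Cross \<Rightarrow> - d | Bar \<Rightarrow> d)"
  unfolding switch_def jump_iff_marked[OF assms] fst_conv snd_conv by (auto split: mark.split)

lemma switch_unmarked: "\<not> marked E \<omega> x s \<Longrightarrow> switch (x, s, d) = (x, s, - d)"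
  by (auto simp: switch_def intro!: the_equality)

lemma jump_iff_switch: "jump E \<omega> (x, s, - d) q \<longleftrightarrow> q = switch (x, s, d)"
proof (cases "marked E \<omega> x s")
  case True
  then obtain y m where ym: "{x, y} \<in> E" "(s, m) \<in> \<omega> {x, y}" by (auto simp: marked_def)
  show ?thesis unfolding jump_iff_marked[OF ym] switch_marked[OF ym] by (cases m) auto
qed (cases q, auto simp: switch_unmarked)

lemma switch_involution:
  assumes "p \<in> arc_ends V"
  shows "switch p \<in> arc_ends V" "switch p \<noteq> p" "switch (switch p) = p"
proof -
  obtain x s d where p: "p = (x, s, d)" by (cases p)
  have xsd: "x \<in> V" "s \<in> T" "d \<in> {-1, 1}" using assms by (auto simp: p arc_ends_def)
  have "switch p \<in> arc_ends V \<and> switch p \<noteq> p \<and> switch (switch p) = p"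
  proof (cases "marked E \<omega> x s")
    case True
    then obtain y m where ym: "{x, y} \<in> E" "(s, m) \<in> \<omega> {x, y}" by (auto simp: marked_def)
    hence yx: "{y, x} \<in> E" "(s, m) \<in> \<omega> {y, x}" by (simp_all add: insert_commute)
    show ?thesis using xsd edge_cases[OF ym(1)]
      by (cases m) (auto simp: p switch_marked[OF ym] switch_marked[OF yx] arc_ends_def)
  qed (use xsd in \<open>auto simp: p switch_unmarked arc_ends_def\<close>)
  thus "switch p \<in> arc_ends V" "switch p \<noteq> p" "switch (switch p) = p" by blast+
qed

text \<open>Loops are unoriented, and so are these relations: each end has one partner along its arc and one
  across its cut.\<close>

definition matchings :: "('v state \<times> 'v state) set" where
  "matchings = {(p, far_end p) | p. p \<in> arc_ends V} \<union> {(p, switch p) | p. p \<in> arc_ends V}"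

definition same_loop :: "('v state \<times> 'v state) set" where
  "same_loop = gen_equiv (arc_ends V) matchings"

lemma matchings_ends: "matchings \<subseteq> arc_ends V \<times> arc_ends V"
  using far_end_in arc_ends_states switch_involution(1) by (fastforce simp: matchings_def)

lemma equiv_same_loop: "equiv (arc_ends V) same_loop"
  unfolding same_loop_def by (rule equiv_gen_equiv[OF matchings_ends])

lemma
  shows same_loop_refl: "p \<in> arc_ends V \<Longrightarrow> (p, p) \<in> same_loop"
    and same_loop_sym: "(p, q) \<in> same_loop \<Longrightarrow> (q, p) \<in> same_loop"
    and same_loop_trans: "(p, q) \<in> same_loop \<Longrightarrow> (q, p') \<in> same_loop \<Longrightarrow> (p, p') \<in> same_loop"
  using equiv_same_loop by (auto elim!: equivE dest: refl_onD symD transD)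

lemma
  assumes "p \<in> arc_ends V"
  shows same_loop_far_end: "(p, far_end p) \<in> same_loop"
    and same_loop_switch: "(p, switch p) \<in> same_loop"
proof -
  have "(p, far_end p) \<in> matchings" "(p, switch p) \<in> matchings"
    using assms unfolding matchings_def by blast+
  thus "(p, far_end p) \<in> same_loop" "(p, switch p) \<in> same_loop"
    using gen_equiv_incl[of matchings "arc_ends V"] unfolding same_loop_def by blast+
qed

text \<open>From departure to departure: along an arc and across the cut at its far end.\<close>

definition advance :: "'v state \<Rightarrow> 'v state" where
  "advance p = switch (far_end p)"

lemma advance_in: "p \<in> states V \<Longrightarrow> advance p \<in> arc_ends V"
  unfolding advance_def by (intro switch_involution far_end_in)

lemma advance_pow_in: "p \<in> states V \<Longrightarrow> (advance ^^ k) p \<in> states V"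
proof (induction k)
  case (Suc k)
  thus ?case using advance_in[of "(advance ^^ k) p"] arc_ends_states by auto
qed simp

lemma vertical_step:
  assumes "(x, s, d) \<in> states V" "0 < r" "r \<le> gap d s"
  shows "vertical E \<omega> (x, s, d) (x, frac (s + d * r), d)"
proof -
  have d: "d \<in> {-1, 1}" using assms by (auto simp: states_def)
  have "\<not> marked E \<omega> x (frac (s + d * h))" if "0 < h" "h < r" for h
    using gap_first[OF d, of h s] marked_in_mark_times cuts that assms by fastforce
  thus ?thesis using assms by auto
qed

lemma advance_reachable:
  assumes "p \<in> states V"
  shows "(vertical E \<omega> OO jump E \<omega>) p (advance p)"
proof (cases p)
  case (fields x s d)
  hence d: "d \<in> {-1, 1}" using assms by (auto simp: states_def)
  have "vertical E \<omega> p (x, frac (s + d * gap d s), d)"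
    using vertical_step[of x s d "gap d s"] assms gap_pos[OF d] fields by simp
  moreover have "jump E \<omega> (x, frac (s + d * gap d s), d) (advance p)"
    using jump_iff_switch[of x "frac (s + d * gap d s)" "- d" "advance p"]
    by (simp only: advance_def fields far_end.simps minus_minus)
  ultimately show ?thesis by blast
qed

text \<open>Without a mark, crossing a cut is the same as arriving there and leaving again.\<close>

lemma cross_unmarked_cut:
  assumes p: "(x, s, d) \<in> states V" and r: "gap d s < r"
    and free: "\<forall>h. 0 < h \<and> h < r \<longrightarrow> \<not> marked E \<omega> x (frac (s + d * h))"
  shows "advance (x, s, d) = (x, frac (s + d * gap d s), d)"
    and "\<forall>h. 0 < h \<and> h < r - gap d s \<longrightarrow> \<not> marked E \<omega> x (frac (frac (s + d * gap d s) + d * h))"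
proof -
  have d: "d \<in> {-1, 1}" using p by (auto simp: states_def)
  note g = gap_pos[OF d, of s]
  show "advance (x, s, d) = (x, frac (s + d * gap d s), d)"
    using free[rule_format, of "gap d s"] g r by (simp add: advance_def switch_unmarked)
  show "\<forall>h. 0 < h \<and> h < r - gap d s \<longrightarrow> \<not> marked E \<omega> x (frac (frac (s + d * gap d s) + d * h))"
  proof (intro allI impI)
    fix h assume "0 < h \<and> h < r - gap d s"
    hence "\<not> marked E \<omega> x (frac (s + d * (gap d s + h)))" using free g by (auto simp: less_diff_eq)
    thus "\<not> marked E \<omega> x (frac (frac (s + d * gap d s) + d * h))"
      by (simp add: distrib_left add.assoc)
  qed
qed

text \<open>A vertical motion may pass several cuts.  It is peeled arc by arc; this ends because, after
  the first one, each arc has at least the length \<open>\<delta>\<close> of the shortest.\<close>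

lemma vertical_decompose:
  assumes p: "p \<in> states V" and v: "vertical E \<omega> p q"
  shows "\<exists>k x s d r. (advance ^^ k) p = (x, s, d) \<and> 0 < r \<and> r \<le> gap d s \<and> q = (x, frac (s + d * r), d)"
proof -
  let ?G = "(\<lambda>(d, t). gap d t) ` ({-1, 1} \<times> T)"
  define \<delta> where "\<delta> = Min ?G"
  have fin: "finite ?G" using finite_T by simp
  have ne: "?G \<noteq> {}" using T_nonempty by simp
  have \<delta>: "0 < \<delta>" unfolding \<delta>_def using Min_in[OF fin ne] gap_pos by auto
  have \<delta>_le: "\<delta> \<le> gap d t" if "d \<in> {-1, 1}" "t \<in> T" for d t
    unfolding \<delta>_def using fin that by (intro Min_le) (auto intro!: image_eqI[of _ _ "(d, t)"])
  let ?concl = "\<lambda>p q. \<exists>k x s d r. (advance ^^ k) p = (x, s, d) \<and> 0 < r \<and> r \<le> gap d s \<and> q = (x, frac (s + d * r), d)"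
  have step: "?concl (x, s, d) (x, frac (s + d * r), d)"
    if p: "(x, s, d) \<in> states V" and r: "0 < r"
      and free: "\<forall>h. 0 < h \<and> h < r \<longrightarrow> \<not> marked E \<omega> x (frac (s + d * h))"
      and rec: "gap d s < r \<Longrightarrow> ?concl (x, frac (s + d * gap d s), d)
          (x, frac (frac (s + d * gap d s) + d * (r - gap d s)), d)" for x s d r
  proof (cases "r \<le> gap d s")
    case True
    thus ?thesis using r by (intro exI[of _ 0]) auto
  next
    case False
    hence gr: "gap d s < r" by simp
    have adv: "advance (x, s, d) = (x, frac (s + d * gap d s), d)"
      by (rule cross_unmarked_cut(1)[OF p gr free])
    have eq: "frac (frac (s + d * gap d s) + d * (r - gap d s)) = frac (s + d * r)"
      by (simp add: right_diff_distrib)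
    obtain k y t e r' where "(advance ^^ k) (x, frac (s + d * gap d s), d) = (y, t, e)" "0 < r'"
      "r' \<le> gap e t" "(x, frac (s + d * r), d) = (y, frac (t + e * r'), e)"
      using rec[OF gr] unfolding eq by blast
    hence "(advance ^^ Suc k) (x, s, d) = (y, t, e) \<and> 0 < r' \<and> r' \<le> gap e t
        \<and> (x, frac (s + d * r), d) = (y, frac (t + e * r'), e)"
      unfolding funpow_Suc_right o_apply adv by blast
    thus ?thesis by blast
  qed
  have ends: "?concl (x, s, d) (x, frac (s + d * r), d)"
    if "(x, s, d) \<in> arc_ends V" "0 < r" "r \<le> real n * \<delta>"
      "\<forall>h. 0 < h \<and> h < r \<longrightarrow> \<not> marked E \<omega> x (frac (s + d * h))" for n x s d r
    using that
  proof (induction n arbitrary: s r)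
    case (Suc n)
    have st: "(x, s, d) \<in> states V" using Suc.prems arc_ends_states by blast
    have d: "d \<in> {-1, 1}" and s: "s \<in> T" and x: "x \<in> V" using Suc.prems(1) by (auto simp: arc_ends_def)
    show ?case
    proof (rule step[OF st Suc.prems(2,4)])
      assume g: "gap d s < r"
      show "?concl (x, frac (s + d * gap d s), d) (x, frac (frac (s + d * gap d s) + d * (r - gap d s)), d)"
      proof (rule Suc.IH)
        show "(x, frac (s + d * gap d s), d) \<in> arc_ends V"
          using x d gap_hits[OF d] by (auto simp: arc_ends_def)
        show "0 < r - gap d s" using g by simp
        show "r - gap d s \<le> real n * \<delta>" using Suc.prems(3) \<delta>_le[OF d s] by (simp add: algebra_simps)
      qed (rule cross_unmarked_cut(2)[OF st g Suc.prems(4)])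
    qed
  qed simp
  obtain x s d where pf: "p = (x, s, d)" by (cases p)
  have st: "(x, s, d) \<in> states V" using p pf by simp
  hence d: "d \<in> {-1, 1}" and x: "x \<in> V" by (auto simp: states_def)
  from v obtain r where r: "0 < r" "q = (x, frac (s + d * r), d)"
    and free: "\<forall>h. 0 < h \<and> h < r \<longrightarrow> \<not> marked E \<omega> x (frac (s + d * h))"
    by (cases q) (auto simp: pf)
  show ?thesis unfolding pf r(2)
  proof (rule step[OF st r(1) free])
    assume g: "gap d s < r"
    obtain n where n: "r - gap d s < real n * \<delta>" using reals_Archimedean3[OF \<delta>] by blast
    show "?concl (x, frac (s + d * gap d s), d) (x, frac (frac (s + d * gap d s) + d * (r - gap d s)), d)"
    proof (rule ends)
      show "(x, frac (s + d * gap d s), d) \<in> arc_ends V"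
        using x d gap_hits[OF d] by (auto simp: arc_ends_def)
      show "0 < r - gap d s" using g by simp
      show "r - gap d s \<le> real n * \<delta>" using n by simp
    qed (rule cross_unmarked_cut(2)[OF st g free])
  qed
qed

text \<open>Every state of the particle lies ahead, on the same arc, of one of the departures
  \<open>(advance ^^ k) p\<close>.\<close>

definition ahead :: "'v state \<Rightarrow> 'v state set" where
  "ahead p = (case p of (x, s, d) \<Rightarrow> {(x, frac (s + d * r), d) | r. 0 \<le> r \<and> r < gap d s})"

lemma ahead_refl: "p \<in> states V \<Longrightarrow> p \<in> ahead p"
  using gap_pos by (cases p) (auto simp: ahead_def states_def intro!: exI[of _ 0])

lemma ahead_props:
  assumes p: "p \<in> states V" and q: "q \<in> ahead p"
  shows "q \<in> states V" "advance q = advance p" "ahead q \<subseteq> ahead p" "arc q \<subseteq> arc p"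
proof -
  obtain x s d where pf: "p = (x, s, d)" by (cases p)
  have d: "d \<in> {-1, 1}" and x: "x \<in> V" using p pf by (auto simp: states_def)
  obtain r where r: "q = (x, frac (s + d * r), d)" "0 \<le> r" "r < gap d s"
    using q by (auto simp: pf ahead_def)
  note g = gap_ahead[OF d r(2,3)]
  show "q \<in> states V" using x d frac_lt_1 by (auto simp: r(1) states_def)
  show "advance q = advance p" by (simp add: advance_def r(1) pf g right_diff_distrib)
  have add: "frac (frac (s + d * r) + d * r') = frac (s + d * (r + r'))" for r'
    by (simp add: distrib_left add.assoc)
  show "ahead q \<subseteq> ahead p"
  proof
    fix z assume "z \<in> ahead q"
    then obtain r' where z: "z = (x, frac (frac (s + d * r) + d * r'), d)" and "0 \<le> r'" "r' < gap d s - r"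
      unfolding ahead_def r(1) prod.case g by blast
    hence "0 \<le> r + r'" "r + r' < gap d s" using r(2) by auto
    with z[unfolded add] show "z \<in> ahead p" unfolding ahead_def pf by blast
  qed
  show "arc q \<subseteq> arc p"
  proof
    fix z assume "z \<in> arc q"
    then obtain r' where z: "z = (x, frac (frac (s + d * r) + d * r'))" and "0 \<le> r'" "r' \<le> gap d s - r"
      unfolding r(1) arc.simps g by blast
    hence "0 \<le> r + r'" "r + r' \<le> gap d s" using r(2) by auto
    with z[unfolded add] show "z \<in> arc p" unfolding pf arc.simps by blast
  qed
qed

lemma reachable_ahead:
  assumes p: "p \<in> states V" and q: "(vertical E \<omega> OO jump E \<omega>)\<^sup>*\<^sup>* p q"
  shows "\<exists>k. q \<in> ahead ((advance ^^ k) p)"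
  using q
proof (induction rule: rtranclp_induct)
  case base
  show ?case using ahead_refl[OF p] by (intro exI[of _ 0]) simp
next
  case (step q q')
  then obtain k where k: "q \<in> ahead ((advance ^^ k) p)" by blast
  note A = ahead_props[OF advance_pow_in[OF p] k]
  from step.hyps obtain q1 where v: "vertical E \<omega> q q1" and j: "jump E \<omega> q1 q'" by blast
  obtain l x s d r where l: "(advance ^^ l) q = (x, s, d)" and r: "0 < r" "r \<le> gap d s"
    and q1: "q1 = (x, frac (s + d * r), d)"
    using vertical_decompose[OF A(1) v] by blast
  have ql: "(x, s, d) \<in> states V" using advance_pow_in[OF A(1), of l] l by simp
  hence d: "d \<in> {-1, 1}" by (auto simp: states_def)
  have q': "q' = switch (x, frac (s + d * r), - d)"
    using j jump_iff_switch[of x "frac (s + d * r)" "- d" q'] by (simp add: q1)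
  have shift: "(advance ^^ Suc l) q = (advance ^^ (Suc l + k)) p" for l
    unfolding funpow_add o_apply funpow_Suc_right A(2) ..
  show ?case
  proof (cases "r = gap d s")
    case True
    hence "q' = (advance ^^ Suc l) q" by (simp add: q' l advance_def)
    hence "q' = (advance ^^ (Suc l + k)) p" by (simp only: shift)
    thus ?thesis using ahead_refl[OF advance_pow_in[OF p]] by metis
  next
    case False
    hence r': "r < gap d s" using r by simp
    have "frac (s + d * r) \<notin> T" by (rule gap_first[OF d r(1) r'])
    hence "\<not> marked E \<omega> x (frac (s + d * r))" using marked_in_mark_times[of E \<omega> x "frac (s + d * r)"] cuts by blast
    hence "q' = (x, frac (s + d * r), d)" by (simp add: q' switch_unmarked)
    hence q'l: "q' \<in> ahead ((advance ^^ l) q)" using r(1) r' by (auto simp: l ahead_def)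
    show ?thesis
    proof (cases l)
      case 0
      thus ?thesis using q'l A(3) by auto
    next
      case (Suc l')
      thus ?thesis using q'l shift[of l'] by metis
    qed
  qed
qed

lemma arc_of_state: "(x, s, d) \<in> states V \<Longrightarrow> (x, s) \<in> arc (x, s, d)"
  using gap_pos[of d s] by (auto simp: states_def intro!: exI[of _ 0])

lemma trajectory_arcs:
  assumes p: "p \<in> states V"
  shows "trajectory E \<omega> p = (\<Union>k. arc ((advance ^^ k) p))"
proof (intro equalityI subsetI)
  fix z assume "z \<in> trajectory E \<omega> p"
  then obtain x s q d where z: "z = (x, s)" and q: "(vertical E \<omega> OO jump E \<omega>)\<^sup>*\<^sup>* p q"
    and or: "q = (x, s, d) \<or> vertical E \<omega> q (x, s, d)"
    unfolding trajectory_def by blast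
  obtain k where k: "q \<in> ahead ((advance ^^ k) p)" using reachable_ahead[OF p q] by blast
  note A = ahead_props[OF advance_pow_in[OF p] k]
  show "z \<in> (\<Union>k. arc ((advance ^^ k) p))"
    using or
  proof
    assume "q = (x, s, d)"
    thus ?thesis using arc_of_state A z by blast
  next
    assume "vertical E \<omega> q (x, s, d)"
    then obtain l y t e r where l: "(advance ^^ l) q = (y, t, e)" and r: "0 < r" "r \<le> gap e t"
      and q1: "(x, s, d) = (y, frac (t + e * r), e)"
      using vertical_decompose[OF A(1)] by blast
    have zl: "z \<in> arc ((advance ^^ l) q)" unfolding l using q1 r z by auto
    show ?thesis
    proof (cases l)
      case 0
      thus ?thesis using zl A(4) by auto
    next
      case (Suc l')
      hence "(advance ^^ l) q = (advance ^^ (l + k)) p"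
        unfolding Suc funpow_add o_apply funpow_Suc_right A(2) by simp
      thus ?thesis using zl by (metis UN_I UNIV_I)
    qed
  qed
next
  fix z assume "z \<in> (\<Union>k. arc ((advance ^^ k) p))"
  then obtain k where k: "z \<in> arc ((advance ^^ k) p)" by blast
  have reach: "(vertical E \<omega> OO jump E \<omega>)\<^sup>*\<^sup>* p ((advance ^^ k) p)"
  proof (induction k)
    case (Suc k)
    thus ?case using advance_reachable[OF advance_pow_in[OF p, of k]] by (simp add: rtranclp.rtrancl_into_rtrancl)
  qed simp
  obtain x s d where xsd: "(advance ^^ k) p = (x, s, d)" by (cases "(advance ^^ k) p")
  have st: "(x, s, d) \<in> states V" using advance_pow_in[OF p, of k] xsd by simp
  obtain r where r: "z = (x, frac (s + d * r))" "0 \<le> r" "r \<le> gap d s" using k by (auto simp: xsd)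
  show "z \<in> trajectory E \<omega> p"
  proof (cases "r = 0")
    case True
    hence "z = (x, s)" using st by (auto simp: r states_def)
    thus ?thesis using reach unfolding xsd trajectory_def by blast
  next
    case False
    hence "vertical E \<omega> (x, s, d) (x, frac (s + d * r), d)" using r vertical_step[OF st] by simp
    thus ?thesis using reach unfolding xsd r(1) trajectory_def by blast
  qed
qed

text \<open>Forward motion alone visits a whole class: on a finite set the injective map
  \<open>advance\<close> is onto, so the forward orbit is also closed under its inverse.\<close>

lemma trajectory_eq_class:
  assumes p: "p \<in> states V"
  shows "trajectory E \<omega> p = (\<Union>q \<in> same_loop `` {far_end p}. arc q)"
proof -
  let ?\<pi> = "far_end p"
  \<comment> \<open>Starting with \<open>advance p\<close> keeps \<open>F\<close> among the ends even if \<open>p\<close> lies between two cuts.\<close>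
  define F where "F = range (\<lambda>k. (advance ^^ Suc k) p)"
  have \<pi>: "?\<pi> \<in> arc_ends V" by (rule far_end_in[OF p])
  have FP: "F \<subseteq> arc_ends V"
    unfolding F_def using advance_in[OF advance_pow_in[OF p]] by auto
  have A: "far_end q \<in> arc_ends V" "far_end (far_end q) = q" if "q \<in> arc_ends V" for q
    using that far_end_in far_end_far_end arc_ends_states by blast+
  have fin: "finite F" using FP finite_arc_ends[OF finite_V] by (rule finite_subset)
  have sub: "advance ` F \<subseteq> F"
  proof
    fix q assume "q \<in> advance ` F"
    then obtain k where "q = advance ((advance ^^ Suc k) p)" by (auto simp: F_def)
    hence "q = (advance ^^ Suc (Suc k)) p" by simp
    thus "q \<in> F" unfolding F_def by blast
  qed
  have inj: "inj_on advance F"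
    unfolding advance_def
    by (rule inj_onI) (metis A FP subsetD switch_involution(3))
  \<comment> \<open>Injective on the finite set \<open>F\<close>, \<open>advance\<close> is onto: this supplies the predecessors in the orbit.\<close>
  have onto: "advance ` F = F" using endo_inj_surj[OF fin sub inj] .
  define O' where "O' = F \<union> far_end ` F"
  have A_O: "far_end q \<in> O'" if "q \<in> O'" for q using that A(2) FP by (fastforce simp: O'_def)
  have B_O: "switch q \<in> O'" if "q \<in> O'" for q
  proof -
    from that consider "q \<in> F" | q' where "q' \<in> F" "q = far_end q'" by (auto simp: O'_def)
    thus ?thesis
    proof cases
      case 1
      then obtain q' where q': "q' \<in> F" "q = advance q'" using onto by blast
      have "far_end q' \<in> arc_ends V" using q'(1) FP A(1) by blast
      from switch_involution(3)[OF this] have "switch q = far_end q'" by (simp add: q'(2) advance_def)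
      thus ?thesis using q' by (auto simp: O'_def)
    next
      case 2
      hence "switch q = advance q'" by (simp add: advance_def)
      thus ?thesis using 2 sub by (auto simp: O'_def)
    qed
  qed
  have \<pi>_O: "?\<pi> \<in> O'"
  proof -
    have "advance p \<in> F" by (auto simp: F_def intro!: image_eqI[of _ _ 0])
    hence "switch (advance p) \<in> O'" using B_O by (auto simp: O'_def)
    thus ?thesis using switch_involution(3)[OF \<pi>] by (simp add: advance_def)
  qed
  have F_class: "q \<in> same_loop `` {?\<pi>}" if "q \<in> F" for q
  proof -
    have "(?\<pi>, (advance ^^ Suc k) p) \<in> same_loop" for k
    proof (induction k)
      case 0
      show ?case using same_loop_switch[OF \<pi>] by (simp add: advance_def)
    next
      case (Suc k)
      have q: "(advance ^^ Suc k) p \<in> arc_ends V" using FP unfolding F_def by blast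
      have "((advance ^^ Suc k) p, (advance ^^ Suc (Suc k)) p) \<in> same_loop"
        using same_loop_trans[OF same_loop_far_end[OF q] same_loop_switch[OF A(1)[OF q]]]
        by (simp add: advance_def)
      thus ?case using Suc same_loop_trans by blast
    qed
    thus ?thesis using that by (auto simp: F_def)
  qed
  have cls: "same_loop `` {?\<pi>} = O'"
  proof (intro equalityI subsetI)
    fix q assume "q \<in> same_loop `` {?\<pi>}"
    hence "(?\<pi>, q) \<in> gen_equiv (arc_ends V) matchings" by (simp add: same_loop_def)
    note mem = this
    have inv: "r \<in> O' \<longleftrightarrow> r' \<in> O'" if "(r, r') \<in> matchings" for r r'
    proof -
      from that have "r \<in> arc_ends V" "r' = far_end r \<or> r' = switch r" by (auto simp: matchings_def)
      from this(2) show ?thesis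
      proof
        assume "r' = far_end r"
        thus ?thesis using A_O[of r] A_O[of r'] A(2)[OF \<open>r \<in> arc_ends V\<close>] by auto
      next
        assume "r' = switch r"
        thus ?thesis using B_O[of r] B_O[of r'] switch_involution(3)[OF \<open>r \<in> arc_ends V\<close>] by auto
      qed
    qed
    have "?\<pi> \<in> O' \<longleftrightarrow> q \<in> O'" by (rule gen_equiv_invariant[OF inv matchings_ends mem])
    thus "q \<in> O'" using \<pi>_O by simp
  next
    fix q assume "q \<in> O'"
    then consider "q \<in> F" | q' where "q' \<in> F" "q = far_end q'" by (auto simp: O'_def)
    thus "q \<in> same_loop `` {?\<pi>}"
    proof cases
      case 2
      have "(?\<pi>, q') \<in> same_loop" using F_class[OF 2(1)] by simp
      moreover have "(q', q) \<in> same_loop" using same_loop_far_end 2 FP by blast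
      ultimately show ?thesis using same_loop_trans by blast
    qed (rule F_class)
  qed
  have UO: "(\<Union>q\<in>O'. arc q) = (\<Union>q\<in>F. arc q)"
  proof -
    have "arc (far_end q) = arc q" if "q \<in> F" for q using arc_far_end that FP by blast
    thus ?thesis unfolding O'_def by simp
  qed
  have "(\<Union>k. arc ((advance ^^ k) p)) = arc p \<union> (\<Union>q\<in>F. arc q)"
  proof (intro equalityI subsetI)
    fix z assume "z \<in> (\<Union>k. arc ((advance ^^ k) p))"
    then obtain k where k: "z \<in> arc ((advance ^^ k) p)" by blast
    show "z \<in> arc p \<union> (\<Union>q\<in>F. arc q)"
    proof (cases k)
      case (Suc l)
      thus ?thesis using k by (auto simp: F_def)
    qed (use k in auto)
  next
    fix z assume "z \<in> arc p \<union> (\<Union>q\<in>F. arc q)"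
    thus "z \<in> (\<Union>k. arc ((advance ^^ k) p))"
    proof
      assume "z \<in> arc p"
      hence "z \<in> arc ((advance ^^ 0) p)" by simp
      thus ?thesis by blast
    next
      assume "z \<in> (\<Union>q\<in>F. arc q)"
      then obtain k where "z \<in> arc ((advance ^^ Suc k) p)" by (auto simp: F_def)
      thus ?thesis by blast
    qed
  qed
  also have "\<dots> = (\<Union>q\<in>O'. arc q)"
    using arc_subset_far_end[OF p] \<pi>_O by (auto simp: UO[symmetric])
  finally show ?thesis unfolding trajectory_arcs[OF p] cls .
qed

lemma union_of_arcs_inj:
  assumes "C \<in> arc_ends V // same_loop" "C' \<in> arc_ends V // same_loop"
    and eq: "(\<Union>q\<in>C. arc q) = (\<Union>q\<in>C'. arc q)"
  shows "C = C'"
proof -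
  obtain p where p: "p \<in> arc_ends V" "C = same_loop `` {p}" using assms(1) by (auto elim: quotientE)
  obtain z where z: "z \<in> arc p" and uniq: "\<forall>q \<in> arc_ends V. z \<in> arc q \<longrightarrow> q = p \<or> q = far_end p"
    using mid_arc_unique[OF p(1)] by blast
  have "z \<in> (\<Union>q\<in>C. arc q)" using z p same_loop_refl by blast
  then obtain q where q: "q \<in> C'" "z \<in> arc q" using eq by blast
  have qP: "q \<in> arc_ends V" using q(1) assms(2) equiv_same_loop by (metis Union_quotient UnionI)
  have "(p, q) \<in> same_loop" using uniq qP q(2) same_loop_refl same_loop_far_end p(1) by blast
  hence "q \<in> C" by (simp add: p(2))
  hence "C \<inter> C' \<noteq> {}" using q(1) by blast
  thus ?thesis using quotient_disj[OF equiv_same_loop assms(1,2)] by blast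
qed

lemma loops_eq: "loops V E \<omega> = (\<lambda>C. \<Union>q\<in>C. arc q) ` (arc_ends V // same_loop)"
proof -
  have "loops V E \<omega> = trajectory E \<omega> ` states V"
    unfolding loops_def states_def by (auto simp: image_iff) blast+
  also have "\<dots> = (\<lambda>p. \<Union>q \<in> same_loop `` {p}. arc q) ` far_end ` states V"
    unfolding image_image by (rule image_cong[OF refl trajectory_eq_class])
  also have "far_end ` states V = arc_ends V"
  proof
    show "far_end ` states V \<subseteq> arc_ends V" using far_end_in by blast
    show "arc_ends V \<subseteq> far_end ` states V"
    proof
      fix q assume q: "q \<in> arc_ends V"
      have "far_end q \<in> states V" using q far_end_in arc_ends_states by blast
      thus "q \<in> far_end ` states V" using far_end_far_end[OF q] by (metis imageI)
    qed
  qed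
  also have "(\<lambda>p. \<Union>q \<in> same_loop `` {p}. arc q) ` arc_ends V = (\<lambda>C. \<Union>q\<in>C. arc q) ` (arc_ends V // same_loop)"
    by (auto simp: quotient_def)
  finally show ?thesis .
qed

theorem num_loops_eq: "num_loops V E \<omega> = card (arc_ends V // same_loop)"
  unfolding num_loops_def loops_eq by (intro card_image inj_onI union_of_arcs_inj)

lemma num_loops_le: "num_loops V E \<omega> \<le> 2 * card V * card T"
proof -
  have "arc_ends V // same_loop = (\<lambda>p. same_loop `` {p}) ` arc_ends V" by (auto simp: quotient_def)
  hence "card (arc_ends V // same_loop) \<le> card (arc_ends V)"
    using card_image_le[OF finite_arc_ends[OF finite_V]] by simp
  thus ?thesis by (simp add: num_loops_eq card_arc_ends)
qed

lemma same_trajectory_iff: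
  assumes "p \<in> states V" "q \<in> states V"
  shows "trajectory E \<omega> p = trajectory E \<omega> q \<longleftrightarrow> (far_end p, far_end q) \<in> same_loop"
proof -
  note pq = assms[THEN far_end_in]
  have "trajectory E \<omega> p = trajectory E \<omega> q \<longleftrightarrow> same_loop `` {far_end p} = same_loop `` {far_end q}"
    unfolding assms[THEN trajectory_eq_class]
    by (rule iffI, erule union_of_arcs_inj[OF pq[THEN quotientI]], simp only:)
  also have "\<dots> \<longleftrightarrow> (far_end p, far_end q) \<in> same_loop"
    using eq_equiv_class_iff[OF equiv_same_loop pq] .
  finally show ?thesis .
qed

lemma same_trajectory_ends_iff:
  assumes "p \<in> arc_ends V" "q \<in> arc_ends V"
  shows "trajectory E \<omega> p = trajectory E \<omega> q \<longleftrightarrow> (p, q) \<in> same_loop"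
proof -
  have "p \<in> states V" "q \<in> states V" using assms arc_ends_states by blast+
  note iff = same_trajectory_iff[OF this] and pq = assms[THEN same_loop_far_end]
  have "(far_end p, far_end q) \<in> same_loop \<longleftrightarrow> (p, q) \<in> same_loop"
    using same_loop_trans[OF same_loop_trans[OF pq(1)] same_loop_sym[OF pq(2)]]
      same_loop_trans[OF same_loop_trans[OF same_loop_sym[OF pq(1)]] pq(2)] by (rule iffI)
  thus ?thesis using iff by simp
qed

end

section \<open>The effect of one more mark\<close>

text \<open>Separates the four ends in \<open>Q\<close> from the rest, which is common to the configurations with and
  without the new mark.\<close>

lemma gen_equiv_matching_pairs:
  assumes A: "\<And>p. p \<in> P \<Longrightarrow> A p \<in> P" and f: "\<And>p. p \<in> P \<Longrightarrow> f p \<in> P"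
    and Q: "Q = {p1, q1, p2, q2}" "Q \<subseteq> P"
    and pairs: "f p1 = q1" "f q1 = p1" "f p2 = q2" "f q2 = p2"
  shows "gen_equiv P ({(p, A p) | p. p \<in> P} \<union> {(p, f p) | p. p \<in> P}) =
    gen_equiv P (insert (p1, q1) (insert (p2, q2) ({(p, A p) | p. p \<in> P} \<union> {(p, f p) | p. p \<in> P - Q})))"
    (is "gen_equiv P ?M = gen_equiv P ?S")
proof (rule gen_equiv_eqI)
  show M: "?M \<subseteq> P \<times> P" using A f by blast
  show S: "?S \<subseteq> P \<times> P" using A f Q by blast
  have inc: "?S \<subseteq> gen_equiv P ?S" "?M \<subseteq> gen_equiv P ?M" by (rule gen_equiv_incl)+
  have "(q1, p1) \<in> gen_equiv P ?S" "(q2, p2) \<in> gen_equiv P ?S"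
    using equiv_gen_equiv[OF S] inc(1) by (auto elim!: equivE dest: symD)
  hence "(p, f p) \<in> gen_equiv P ?S" if "p \<in> Q" for p
    using that inc(1) pairs unfolding Q(1) by auto
  moreover have "(p, f p) \<in> gen_equiv P ?S" if "p \<in> P - Q" for p
    using that inc(1) by blast
  ultimately show "?M \<subseteq> gen_equiv P ?S" using inc(1) by blast
  have "?S \<subseteq> ?M" using Q pairs by blast
  thus "?S \<subseteq> gen_equiv P ?M" using inc(2) by blast
qed

lemma mark_times_insert:
  "e \<in> E \<Longrightarrow> mark_times E (\<omega> (e := insert (s, m) (\<omega> e))) = insert s (mark_times E \<omega>)"
  by (auto simp: mark_times_def image_iff)

lemma distinct_times_insert:
  assumes "distinct_times E \<omega>" "e \<in> E" "s \<notin> mark_times E \<omega>"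
  shows "distinct_times E (\<omega> (e := insert (s, m) (\<omega> e)))"
proof -
  have new: "(s, m') \<notin> \<omega> e'" if "e' \<in> E" for e' m'
    using assms(3) that by (force simp: mark_times_def)
  show ?thesis
    unfolding distinct_times_def
  proof (intro ballI allI impI)
    fix e1 e2 s' m1 m2
    assume e: "e1 \<in> E" "e2 \<in> E"
      and 1: "(s', m1) \<in> (\<omega> (e := insert (s, m) (\<omega> e))) e1"
      and 2: "(s', m2) \<in> (\<omega> (e := insert (s, m) (\<omega> e))) e2"
    show "e1 = e2 \<and> m1 = m2"
    proof (cases "s' = s")
      case True
      thus ?thesis using 1 2 new e by (auto split: if_splits)
    next
      case False
      hence "(s', m1) \<in> \<omega> e1" "(s', m2) \<in> \<omega> e2" using 1 2 by (auto split: if_splits)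
      thus ?thesis using assms(1) e unfolding distinct_times_def by blast
    qed
  qed
qed

text \<open>At time \<open>s\<close>, let \<open>a\<close>, \<open>b\<close> be the ends below and above \<open>(x, s)\<close>, and \<open>c\<close>, \<open>d\<close> those at \<open>(y, s)\<close>.
  Without a mark \<open>a\<close> is matched to \<open>b\<close> and \<open>c\<close> to \<open>d\<close>; a cross matches \<open>a\<close> to \<open>d\<close> and \<open>b\<close> to \<open>c\<close>; a bar
  matches \<open>a\<close> to \<open>c\<close> and \<open>b\<close> to \<open>d\<close>.\<close>

theorem
  fixes V :: "'v set"
  assumes graph: "simple_graph V E" and dist: "distinct_times E \<omega>"
    and fin: "finite (mark_times E \<omega>)" and circ: "mark_times E \<omega> \<subseteq> {0..<1}"
    and e: "{x, y} \<in> E" and s: "s \<in> {0..<1}" "s \<notin> mark_times E \<omega>"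
  defines "\<omega>' \<equiv> \<lambda>m. \<omega> ({x, y} := insert (s, m) (\<omega> {x, y}))"
  shows merge_loops: "trajectory E \<omega> (x, s, 1) \<noteq> trajectory E \<omega> (y, s, 1) \<Longrightarrow>
        num_loops V E (\<omega>' m) + 1 \<le> num_loops V E \<omega>"
    and split_loop: "\<exists>m. num_loops V E (\<omega>' m) \<le> num_loops V E \<omega> + 1 \<and>
        (\<forall>m'. m' \<noteq> m \<longrightarrow> num_loops V E (\<omega>' m') \<le> num_loops V E \<omega>)"
proof -
  define T where "T = insert s (mark_times E \<omega>)"
  interpret cut_circle T
    by unfold_locales (use fin circ s in \<open>auto simp: T_def\<close>)
  interpret O: cut_configuration T V E \<omega>
    by unfold_locales (use graph dist in \<open>auto simp: T_def\<close>)
  have conf: "cut_configuration T V E (\<omega>' m)" for m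
    by unfold_locales
      (use graph distinct_times_insert[OF dist e s(2)] mark_times_insert[OF e] in \<open>auto simp: T_def \<omega>'_def\<close>)
  interpret C: cut_configuration T V E "\<omega>' Cross" by (rule conf)
  interpret B: cut_configuration T V E "\<omega>' Bar" by (rule conf)
  note xy = O.edge_cases[OF e]
  let ?P = "arc_ends V" and ?a = "(x, s, -1) :: 'v state" and ?b = "(x, s, 1) :: 'v state"
    and ?c = "(y, s, -1) :: 'v state" and ?d = "(y, s, 1) :: 'v state"
  let ?Q = "{?a, ?b, ?c, ?d}"
  let ?A = "{(p, far_end p) | p. p \<in> ?P}"
  define R where "R = ?A \<union> {(p, O.switch p) | p. p \<in> ?P - ?Q}"
  have "s \<in> T" by (simp add: T_def)
  hence QP: "?a \<in> ?P" "?b \<in> ?P" "?c \<in> ?P" "?d \<in> ?P" using xy by (auto simp: arc_ends_def)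
  have AP: "far_end p \<in> ?P \<and> far_end p \<noteq> p \<and> far_end (far_end p) = p" if "p \<in> ?P" for p
    using that far_end_in far_end_neq far_end_far_end arc_ends_states by blast
  have O_um: "\<not> marked E \<omega> z s" for z using s(2) marked_in_mark_times by metis
  have O_sw: "O.switch (z, s, d) = (z, s, - d)" for z d by (rule O.switch_unmarked[OF O_um])
  have new: "(s, m) \<in> \<omega>' m {x, y}" for m by (simp add: \<omega>'_def)
  hence new': "(s, m) \<in> \<omega>' m {y, x}" for m by (simp add: insert_commute)
  have e': "{y, x} \<in> E" using e by (simp add: insert_commute)
  have C_sw: "C.switch (x, s, d) = (y, s, - d)" "C.switch (y, s, d) = (x, s, - d)" for d
    using C.switch_marked[OF e new] C.switch_marked[OF e' new'] by auto
  have B_sw: "B.switch (x, s, d) = (y, s, d)" "B.switch (y, s, d) = (x, s, d)" for d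
    using B.switch_marked[OF e new] B.switch_marked[OF e' new'] by auto
  have jump_eq: "jump E (\<omega>' m) (z, t, d) q \<longleftrightarrow> jump E \<omega> (z, t, d) q" if "t \<noteq> s \<or> z \<notin> {x, y}" for m z t d q
  proof -
    have "(t, m') \<in> \<omega>' m {z, z'} \<longleftrightarrow> (t, m') \<in> \<omega> {z, z'}" for z' m'
    proof (cases "{z, z'} = {x, y}")
      case True
      hence "t \<noteq> s" using that by auto
      thus ?thesis by (simp add: \<omega>'_def True)
    qed (simp add: \<omega>'_def)
    hence "marked E (\<omega>' m) z t \<longleftrightarrow> marked E \<omega> z t"
      and "\<And>z' d'. jump E (\<omega>' m) (z, t, d) (z', t, d') \<longleftrightarrow> jump E \<omega> (z, t, d) (z', t, d')"
      by (auto simp: marked_def)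
    thus ?thesis by (cases q) (auto split: if_splits)
  qed
  have off: "C.switch p = O.switch p" "B.switch p = O.switch p" if p: "p \<in> ?P - ?Q" for p
  proof -
    obtain z t d where pf: "p = (z, t, d)" by (cases p)
    have "t \<noteq> s \<or> z \<notin> {x, y}" using p by (auto simp: pf arc_ends_def)
    note je = jump_eq[OF this]
    show "C.switch p = O.switch p" "B.switch p = O.switch p"
      unfolding C.switch_def B.switch_def O.switch_def pf fst_conv snd_conv je by (rule refl)+
  qed
  have im: "{(p, g p) | p. p \<in> S} = (\<lambda>p. (p, g p)) ` S" for g :: "'v state \<Rightarrow> 'v state" and S
    by blast
  have offR: "{(p, C.switch p) | p. p \<in> ?P - ?Q} = {(p, O.switch p) | p. p \<in> ?P - ?Q}"
    "{(p, B.switch p) | p. p \<in> ?P - ?Q} = {(p, O.switch p) | p. p \<in> ?P - ?Q}"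
    unfolding im by (rule image_cong[OF refl], simp only: off)+
  have r1: "O.same_loop = gen_equiv ?P (insert (?a, ?b) (insert (?c, ?d) R))"
    unfolding O.same_loop_def O.matchings_def R_def
    by (rule gen_equiv_matching_pairs) (use AP O.switch_involution(1) QP O_sw in auto)
  have r2: "C.same_loop = gen_equiv ?P (insert (?a, ?d) (insert (?b, ?c) R))"
    unfolding C.same_loop_def C.matchings_def R_def offR(1)[symmetric]
    by (rule gen_equiv_matching_pairs) (use AP C.switch_involution(1) QP C_sw in auto)
  have r3: "B.same_loop = gen_equiv ?P (insert (?a, ?c) (insert (?b, ?d) R))"
    unfolding B.same_loop_def B.matchings_def R_def offR(2)[symmetric]
    by (rule gen_equiv_matching_pairs) (use AP B.switch_involution(1) QP B_sw in auto)
  have finP: "finite ?P" by (rule finite_arc_ends[OF O.finite_V])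
  have offQ: "O.switch p \<in> ?P - ?Q \<and> O.switch p \<noteq> p \<and> O.switch (O.switch p) = p" if p: "p \<in> ?P - ?Q" for p
  proof -
    have pP: "p \<in> ?P" using p by blast
    have "O.switch p \<notin> ?Q"
    proof
      assume "O.switch p \<in> ?Q"
      hence "O.switch (O.switch p) \<in> ?Q" using O_sw by auto
      thus False using O.switch_involution(3)[OF pP] p by simp
    qed
    thus ?thesis using O.switch_involution[OF pP] by blast
  qed
  have RP: "R \<subseteq> ?P \<times> ?P" using AP offQ unfolding R_def by blast
  have dQ: "distinct [?a, ?b, ?c, ?d]" using xy by auto
  note pairing = four_ends_paired[OF finP AP offQ QP dQ R_def]
  note count = rematch_four_ends[OF finP RP QP pairing, folded r1 r2 r3,
      folded O.num_loops_eq C.num_loops_eq B.num_loops_eq]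
  show "num_loops V E (\<omega>' m) + 1 \<le> num_loops V E \<omega>"
    if "trajectory E \<omega> (x, s, 1) \<noteq> trajectory E \<omega> (y, s, 1)"
    using count(1) that O.same_trajectory_ends_iff[OF QP(2,4)] by (cases m) auto
  show "\<exists>m. num_loops V E (\<omega>' m) \<le> num_loops V E \<omega> + 1 \<and>
        (\<forall>m'. m' \<noteq> m \<longrightarrow> num_loops V E (\<omega>' m') \<le> num_loops V E \<omega>)"
    using count(2)
  proof
    assume "num_loops V E (\<omega>' Cross) \<le> num_loops V E \<omega> + 1 \<and> num_loops V E (\<omega>' Bar) \<le> num_loops V E \<omega>"
    thus ?thesis by (intro exI[of _ Cross]) (metis mark.exhaust)
  next
    assume "num_loops V E (\<omega>' Cross) \<le> num_loops V E \<omega> \<and> num_loops V E (\<omega>' Bar) \<le> num_loops V E \<omega> + 1"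
    thus ?thesis by (intro exI[of _ Bar]) (metis mark.exhaust)
  qed
qed

text \<open>The bound is linear in the number of marks, so \<open>\<theta>\<close> to the number of loops grows at most
  exponentially with it and has a finite mean.\<close>

lemma num_loops_le_mark_times:
  fixes V :: "'v set"
  assumes graph: "simple_graph V E" and dist: "distinct_times E \<omega>"
    and fin: "finite (mark_times E \<omega>)" and circ: "mark_times E \<omega> \<subseteq> {0..<1}"
  shows "num_loops V E \<omega> \<le> 2 * card V * (card (mark_times E \<omega>) + 1)"
proof -
  define T where "T = insert 0 (mark_times E \<omega>)"
  interpret cut_circle T
    by unfold_locales (use fin circ in \<open>auto simp: T_def\<close>)
  interpret cut_configuration T V E \<omega>
    by unfold_locales (use graph dist in \<open>auto simp: T_def\<close>)
  have "card T \<le> card (mark_times E \<omega>) + 1" using fin by (simp add: T_def card_insert_if)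
  hence "2 * card V * card T \<le> 2 * card V * (card (mark_times E \<omega>) + 1)" by (rule mult_le_mono2)
  thus ?thesis using num_loops_le by linarith
qed

text \<open>For \<open>f x\<close> the loop through \<open>x\<close> at a fixed time, this counts the edges whose ends share a loop.
  Such an edge lies within one class of \<open>f\<close>, and the classes partition \<open>V\<close>.\<close>

lemma edges_in_small_classes:
  fixes f :: "'v \<Rightarrow> 'b"
  assumes graph: "simple_graph V E"
    and sparse: "\<And>a. a \<in> f ` V \<Longrightarrow> real (edges_within E {x \<in> V. f x = a}) \<le> K * real (card {x \<in> V. f x = a})"
  shows "real (card {e \<in> E. \<exists>a. \<forall>x\<in>e. f x = a}) \<le> K * real (card V)"
proof -
  let ?S = "\<lambda>a. {x \<in> V. f x = a}"
  have V: "finite V" and EV: "\<And>e. e \<in> E \<Longrightarrow> e \<subseteq> V" and e2: "\<And>e. e \<in> E \<Longrightarrow> card e = 2"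
    using graph by (auto simp: simple_graph_def)
  have "finite E" using V EV by (meson finite_Pow_iff finite_subset Pow_iff subsetI)
  have ne: "e \<noteq> {}" if "e \<in> E" for e using e2[OF that] by auto
  have "{e \<in> E. \<exists>a. \<forall>x\<in>e. f x = a} = (\<Union>a\<in>f ` V. {e \<in> E. e \<subseteq> (?S a)})"
  proof (intro equalityI subsetI)
    fix e assume "e \<in> {e \<in> E. \<exists>a. \<forall>x\<in>e. f x = a}"
    then obtain a where e: "e \<in> E" "\<forall>x\<in>e. f x = a" by blast
    then obtain x where "x \<in> e" using ne by blast
    have "e \<subseteq> (?S a)" using e EV by auto
    moreover have "a \<in> f ` V" using \<open>x \<in> e\<close> calculation by blast
    ultimately have "a \<in> f ` V" "e \<subseteq> (?S a)" by blast+
    thus "e \<in> (\<Union>a\<in>f ` V. {e \<in> E. e \<subseteq> (?S a)})" using e by blast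
  qed blast
  hence "card {e \<in> E. \<exists>a. \<forall>x\<in>e. f x = a} \<le> (\<Sum>a\<in>f ` V. edges_within E (?S a))"
    unfolding edges_within_def using card_UN_le[of "f ` V"] V by simp
  hence "real (card {e \<in> E. \<exists>a. \<forall>x\<in>e. f x = a}) \<le> real (\<Sum>a\<in>f ` V. edges_within E (?S a))"
    by (rule of_nat_mono)
  also have "\<dots> = (\<Sum>a\<in>f ` V. real (edges_within E (?S a)))" by simp
  also have "\<dots> \<le> (\<Sum>a\<in>f ` V. K * real (card (?S a)))" by (rule sum_mono[OF sparse])
  also have "\<dots> = K * real (\<Sum>a\<in>f ` V. card (?S a))" by (simp add: sum_distrib_left)
  also have "(\<Sum>a\<in>f ` V. card (?S a)) = card V"
    using sum.image_gen[OF V, of "\<lambda>_. 1::nat" f] by simp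
  finally show ?thesis .
qed

section \<open>Time changes and measurability\<close>

text \<open>Lifts to the real line of the increasing bijections of the circle that fix \<open>0\<close>; the lift lets
  motion that winds around the circle be treated as motion on the line.\<close>

definition time_change :: "(real \<Rightarrow> real) \<Rightarrow> bool" where
  "time_change \<Phi> \<longleftrightarrow> strict_mono \<Phi> \<and> surj \<Phi> \<and> \<Phi> 0 = 0 \<and> (\<forall>x. \<Phi> (x + 1) = \<Phi> x + 1)"

lemma time_change_inv:
  assumes "time_change \<Phi>"
  shows "time_change (inv \<Phi>)"
proof -
  have m: "strict_mono \<Phi>" and s: "surj \<Phi>" and z: "\<Phi> 0 = 0" and p: "\<And>x. \<Phi> (x + 1) = \<Phi> x + 1"
    using assms by (auto simp: time_change_def)
  have i: "inj \<Phi>" by (rule strict_mono_imp_inj_on[OF m])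
  have "strict_mono (inv \<Phi>)"
    by (rule strict_monoI) (metis m s strict_mono_less surj_f_inv_f)
  moreover have "surj (inv \<Phi>)" by (rule inj_imp_surj_inv[OF i])
  moreover have "inv \<Phi> 0 = 0" by (metis i inv_f_f z)
  moreover have "inv \<Phi> (x + 1) = inv \<Phi> x + 1" for x
    using p[of "inv \<Phi> x"] by (metis i inv_f_f s surj_f_inv_f)
  ultimately show ?thesis by (simp add: time_change_def)
qed

lemma time_change_frac:
  assumes "time_change \<Phi>"
  shows "\<Phi> (frac x) = frac (\<Phi> x)"
proof -
  have m: "strict_mono \<Phi>" and z: "\<Phi> 0 = 0" and p: "\<And>x. \<Phi> (x + 1) = \<Phi> x + 1"
    using assms by (auto simp: time_change_def)
  have nat: "\<Phi> (y + real n) = \<Phi> y + real n" for y n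
  proof (induction n)
    case (Suc n)
    have "y + real (Suc n) = (y + real n) + 1" by simp
    hence "\<Phi> (y + real (Suc n)) = \<Phi> (y + real n) + 1" by (simp only: p)
    thus ?case using Suc by simp
  qed simp
  have int: "\<Phi> (y + of_int k) = \<Phi> y + of_int k" for y k
  proof (cases k)
    case (nonneg n)
    thus ?thesis using nat by simp
  next
    case (neg n)
    hence "real (Suc n) = - of_int k" by simp
    thus ?thesis using nat[of "y + of_int k" "Suc n"] by simp
  qed
  have "\<Phi> x = \<Phi> (frac x) + of_int \<lfloor>x\<rfloor>" using int[of "frac x" "\<lfloor>x\<rfloor>"] by (simp add: frac_def)
  moreover have "\<Phi> 0 \<le> \<Phi> (frac x)" "\<Phi> (frac x) < \<Phi> (0 + 1)"
    using m by (simp_all add: strict_mono_less strict_mono_less_eq frac_lt_1)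
  ultimately show ?thesis unfolding p z by (intro frac_unique_iff[THEN iffD2, symmetric]) auto
qed

lemma time_change_circle:
  assumes "time_change \<Phi>"
  shows "\<Phi> s \<in> {0..<1} \<longleftrightarrow> s \<in> {0..<1}"
proof -
  have m: "strict_mono \<Phi>" and z: "\<Phi> 0 = 0" and p: "\<And>x. \<Phi> (x + 1) = \<Phi> x + 1"
    using assms by (auto simp: time_change_def)
  have "\<Phi> 1 = 1" using p[of 0] z by simp
  thus ?thesis using strict_mono_less_eq[OF m, of 0 s] strict_mono_less[OF m, of s 1] z by simp
qed

lemma time_change_image_circle:
  assumes "time_change \<Phi>"
  shows "\<Phi> ` {0..<1} = {0..<1}"
proof (intro equalityI subsetI)
  fix s :: real assume s: "s \<in> {0..<1}"
  obtain r where "s = \<Phi> r" using assms unfolding time_change_def by (metis surjD)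
  thus "s \<in> \<Phi> ` {0..<1}" using s time_change_circle[OF assms] by blast
qed (use time_change_circle[OF assms] in blast)

definition retimed :: "'v set set \<Rightarrow> (real \<Rightarrow> real) \<Rightarrow> 'v config \<Rightarrow> 'v config \<Rightarrow> bool" where
  "retimed E \<Phi> \<omega> \<omega>' \<longleftrightarrow> (\<forall>e\<in>E. \<omega>' e = map_prod \<Phi> id ` \<omega> e)"

lemma retimed_inv:
  assumes "time_change \<Phi>" "retimed E \<Phi> \<omega> \<omega>'"
  shows "retimed E (inv \<Phi>) \<omega>' \<omega>"
proof -
  have i: "inj \<Phi>" using assms strict_mono_imp_inj_on unfolding time_change_def by blast
  have "map_prod (inv \<Phi>) id (map_prod \<Phi> id z) = z" for z :: "real \<times> mark"
    using i by (cases z) simp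
  thus ?thesis using assms(2) by (simp add: retimed_def image_image)
qed

lemma retimed_mem:
  assumes "time_change \<Phi>" "retimed E \<Phi> \<omega> \<omega>'" "e \<in> E"
  shows "(\<Phi> s, m) \<in> \<omega>' e \<longleftrightarrow> (s, m) \<in> \<omega> e"
proof -
  have i: "inj \<Phi>" using assms strict_mono_imp_inj_on unfolding time_change_def by blast
  show ?thesis using assms(2,3) i by (auto simp: retimed_def inj_eq intro: image_eqI[of _ _ "(s, m)"])
qed

lemma retimed_marked:
  assumes "time_change \<Phi>" "retimed E \<Phi> \<omega> \<omega>'"
  shows "marked E \<omega>' x (\<Phi> s) \<longleftrightarrow> marked E \<omega> x s"
  using retimed_mem[OF assms] unfolding marked_def by blast

fun retime_state :: "(real \<Rightarrow> real) \<Rightarrow> 'v state \<Rightarrow> 'v state" where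
  "retime_state \<Phi> (x, s, d) = (x, \<Phi> s, d)"

lemma retime_vertical:
  assumes \<Phi>: "time_change \<Phi>" "retimed E \<Phi> \<omega> \<omega>'" and d: "snd (snd p) \<in> {-1, 1}"
    and v: "vertical E \<omega> p q"
  shows "vertical E \<omega>' (retime_state \<Phi> p) (retime_state \<Phi> q)"
proof -
  obtain x s d where p: "p = (x, s, d)" by (cases p)
  have d: "d \<in> {-1, 1}" using d p by simp
  from v obtain r where r: "0 < r" "q = (x, frac (s + d * r), d)"
    and free: "\<And>h. 0 < h \<Longrightarrow> h < r \<Longrightarrow> \<not> marked E \<omega> x (frac (s + d * h))"
    by (cases q) (auto simp: p)
  have m: "\<And>a b. \<Phi> a < \<Phi> b \<longleftrightarrow> a < b" using \<Phi>(1) by (simp add: time_change_def strict_mono_less)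
  define r' where "r' = d * (\<Phi> (s + d * r) - \<Phi> s)"
  have dd: "d * (d * z) = z" for z using d by auto
  have "0 < r'" using d r(1) by (auto simp: r'_def m)
  moreover have "\<Phi> (frac (s + d * r)) = frac (\<Phi> s + d * r')"
    by (simp add: r'_def dd time_change_frac[OF \<Phi>(1)])
  moreover have "\<not> marked E \<omega>' x (frac (\<Phi> s + d * h'))" if h': "0 < h'" "h' < r'" for h'
  proof -
    obtain y where y: "\<Phi> s + d * h' = \<Phi> y" using \<Phi>(1) unfolding time_change_def by (metis surjD)
    have "0 < d * (y - s) \<and> d * (y - s) < r"
      using d h' y m[of s y] m[of y s] m[of y "s + r"] m[of "s - r" y] unfolding r'_def by auto
    from free[OF this[THEN conjunct1] this[THEN conjunct2]] have "\<not> marked E \<omega> x (frac y)"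
      by (simp add: dd)
    thus ?thesis unfolding y time_change_frac[OF \<Phi>(1), symmetric] retimed_marked[OF \<Phi>] .
  qed
  ultimately show ?thesis unfolding p r(2) retime_state.simps vertical.simps by blast
qed

lemma retime_jump:
  assumes \<Phi>: "time_change \<Phi>" "retimed E \<Phi> \<omega> \<omega>'" and j: "jump E \<omega> p q"
  shows "jump E \<omega>' (retime_state \<Phi> p) (retime_state \<Phi> q)"
proof -
  obtain x s d x' s' d' where pq: "p = (x, s, d)" "q = (x', s', d')" by (cases p, cases q)
  have "{x, x'} \<in> E \<and> (\<Phi> s, m) \<in> \<omega>' {x, x'} \<longleftrightarrow> {x, x'} \<in> E \<and> (s, m) \<in> \<omega> {x, x'}" for m
    using retimed_mem[OF \<Phi>] by blast
  hence eq: "(\<exists>m. {x, x'} \<in> E \<and> (\<Phi> s, m) \<in> \<omega>' {x, x'} \<and> d' = (case m of Cross \<Rightarrow> d | Bar \<Rightarrow> - d)) \<longleftrightarrow>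
     (\<exists>m. {x, x'} \<in> E \<and> (s, m) \<in> \<omega> {x, x'} \<and> d' = (case m of Cross \<Rightarrow> d | Bar \<Rightarrow> - d))" by blast
  have "s' = s" and c: "if marked E \<omega> x s
      then \<exists>m. {x, x'} \<in> E \<and> (s, m) \<in> \<omega> {x, x'} \<and> d' = (case m of Cross \<Rightarrow> d | Bar \<Rightarrow> - d)
      else x' = x \<and> d' = d"
    using j unfolding pq jump.simps by blast+
  thus ?thesis unfolding pq retime_state.simps jump.simps retimed_marked[OF \<Phi>] eq by blast
qed

lemma retime_trajectory_subset:
  assumes \<Phi>: "time_change \<Phi>" "retimed E \<Phi> \<omega> \<omega>'" and d: "snd (snd p) \<in> {-1, 1}"
  shows "map_prod id \<Phi> ` trajectory E \<omega> p \<subseteq> trajectory E \<omega>' (retime_state \<Phi> p)"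
proof
  have dir: "snd (snd q) \<in> {-1, 1} \<and> (vertical E \<omega>' OO jump E \<omega>')\<^sup>*\<^sup>* (retime_state \<Phi> p) (retime_state \<Phi> q)"
    if "(vertical E \<omega> OO jump E \<omega>)\<^sup>*\<^sup>* p q" for q
    using that
  proof (induction rule: rtranclp_induct)
    case (step q q')
    then obtain q1 where v: "vertical E \<omega> q q1" and j: "jump E \<omega> q1 q'" by blast
    have dq: "snd (snd q) \<in> {-1, 1}" using step.IH by blast
    have "snd (snd q1) = snd (snd q)" using v by (cases q; cases q1) simp
    moreover have "snd (snd q') \<in> {snd (snd q1), - snd (snd q1)}"
    proof -
      have "(case m of Cross \<Rightarrow> d | Bar \<Rightarrow> - d) \<in> {d, - d}" for m and d :: real by (cases m) auto
      thus ?thesis using j by (cases q1; cases q') (auto split: if_splits)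
    qed
    ultimately have "snd (snd q') \<in> {-1, 1}" using dq by auto
    moreover have "(vertical E \<omega>' OO jump E \<omega>') (retime_state \<Phi> q) (retime_state \<Phi> q')"
      using retime_vertical[OF \<Phi> dq v] retime_jump[OF \<Phi> j] by blast
    ultimately show ?case using step.IH by (meson rtranclp.rtrancl_into_rtrancl)
  qed (use d in simp)
  fix z assume "z \<in> map_prod id \<Phi> ` trajectory E \<omega> p"
  then obtain x s where z: "z = (x, \<Phi> s)" and xs: "(x, s) \<in> trajectory E \<omega> p" by auto
  from xs obtain q d where q: "(vertical E \<omega> OO jump E \<omega>)\<^sup>*\<^sup>* p q"
    and or: "q = (x, s, d) \<or> vertical E \<omega> q (x, s, d)"
    unfolding trajectory_def by blast
  have "retime_state \<Phi> q = (x, \<Phi> s, d) \<or> vertical E \<omega>' (retime_state \<Phi> q) (x, \<Phi> s, d)"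
    using or retime_vertical[OF \<Phi>, of q "(x, s, d)"] dir[OF q] by auto
  thus "z \<in> trajectory E \<omega>' (retime_state \<Phi> p)"
    using dir[OF q] unfolding trajectory_def z by blast
qed

text \<open>The inclusion above, applied to \<open>\<Phi>\<close> and to its inverse.\<close>

lemma retime_trajectory:
  assumes \<Phi>: "time_change \<Phi>" "retimed E \<Phi> \<omega> \<omega>'" and d: "d \<in> {-1, 1}"
  shows "trajectory E \<omega>' (x, \<Phi> s, d) = map_prod id \<Phi> ` trajectory E \<omega> (x, s, d)"
proof
  have i: "inj \<Phi>" and su: "surj \<Phi>"
    using \<Phi>(1) strict_mono_imp_inj_on unfolding time_change_def by blast+
  show "map_prod id \<Phi> ` trajectory E \<omega> (x, s, d) \<subseteq> trajectory E \<omega>' (x, \<Phi> s, d)"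
    using retime_trajectory_subset[OF \<Phi>, of "(x, s, d)"] d by simp
  have "map_prod id (inv \<Phi>) ` trajectory E \<omega>' (x, \<Phi> s, d) \<subseteq> trajectory E \<omega> (x, s, d)"
    using retime_trajectory_subset[OF time_change_inv[OF \<Phi>(1)] retimed_inv[OF \<Phi>], of "(x, \<Phi> s, d)"] d i
    by simp
  hence "map_prod id \<Phi> ` map_prod id (inv \<Phi>) ` trajectory E \<omega>' (x, \<Phi> s, d) \<subseteq> map_prod id \<Phi> ` trajectory E \<omega> (x, s, d)"
    by (rule image_mono)
  moreover have "map_prod id \<Phi> (map_prod id (inv \<Phi>) z) = z" for z :: "'a \<times> real"
    using surj_f_inv_f[OF su] by (cases z) simp
  ultimately show "trajectory E \<omega>' (x, \<Phi> s, d) \<subseteq> map_prod id \<Phi> ` trajectory E \<omega> (x, s, d)"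
    by (simp add: image_image)
qed

lemma retime_loops:
  assumes \<Phi>: "time_change \<Phi>" "retimed E \<Phi> \<omega> \<omega>'"
  shows "loops V E \<omega>' = image (map_prod id \<Phi>) ` loops V E \<omega>"
proof -
  have "loops V E \<omega>' = {trajectory E \<omega>' (x, \<Phi> s, d) | x s d. x \<in> V \<and> s \<in> {0..<1} \<and> d \<in> {-1, 1}}"
    unfolding loops_def using time_change_image_circle[OF \<Phi>(1)] by (smt (verit) Collect_cong image_iff)
  also have "\<dots> = image (map_prod id \<Phi>) ` loops V E \<omega>"
    unfolding loops_def using retime_trajectory[OF \<Phi>] by blast
  finally show ?thesis .
qed

lemma retime_num_loops:
  assumes \<Phi>: "time_change \<Phi>" "retimed E \<Phi> \<omega> \<omega>'"
  shows "num_loops V E \<omega>' = num_loops V E \<omega>"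
proof -
  have "inj \<Phi>" using \<Phi>(1) strict_mono_imp_inj_on unfolding time_change_def by blast
  hence "inj (map_prod id \<Phi> :: 'a \<times> real \<Rightarrow> 'a \<times> real)" by (intro prod.inj_map) auto
  hence "inj (image (map_prod id \<Phi> :: 'a \<times> real \<Rightarrow> 'a \<times> real))" by (simp add: inj_image_eq_iff inj_on_def)
  thus ?thesis unfolding num_loops_def retime_loops[OF \<Phi>] by (metis card_image inj_on_subset subset_UNIV)
qed

lemma retime_loop_support:
  assumes "time_change \<Phi>"
  shows "loop_support V (map_prod id \<Phi> ` \<gamma>) = loop_support V \<gamma>"
proof -
  have i: "inj \<Phi>" using assms strict_mono_imp_inj_on unfolding time_change_def by blast
  have "(\<exists>s\<in>{0..<1}. (x, s) \<in> map_prod id \<Phi> ` \<gamma>) \<longleftrightarrow> (\<exists>s\<in>{0..<1}. (x, s) \<in> \<gamma>)" for x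
  proof -
    have "(\<exists>s\<in>{0..<1}. (x, s) \<in> map_prod id \<Phi> ` \<gamma>) \<longleftrightarrow> (\<exists>s\<in>{0..<1}. (x, \<Phi> s) \<in> map_prod id \<Phi> ` \<gamma>)"
      using time_change_image_circle[OF assms] by (metis (no_types, lifting) image_iff)
    moreover have "(x, \<Phi> s) \<in> map_prod id \<Phi> ` \<gamma> \<longleftrightarrow> (x, s) \<in> \<gamma>" for s
      using i by (auto simp: inj_eq intro: image_eqI[of _ _ "(x, s)"])
    ultimately show ?thesis by (simp only:)
  qed
  thus ?thesis by (simp add: loop_support_def)
qed

definition time_invariant :: "'v set set \<Rightarrow> ('v config \<Rightarrow> bool) \<Rightarrow> bool" where
  "time_invariant E P \<longleftrightarrow> (\<forall>\<Phi> \<omega> \<omega>'. time_change \<Phi> \<longrightarrow> retimed E \<Phi> \<omega> \<omega>' \<longrightarrow> P \<omega>' = P \<omega>)"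

lemma time_invariant_num_loops: "time_invariant E (\<lambda>\<omega>. Q (num_loops V E \<omega>))"
  unfolding time_invariant_def using retime_num_loops by metis

lemma time_invariant_large_loop:
  "time_invariant E (\<lambda>\<omega>. \<exists>\<gamma>\<in>loops V E \<omega>. real (card (loop_support V \<gamma>)) > K)"
  unfolding time_invariant_def by (auto simp: retime_loops retime_loop_support)

lemma time_invariant_distinct_times: "time_invariant E (distinct_times E)"
proof -
  have "distinct_times E \<omega>" if \<Phi>: "time_change \<Phi>" "retimed E \<Phi> \<omega> \<omega>'" and d: "distinct_times E \<omega>'"
    for \<Phi> \<omega> \<omega>'
    using d retimed_mem[OF \<Phi>] unfolding distinct_times_def by metis
  thus ?thesis unfolding time_invariant_def by (metis time_change_inv retimed_inv)
qed

subsection \<open>Discretisation\<close>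

text \<open>A time on the grid stays, any other time moves to the middle of its cell.  Such a move extends to
  an increasing bijection of each cell, as long as no two times share a cell; moving
  all times of a cell to its left end would not.\<close>

definition grid :: "nat \<Rightarrow> real \<Rightarrow> real" where
  "grid N t = (of_int \<lfloor>real N * t\<rfloor> + (if real N * t = of_int \<lfloor>real N * t\<rfloor> then 0 else 1 / 2)) / real N"

text \<open>Each cell, rescaled to \<open>{0..<1}\<close>, is mapped by \<open>y \<mapsto> y powr p\<close>, with \<open>p\<close> chosen such that the time in
  that cell goes to \<open>1 / 2\<close>.\<close>

lemma exists_time_change_to_grid:
  assumes S: "S \<subseteq> {0..<1}" and N: "0 < N"
    and sep: "\<And>t t'. t \<in> S \<Longrightarrow> t' \<in> S \<Longrightarrow> \<lfloor>real N * t\<rfloor> = \<lfloor>real N * t'\<rfloor> \<Longrightarrow> t = t'"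
  shows "\<exists>\<Phi>. time_change \<Phi> \<and> (\<forall>t\<in>S. \<Phi> t = grid N t)"
proof -
  have "\<exists>p>0. \<forall>t\<in>S. \<lfloor>real N * t\<rfloor> = j \<longrightarrow> frac (real N * t) \<noteq> 0 \<longrightarrow> frac (real N * t) powr p = 1 / 2" for j
  proof (cases "\<exists>t\<in>S. \<lfloor>real N * t\<rfloor> = j \<and> frac (real N * t) \<noteq> 0")
    case True
    then obtain t where t: "t \<in> S" "\<lfloor>real N * t\<rfloor> = j" "frac (real N * t) \<noteq> 0" by blast
    define c where "c = frac (real N * t)"
    have c: "0 < c" "c < 1" using t(3) frac_lt_1[of "real N * t"] frac_ge_0[of "real N * t"]
      unfolding c_def by linarith+
    have "c powr (ln (1 / 2) / ln c) = 1 / 2" using c by (simp add: powr_def)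
    moreover have "0 < ln (1 / 2) / ln c" using c by (intro divide_neg_neg) auto
    ultimately show ?thesis using t(1,2) sep unfolding c_def by metis
  qed (auto intro: exI[of _ 1])
  then obtain p where p: "\<And>j. 0 < p j" "\<And>j t. t \<in> S \<Longrightarrow> \<lfloor>real N * t\<rfloor> = j \<Longrightarrow>
      frac (real N * t) \<noteq> 0 \<Longrightarrow> frac (real N * t) powr p j = 1 / 2"
    by metis
  define \<Phi> where "\<Phi> x = (of_int \<lfloor>real N * x\<rfloor> + frac (real N * x) powr p (\<lfloor>real N * x\<rfloor> mod int N)) / real N" for x
  have fp: "0 \<le> frac y powr q" "frac y powr q < 1" if "0 < q" for y q :: real
    using powr_less_mono2[OF that frac_ge_0 frac_lt_1[of y]] by auto
  have "strict_mono \<Phi>"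
  proof (rule strict_monoI)
    fix x y :: real assume xy: "x < y"
    hence lt: "real N * x < real N * y" using N by simp
    have "of_int \<lfloor>real N * x\<rfloor> + frac (real N * x) powr p (\<lfloor>real N * x\<rfloor> mod int N)
        < of_int \<lfloor>real N * y\<rfloor> + frac (real N * y) powr p (\<lfloor>real N * y\<rfloor> mod int N)"
    proof (cases "\<lfloor>real N * x\<rfloor> = \<lfloor>real N * y\<rfloor>")
      case True
      hence "frac (real N * x) < frac (real N * y)" using lt by (simp add: frac_def)
      thus ?thesis unfolding True using p(1) by (simp add: powr_less_mono2)
    next
      case False
      hence "\<lfloor>real N * x\<rfloor> < \<lfloor>real N * y\<rfloor>" using lt floor_mono[of "real N * x" "real N * y"] by simp
      hence "of_int \<lfloor>real N * x\<rfloor> + 1 \<le> (of_int \<lfloor>real N * y\<rfloor> :: real)" by linarith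
      thus ?thesis using fp(2)[OF p(1), of "real N * x" "\<lfloor>real N * x\<rfloor> mod int N"]
          fp(1)[OF p(1), of "real N * y" "\<lfloor>real N * y\<rfloor> mod int N"] by linarith
    qed
    thus "\<Phi> x < \<Phi> y" using N by (simp add: \<Phi>_def divide_strict_right_mono)
  qed
  moreover have "surj \<Phi>"
  proof (rule surjI)
    fix y :: real
    define j where "j = \<lfloor>real N * y\<rfloor>"
    define q where "q = p (j mod int N)"
    define x where "x = (of_int j + frac (real N * y) powr (1 / q)) / real N"
    have q: "0 < q" by (simp add: q_def p(1))
    have Nx: "real N * x = of_int j + frac (real N * y) powr (1 / q)" using N by (simp add: x_def)
    have b: "0 \<le> frac (real N * y) powr (1 / q)" "frac (real N * y) powr (1 / q) < 1"
      using fp[of "1 / q"] q by auto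
    have fl: "\<lfloor>real N * x\<rfloor> = j" unfolding Nx using b by linarith
    have "frac (real N * x) = real N * x - of_int j" by (simp only: frac_def fl)
    hence fr: "frac (real N * x) = frac (real N * y) powr (1 / q)" using Nx by linarith
    have "frac (real N * x) powr q = frac (real N * y)"
      unfolding fr using q by (simp add: powr_powr)
    thus "\<Phi> ((of_int \<lfloor>real N * y\<rfloor> + frac (real N * y) powr (1 / p (\<lfloor>real N * y\<rfloor> mod int N))) / real N) = y"
      unfolding j_def[symmetric] q_def[symmetric] x_def[symmetric] \<Phi>_def fl
      using N by (simp add: q_def[symmetric] j_def frac_def)
  qed
  moreover have "\<Phi> 0 = 0" by (simp add: \<Phi>_def)
  moreover have "\<Phi> (x + 1) = \<Phi> x + 1" for x
  proof -
    have "real N * (x + 1) = real N * x + of_int (int N)" by (simp add: algebra_simps)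
    hence "\<lfloor>real N * (x + 1)\<rfloor> = \<lfloor>real N * x\<rfloor> + int N" "frac (real N * (x + 1)) = frac (real N * x)"
      by (simp_all only: floor_add_int frac_add_of_int_right)
    thus ?thesis using N by (simp add: \<Phi>_def field_simps)
  qed
  moreover have "\<Phi> t = grid N t" if t: "t \<in> S" for t
  proof -
    have "0 \<le> t" "t < 1" using t S by auto
    hence "0 \<le> \<lfloor>real N * t\<rfloor>" "real N * t < real N" using N by auto
    hence md: "\<lfloor>real N * t\<rfloor> mod int N = \<lfloor>real N * t\<rfloor>"
      by (intro mod_pos_pos_trivial) (auto simp: floor_less_iff)
    show ?thesis
    proof (cases "frac (real N * t) = 0")
      case True
      hence "real N * t = of_int \<lfloor>real N * t\<rfloor>" by (simp add: frac_def del: frac_eq_0_iff)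
      thus ?thesis unfolding \<Phi>_def grid_def True by simp
    next
      case False
      hence "real N * t \<noteq> of_int \<lfloor>real N * t\<rfloor>" by (metis frac_of_int)
      thus ?thesis unfolding \<Phi>_def grid_def md p(2)[OF t refl False] by simp
    qed
  qed
  ultimately show ?thesis unfolding time_change_def by blast
qed

lemma eventually_separated:
  assumes "finite (S :: real set)"
  shows "\<forall>\<^sub>F N in sequentially. \<forall>t\<in>S. \<forall>t'\<in>S. \<lfloor>real N * t\<rfloor> = \<lfloor>real N * t'\<rfloor> \<longrightarrow> t = t'"
proof (intro eventually_ball_finite[OF assms] ballI)
  fix t t' assume "t \<in> S" "t' \<in> S"
  show "\<forall>\<^sub>F N in sequentially. \<lfloor>real N * t\<rfloor> = \<lfloor>real N * t'\<rfloor> \<longrightarrow> t = t'"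
  proof (cases "t = t'")
    case False
    hence pos: "0 < \<bar>t - t'\<bar>" by simp
    obtain M where M: "1 < real M * \<bar>t - t'\<bar>" using reals_Archimedean3[OF pos] by blast
    have "\<lfloor>real N * t\<rfloor> \<noteq> \<lfloor>real N * t'\<rfloor>" if "M \<le> N" for N
    proof
      assume "\<lfloor>real N * t\<rfloor> = \<lfloor>real N * t'\<rfloor>"
      hence "\<bar>real N * t - real N * t'\<bar> < 1" by linarith
      hence "real N * \<bar>t - t'\<bar> < 1" by (simp add: abs_mult flip: right_diff_distrib)
      moreover have "real M * \<bar>t - t'\<bar> \<le> real N * \<bar>t - t'\<bar>" using that by (intro mult_right_mono) auto
      ultimately show False using M by simp
    qed
    thus ?thesis unfolding eventually_sequentially by blast
  qed simp
qed

lemma space_mark_law: "space (mark_law u) = {0..<1} \<times> UNIV"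
  by (simp add: mark_law_def space_pair_measure circle_def space_restrict_space)

lemma finite_mark: "finite (UNIV :: mark set)"
proof -
  have "(UNIV :: mark set) = {Cross, Bar}" using mark.exhaust by blast
  thus ?thesis by (metis finite.emptyI finite.insertI)
qed

lemma measurable_grid [measurable]: "grid N \<in> borel_measurable borel"
  unfolding grid_def by measurable

lemma finite_grid: "finite (grid N ` {0..<1})"
proof (rule finite_subset)
  let ?K = "(\<lambda>k. of_int k / real N) ` {0..int N} \<union> (\<lambda>k. (of_int k + 1 / 2) / real N) ` {0..int N}"
  show "finite ?K" by simp
  show "grid N ` {0..<1} \<subseteq> ?K"
  proof
    fix g assume "g \<in> grid N ` {0..<1}"
    then obtain t where t: "0 \<le> t" "t < 1" "g = grid N t" by auto
    have "real N * t \<le> real N * 1" using t by (intro mult_left_mono) auto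
    hence "\<lfloor>real N * t\<rfloor> \<in> {0..int N}" using t by (auto simp: le_floor_iff floor_le_iff)
    moreover have "g = of_int \<lfloor>real N * t\<rfloor> / real N \<or> g = (of_int \<lfloor>real N * t\<rfloor> + 1 / 2) / real N"
    proof -
      have "(if b then 0 else 1 / 2) = (0 :: real) \<or> (if b then 0 else 1 / 2) = (1 / 2 :: real)" for b by simp
      moreover have "(f + h) / n = f / n \<or> (f + h) / n = (f + 1 / 2) / n" if "h = 0 \<or> h = 1 / 2" for f h n :: real
        using that by auto
      ultimately show ?thesis unfolding t(3) grid_def by blast
    qed
    ultimately show "g \<in> ?K" by blast
  qed
qed

lemma measurable_discretisation:
  "{A \<in> space (configurations (mark_law u)). map_prod (grid N) id ` A = D} \<in> sets (configurations (mark_law u))"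
proof (cases "D \<subseteq> grid N ` {0..<1} \<times> UNIV")
  case True
  define cell where "cell z = {z' \<in> space (mark_law u). grid N (fst z') = fst z \<and> snd z' = snd z}" for z
  have cell: "cell z \<in> sets (mark_law u)" for z unfolding cell_def by measurable
  have "{A \<in> space (configurations (mark_law u)). map_prod (grid N) id ` A = D} =
      {A \<in> space (configurations (mark_law u)). \<forall>z\<in>grid N ` {0..<1} \<times> UNIV. card (A \<inter> cell z) \<noteq> 0 \<longleftrightarrow> z \<in> D}"
  proof (intro Collect_cong conj_cong refl)
    fix A assume "A \<in> space (configurations (mark_law u))"
    hence A: "finite A" "A \<subseteq> {0..<1} \<times> UNIV" by (auto simp: space_configurations space_mark_law)
    have im: "z \<in> map_prod (grid N) id ` A \<longleftrightarrow> card (A \<inter> cell z) \<noteq> 0" for z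
    proof -
      have "z \<in> map_prod (grid N) id ` A \<longleftrightarrow> A \<inter> cell z \<noteq> {}"
        using A(2) by (cases z) (force simp: cell_def space_mark_law)
      thus ?thesis using A(1) by simp
    qed
    have "map_prod (grid N) id ` A \<subseteq> grid N ` {0..<1} \<times> UNIV" using A(2) by fastforce
    thus "map_prod (grid N) id ` A = D \<longleftrightarrow> (\<forall>z\<in>grid N ` {0..<1} \<times> UNIV. card (A \<inter> cell z) \<noteq> 0 \<longleftrightarrow> z \<in> D)"
      unfolding im[symmetric] using True by blast
  qed
  also have "\<dots> \<in> sets (configurations (mark_law u))"
  proof (rule sets.sets_Collect_finite_All)
    show "finite (grid N ` {0..<1} \<times> (UNIV :: mark set))" using finite_grid finite_mark by simp
    fix z
    note [measurable] = measurable_count_configurations[OF cell[of z]]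
    show "{A \<in> space (configurations (mark_law u)). (card (A \<inter> cell z) \<noteq> 0) = (z \<in> D)} \<in> sets (configurations (mark_law u))"
      by measurable
  qed
  finally show ?thesis .
next
  case False
  have "{A \<in> space (configurations (mark_law u)). map_prod (grid N) id ` A = D} = {}"
    using False by (auto simp: space_configurations space_mark_law subset_iff)
  thus ?thesis by (simp only: sets.empty_sets)
qed

abbreviation config_space :: "'v set set \<Rightarrow> real \<Rightarrow> 'v config measure" where
  "config_space E u \<equiv> \<Pi>\<^sub>M e\<in>E. configurations (mark_law u)"

text \<open>Once the grid is so fine that it separates the times in \<open>\<omega>\<close>, discretising amounts to a time change
  and leaves \<open>P\<close> unaltered.  A discretised configuration takes finitely many values, each on an event
  given by numbers of marks in cells, and \<open>P\<close> is the limit of these finite approximations.\<close>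

theorem time_invariant_measurable:
  assumes E: "finite E" and inv: "time_invariant E P"
  shows "{\<omega> \<in> space (config_space E u). P \<omega>} \<in> sets (config_space E u)"
proof -
  let ?C = "configurations (mark_law u)" and ?M = "config_space E u"
  let ?G = "\<lambda>N. grid N ` {0..<1} \<times> (UNIV :: mark set)"
  define disc where "disc N \<omega> = restrict (\<lambda>e. map_prod (grid N) id ` \<omega> e) E" for N and \<omega> :: "'a config"
  have meas: "{\<omega> \<in> space ?M. P (disc N \<omega>)} \<in> sets ?M" for N
  proof -
    let ?D = "{D \<in> (\<Pi>\<^sub>E e\<in>E. Pow (?G N)). P D}"
    let ?W = "\<lambda>D. {\<omega> \<in> space ?M. \<forall>e\<in>E. map_prod (grid N) id ` \<omega> e = D e}"
    have "finite (\<Pi>\<^sub>E e\<in>E. Pow (?G N))" by (intro finite_PiE E) (simp add: finite_grid finite_mark)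
    hence finD: "finite ?D" by simp
    have "{\<omega> \<in> space ?M. P (disc N \<omega>)} = (\<Union>D\<in>?D. ?W D)"
    proof (intro equalityI subsetI)
      fix \<omega> assume w: "\<omega> \<in> {\<omega> \<in> space ?M. P (disc N \<omega>)}"
      hence "\<omega> e \<subseteq> {0..<1} \<times> UNIV" if "e \<in> E" for e
        using that by (auto simp: space_PiM space_configurations space_mark_law)
      hence "map_prod (grid N) id ` \<omega> e \<in> Pow (?G N)" if "e \<in> E" for e using that by fastforce
      hence "disc N \<omega> \<in> ?D" using w by (auto simp: disc_def)
      moreover have "\<forall>e\<in>E. map_prod (grid N) id ` \<omega> e = disc N \<omega> e" by (simp add: disc_def)
      ultimately show "\<omega> \<in> (\<Union>D\<in>?D. ?W D)"
        using w by blast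
    next
      fix \<omega> assume "\<omega> \<in> (\<Union>D\<in>?D. ?W D)"
      then obtain D where D: "D \<in> ?D" "\<omega> \<in> space ?M" "\<forall>e\<in>E. map_prod (grid N) id ` \<omega> e = D e" by blast
      have "disc N \<omega> = D"
      proof
        fix e show "disc N \<omega> e = D e" using D by (cases "e \<in> E") (auto simp: disc_def)
      qed
      thus "\<omega> \<in> {\<omega> \<in> space ?M. P (disc N \<omega>)}" using D by simp
    qed
    also have "\<dots> \<in> sets ?M"
    proof (intro sets.finite_UN[OF finD] sets.sets_Collect_finite_All[OF _ E])
      fix D e assume e: "e \<in> E"
      have "(\<lambda>\<omega>. \<omega> e) -` {A \<in> space ?C. map_prod (grid N) id ` A = D e} \<inter> space ?M \<in> sets ?M"
        by (rule measurable_sets[OF measurable_component_singleton[OF e] measurable_discretisation])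
      also have "(\<lambda>\<omega>. \<omega> e) -` {A \<in> space ?C. map_prod (grid N) id ` A = D e} \<inter> space ?M
          = {\<omega> \<in> space ?M. map_prod (grid N) id ` \<omega> e = D e}"
        using e by (auto simp: space_PiM)
      finally show "{\<omega> \<in> space ?M. map_prod (grid N) id ` \<omega> e = D e} \<in> sets ?M" .
    qed
    finally show ?thesis .
  qed
  have lim: "P \<omega> \<longleftrightarrow> (\<exists>M. \<forall>N. M \<le> N \<longrightarrow> P (disc N \<omega>))" if w: "\<omega> \<in> space ?M" for \<omega>
  proof -
    have wf: "finite (\<omega> e)" "\<omega> e \<subseteq> {0..<1} \<times> UNIV" if "e \<in> E" for e
      using w that by (auto simp: space_PiM space_configurations space_mark_law)
    have fin: "finite (mark_times E \<omega>)" unfolding mark_times_def using E wf by auto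
    have circ: "mark_times E \<omega> \<subseteq> {0..<1}" unfolding mark_times_def using wf by force
    have "\<forall>\<^sub>F N in sequentially. P (disc N \<omega>) = P \<omega>"
      using eventually_separated[OF fin] eventually_gt_at_top[of 0]
    proof eventually_elim
      case (elim N)
      obtain \<Phi> where \<Phi>: "time_change \<Phi>" "\<forall>t\<in>mark_times E \<omega>. \<Phi> t = grid N t"
        using exists_time_change_to_grid[OF circ elim(2)] elim(1) by blast
      have "map_prod (grid N) id ` \<omega> e = map_prod \<Phi> id ` \<omega> e" if "e \<in> E" for e
        using \<Phi>(2) that by (intro image_cong) (force simp: mark_times_def)+
      hence "retimed E \<Phi> \<omega> (disc N \<omega>)" by (simp add: retimed_def disc_def)
      thus ?case using inv \<Phi>(1) unfolding time_invariant_def by blast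
    qed
    then obtain M where M: "\<And>N. M \<le> N \<Longrightarrow> P (disc N \<omega>) = P \<omega>" unfolding eventually_sequentially by blast
    show ?thesis
    proof
      assume "P \<omega>"
      thus "\<exists>M. \<forall>N. M \<le> N \<longrightarrow> P (disc N \<omega>)" using M by blast
    next
      assume "\<exists>M. \<forall>N. M \<le> N \<longrightarrow> P (disc N \<omega>)"
      then obtain M' where "\<And>N. M' \<le> N \<Longrightarrow> P (disc N \<omega>)" by blast
      thus "P \<omega>" using M[of "max M M'"] by auto
    qed
  qed
  have "{\<omega> \<in> space ?M. P \<omega>} = {\<omega> \<in> space ?M. \<exists>M. \<forall>N. M \<le> N \<longrightarrow> P (disc N \<omega>)}"
    using lim by blast
  also have "\<dots> \<in> sets ?M"
    by (intro sets.sets_Collect_countable_Ex sets.sets_Collect_countable_All sets.sets_Collect_imp meas)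
       (auto intro: sets.sets_Collect_const)
  finally show ?thesis .
qed

subsection \<open>Inserting a mark\<close>

text \<open>A finite set contains \<open>z\<close> if and only if, on every grid, it meets the cell of \<open>z\<close>; this uses countably
  many counting events.\<close>

lemma measurable_mark_mem:
  "Measurable.pred (configurations (mark_law u) \<Otimes>\<^sub>M mark_law u) (\<lambda>(A, z). z \<in> A)"
proof -
  let ?M = "configurations (mark_law u) \<Otimes>\<^sub>M mark_law u"
  define cell where "cell N j m = {z' \<in> space (mark_law u). \<lfloor>real N * fst z'\<rfloor> = j \<and> snd z' = m}" for N j m
  have cell: "cell N j m \<in> sets (mark_law u)" for N j m unfolding cell_def by measurable
  note [measurable] = measurable_count_configurations[OF cell]
  have "Measurable.pred ?M (\<lambda>w. \<forall>N. \<exists>j. \<lfloor>real N * fst (snd w)\<rfloor> = j \<and>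
      (snd (snd w) = Cross \<and> card (fst w \<inter> cell N j Cross) \<noteq> 0 \<or> snd (snd w) = Bar \<and> card (fst w \<inter> cell N j Bar) \<noteq> 0))"
    by measurable
  also have "(\<lambda>w. \<forall>N. \<exists>j. \<lfloor>real N * fst (snd w)\<rfloor> = j \<and>
      (snd (snd w) = Cross \<and> card (fst w \<inter> cell N j Cross) \<noteq> 0 \<or> snd (snd w) = Bar \<and> card (fst w \<inter> cell N j Bar) \<noteq> 0))
    = (\<lambda>w. \<forall>N. card (fst w \<inter> cell N \<lfloor>real N * fst (snd w)\<rfloor> (snd (snd w))) \<noteq> 0)"
    by (intro ext, rename_tac w, case_tac "snd (snd w)") simp_all
  finally have m: "Measurable.pred ?M (\<lambda>w. \<forall>N. card (fst w \<inter> cell N \<lfloor>real N * fst (snd w)\<rfloor> (snd (snd w))) \<noteq> 0)" .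
  have key: "z \<in> A \<longleftrightarrow> (\<forall>N. card (A \<inter> cell N \<lfloor>real N * fst z\<rfloor> (snd z)) \<noteq> 0)"
    if A: "finite A" "A \<subseteq> space (mark_law u)" for A z
  proof
    assume "z \<in> A"
    hence "z \<in> A \<inter> cell N \<lfloor>real N * fst z\<rfloor> (snd z)" for N using A by (auto simp: cell_def)
    hence "A \<inter> cell N \<lfloor>real N * fst z\<rfloor> (snd z) \<noteq> {}" for N by blast
    thus "\<forall>N. card (A \<inter> cell N \<lfloor>real N * fst z\<rfloor> (snd z)) \<noteq> 0" using A(1) by simp
  next
    assume ne: "\<forall>N. card (A \<inter> cell N \<lfloor>real N * fst z\<rfloor> (snd z)) \<noteq> 0"
    have "finite (insert (fst z) (fst ` A))" using A by simp
    from eventually_separated[OF this] obtain N where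
      N: "\<forall>t\<in>insert (fst z) (fst ` A). \<forall>t'\<in>insert (fst z) (fst ` A). \<lfloor>real N * t\<rfloor> = \<lfloor>real N * t'\<rfloor> \<longrightarrow> t = t'"
      unfolding eventually_sequentially by blast
    have "A \<inter> cell N \<lfloor>real N * fst z\<rfloor> (snd z) \<noteq> {}" using ne by (metis card.empty)
    then obtain z' where z': "z' \<in> A" "\<lfloor>real N * fst z'\<rfloor> = \<lfloor>real N * fst z\<rfloor>" "snd z' = snd z"
      by (auto simp: cell_def)
    hence "fst z' = fst z" using N by blast
    thus "z \<in> A" using z' by (metis prod_eqI)
  qed
  show ?thesis
  proof (rule measurable_cong[THEN iffD2, OF _ m])
    fix w assume "w \<in> space ?M"
    then obtain A z where w: "w = (A, z)" "finite A" "A \<subseteq> space (mark_law u)"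
      by (auto simp: space_pair_measure space_configurations)
    show "(case w of (A, z) \<Rightarrow> z \<in> A) \<longleftrightarrow>
        (\<forall>N. card (fst w \<inter> cell N \<lfloor>real N * fst (snd w)\<rfloor> (snd (snd w))) \<noteq> 0)"
      unfolding w(1) prod.case fst_conv snd_conv by (rule key[OF w(2,3)])
  qed
qed

lemma measurable_insert_mark:
  "(\<lambda>(A, z). insert z A) \<in> configurations (mark_law u) \<Otimes>\<^sub>M mark_law u \<rightarrow>\<^sub>M configurations (mark_law u)"
proof -
  let ?M = "configurations (mark_law u) \<Otimes>\<^sub>M mark_law u"
  note [measurable] = measurable_mark_mem[unfolded case_prod_beta]
  show ?thesis
  proof (subst (2) configurations_def, rule measurable_measure_of)
    show "(\<lambda>(A, z). insert z A) \<in> space ?M \<rightarrow> {A. finite A \<and> A \<subseteq> space (mark_law u)}"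
      by (auto simp: space_pair_measure space_configurations)
    fix Y assume "Y \<in> {{A. finite A \<and> A \<subseteq> space (mark_law u) \<and> card (A \<inter> B) = k} | B k. B \<in> sets (mark_law u)}"
    then obtain B k where B [measurable]: "B \<in> sets (mark_law u)"
      and Y: "Y = {A. finite A \<and> A \<subseteq> space (mark_law u) \<and> card (A \<inter> B) = k}" by auto
    note [measurable] = measurable_count_configurations[OF B]
    have "card (insert z A \<inter> B) = card (A \<inter> B) + (if z \<in> B \<and> \<not> z \<in> A then 1 else 0)" if "finite A" for z A
      using that by (cases "z \<in> A") (auto simp: card_insert_if insert_absorb)
    hence "(\<lambda>(A, z). insert z A) -` Y \<inter> space ?M =
        {w \<in> space ?M. card (fst w \<inter> B) + (if snd w \<in> B \<and> \<not> snd w \<in> fst w then 1 else 0) = k}"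
      by (auto simp: Y space_pair_measure space_configurations)
    also have "\<dots> \<in> sets ?M" by measurable
    finally show "(\<lambda>(A, z). insert z A) -` Y \<inter> space ?M \<in> sets ?M" .
  qed auto
qed

lemma measurable_add_mark:
  assumes "e \<in> E"
  shows "(\<lambda>(\<omega>, z). \<omega> (e := insert z (\<omega> e))) \<in>
    (config_space E u) \<Otimes>\<^sub>M mark_law u \<rightarrow>\<^sub>M (config_space E u)"
proof -
  let ?C = "configurations (mark_law u)"
  let ?M = "(\<Pi>\<^sub>M e\<in>E. ?C) \<Otimes>\<^sub>M mark_law u"
  have comp: "(\<lambda>w. fst w e') \<in> ?M \<rightarrow>\<^sub>M ?C" if "e' \<in> E" for e'
    using that by measurable
  have "(\<lambda>w. (\<lambda>(A, z). insert z A) (fst w e, snd w)) \<in> ?M \<rightarrow>\<^sub>M ?C"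
    by (rule measurable_compose[OF _ measurable_insert_mark]) (use comp[OF assms] in measurable)
  hence ins: "(\<lambda>w. insert (snd w) (fst w e)) \<in> ?M \<rightarrow>\<^sub>M ?C" by simp
  show ?thesis
  proof (rule measurable_PiM_single')
    fix e' assume e': "e' \<in> E"
    show "(\<lambda>w. (case w of (\<omega>, z) \<Rightarrow> \<omega> (e := insert z (\<omega> e))) e') \<in> ?M \<rightarrow>\<^sub>M ?C"
      using ins comp[OF e'] by (cases "e' = e") (simp_all add: case_prod_beta)
  next
    show "(\<lambda>w. case w of (\<omega>, z) \<Rightarrow> \<omega> (e := insert z (\<omega> e))) \<in> space ?M \<rightarrow> (\<Pi>\<^sub>E e\<in>E. space ?C)"
      using assms by (auto simp: space_pair_measure space_PiM space_configurations PiE_iff extensional_def split: if_splits; blast)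
  qed
qed

section \<open>Poisson calculus\<close>

lemma sets_poisson_process [simp, measurable_cong]:
  "sets (poisson_process t (mark_law u)) = sets (configurations (mark_law u))"
  by (simp add: poisson_process_def)

lemma space_poisson_process [simp]:
  "space (poisson_process t (mark_law u)) = space (configurations (mark_law u))"
  by (simp add: poisson_process_def)

lemma sets_loop_law [simp, measurable_cong]:
  "sets (loop_law E t u) = sets (config_space E u)"
  unfolding loop_law_def by (intro sets_PiM_cong) auto

lemma space_loop_law [simp]:
  "space (loop_law E t u) = space (config_space E u)"
  by (rule sets_eq_imp_space_eq) simp

lemma prob_space_loop_law: "prob_space (loop_law E t u)"
  unfolding loop_law_def by (intro prob_space_PiM prob_space_poisson_process_marks)

lemma measurable_card_configurations [measurable]:
  "card \<in> measurable (configurations (mark_law u)) (count_space UNIV)"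
proof -
  have "(\<lambda>A. card (A \<inter> space (mark_law u))) \<in> measurable (configurations (mark_law u)) (count_space UNIV)"
    by (intro measurable_count_configurations) simp
  thus ?thesis
    by (rule measurable_cong[THEN iffD1, rotated]) (auto simp: space_configurations Int_absorb2)
qed

lemma measurable_first_marks [measurable]:
  "(\<lambda>X. X ` {..<n}) \<in> (\<Pi>\<^sub>M i\<in>(UNIV :: nat set). mark_law u) \<rightarrow>\<^sub>M configurations (mark_law u)"
  using measurable_compose[OF measurable_Pair1'[of n "measure_pmf (return_pmf (0::nat))"]
      measurable_mark_sample[of "return_pmf 0" u]] by simp

lemma nn_integral_poisson_process:
  assumes t: "0 \<le> t" and g [measurable]: "g \<in> borel_measurable (configurations (mark_law u))"
  shows "(\<integral>\<^sup>+A. g A \<partial>poisson_process t (mark_law u)) =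
    (\<Sum>n. ennreal (t ^ n / fact n * exp (- t)) * (\<integral>\<^sup>+X. g (X ` {..<n}) \<partial>(\<Pi>\<^sub>M i\<in>(UNIV :: nat set). mark_law u)))"
proof -
  let ?P = "\<Pi>\<^sub>M i\<in>(UNIV :: nat set). mark_law u"
  let ?N = "measure_pmf (poisson_number t)"
  interpret Q: prob_space "mark_law u" by (rule prob_space_mark_law)
  interpret P: prob_space ?P by (rule prob_space_PiM) (rule Q.prob_space_axioms)
  note h [measurable] = measurable_mark_sample[of "poisson_number t" u]
  have "(\<integral>\<^sup>+A. g A \<partial>poisson_process t (mark_law u)) = (\<integral>\<^sup>+w. g (case w of (N, X) \<Rightarrow> X ` {..<N}) \<partial>(?N \<Otimes>\<^sub>M ?P))"
    unfolding poisson_process_def by (rule nn_integral_distr) measurable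
  also have "\<dots> = (\<integral>\<^sup>+n. \<integral>\<^sup>+X. g (X ` {..<n}) \<partial>?P \<partial>?N)"
    by (subst P.nn_integral_fst[symmetric]) (auto intro: measurable_compose[OF h g])
  also have "\<dots> = (\<Sum>n. ennreal (pmf (poisson_number t) n) * (\<integral>\<^sup>+X. g (X ` {..<n}) \<partial>?P))"
    by (simp add: nn_integral_measure_pmf nn_integral_count_space_nat)
  finally show ?thesis by (simp add: pmf_poisson_number[OF t])
qed

lemma AE_card_first_marks:
  "AE X in (\<Pi>\<^sub>M i\<in>(UNIV :: nat set). mark_law u). card (X ` {..<n}) = n"
proof -
  have "AE X in (\<Pi>\<^sub>M i\<in>(UNIV :: nat set). mark_law u). \<forall>i\<in>{..<n}. \<forall>j\<in>{..<n}. i \<noteq> j \<longrightarrow> X i \<noteq> X j"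
    by (intro AE_finite_allI finite_lessThan AE_impI mark_sequence_distinct)
  thus ?thesis
  proof (rule AE_mp, intro AE_I2 impI)
    fix X :: "nat \<Rightarrow> real \<times> mark" assume "\<forall>i\<in>{..<n}. \<forall>j\<in>{..<n}. i \<noteq> j \<longrightarrow> X i \<noteq> X j"
    hence "inj_on X {..<n}" by (auto simp: inj_on_def)
    thus "card (X ` {..<n}) = n" by (simp add: card_image)
  qed
qed

text \<open>Configurations with \<open>n\<close> marks have weight \<open>t\<^sup>n / n! * exp (- t)\<close> on the left and
  \<open>1 / n! * exp (- 1)\<close> on the right.\<close>

lemma poisson_process_density:
  assumes t: "0 \<le> t"
  shows "poisson_process t (mark_law u) =
    density (poisson_process 1 (mark_law u)) (\<lambda>A. ennreal (exp (1 - t) * t ^ card A))" (is "?l = ?r")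
proof (rule measure_eqI)
  fix A assume "A \<in> sets ?l"
  hence A [measurable]: "A \<in> sets (configurations (mark_law u))" by simp
  let ?P = "\<Pi>\<^sub>M i\<in>(UNIV :: nat set). mark_law u"
  let ?i = "\<lambda>n. \<integral>\<^sup>+X. ennreal (exp (1 - t) * t ^ card (X ` {..<n})) * indicator A (X ` {..<n}) \<partial>?P"
  let ?j = "\<lambda>n. \<integral>\<^sup>+X. indicator A (X ` {..<n}) \<partial>?P"
  have "emeasure ?r A = (\<integral>\<^sup>+B. ennreal (exp (1 - t) * t ^ card B) * indicator A B \<partial>poisson_process 1 (mark_law u))"
    by (rule emeasure_density) auto
  also have "\<dots> = (\<Sum>n. ennreal (1 ^ n / fact n * exp (- 1)) *
      ?i n)"
    by (rule nn_integral_poisson_process) auto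
  also have "\<dots> = (\<Sum>n. ennreal (t ^ n / fact n * exp (- t)) * ?j n)"
  proof (intro suminf_cong)
    fix n
    have "?i n
        = (\<integral>\<^sup>+X. ennreal (exp (1 - t) * t ^ n) * indicator A (X ` {..<n}) \<partial>?P)"
      by (rule nn_integral_cong_AE, use AE_card_first_marks[of n u] in eventually_elim) simp
    also have "\<dots> = ennreal (exp (1 - t) * t ^ n) * ?j n"
      by (rule nn_integral_cmult) measurable
    finally have eq: "?i n
        = ennreal (exp (1 - t) * t ^ n) * ?j n" .
    have "1 ^ n / fact n * exp (- 1) * (exp (1 - t) * t ^ n) = t ^ n / fact n * (exp (- 1) * exp (1 - t))"
      by simp
    also have "exp (- 1) * exp (1 - t) = exp (- t)" by (simp flip: exp_add)
    finally have "ennreal (1 ^ n / fact n * exp (- 1)) * ennreal (exp (1 - t) * t ^ n) = ennreal (t ^ n / fact n * exp (- t))"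
      using t by (subst ennreal_mult[symmetric]) auto
    thus "ennreal (1 ^ n / fact n * exp (- 1)) *
      ?i n
      = ennreal (t ^ n / fact n * exp (- t)) * ?j n"
      unfolding eq by (simp only: mult.assoc[symmetric])
  qed
  also have "\<dots> = (\<integral>\<^sup>+B. indicator A B \<partial>poisson_process t (mark_law u))"
    by (rule nn_integral_poisson_process[OF t, symmetric]) measurable
  also have "\<dots> = emeasure ?l A" by simp
  finally show "emeasure ?l A = emeasure ?r A" ..
qed simp

text \<open>An independent sequence is a first term followed by an independent copy of the sequence.\<close>

lemma nn_integral_insert_first_marks:
  assumes g [measurable]: "g \<in> borel_measurable (configurations (mark_law u))"
  shows "(\<integral>\<^sup>+X. g (X ` {..<Suc n}) \<partial>(\<Pi>\<^sub>M i\<in>(UNIV :: nat set). mark_law u)) =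
    (\<integral>\<^sup>+X. \<integral>\<^sup>+z. g (insert z (X ` {..<n})) \<partial>mark_law u \<partial>(\<Pi>\<^sub>M i\<in>(UNIV :: nat set). mark_law u))"
proof -
  let ?Q = "mark_law u" and ?P = "\<Pi>\<^sub>M i\<in>(UNIV :: nat set). mark_law u"
  interpret Q: prob_space ?Q by (rule prob_space_mark_law)
  interpret sequence_space ?Q ..
  interpret P: prob_space ?P by (rule prob_space_PiM) (rule Q.prob_space_axioms)
  interpret QP: pair_prob_space ?Q ?P ..
  have "(\<integral>\<^sup>+X. g (X ` {..<Suc n}) \<partial>?P)
      = (\<integral>\<^sup>+X. g (X ` {..<Suc n}) \<partial>distr (?Q \<Otimes>\<^sub>M ?P) ?P (\<lambda>(z, X). case_nat z X))"
    by (simp only: PiM_iter)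
  also have "\<dots> = (\<integral>\<^sup>+w. g ((case w of (z, X) \<Rightarrow> case_nat z X) ` {..<Suc n}) \<partial>(?Q \<Otimes>\<^sub>M ?P))"
    by (rule nn_integral_distr) measurable
  also have "\<dots> = (\<integral>\<^sup>+w. g (insert (fst w) (snd w ` {..<n})) \<partial>(?Q \<Otimes>\<^sub>M ?P))"
  proof (intro nn_integral_cong arg_cong[where f = g])
    fix w show "(case w of (z, X) \<Rightarrow> case_nat z X) ` {..<Suc n} = insert (fst w) (snd w ` {..<n})"
      by (cases w) (simp add: lessThan_Suc_eq_insert_0 image_image)
  qed
  also have "\<dots> = (\<integral>\<^sup>+X. \<integral>\<^sup>+z. g (insert z (X ` {..<n})) \<partial>?Q \<partial>?P)"
  proof (subst QP.nn_integral_snd[symmetric])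
    have "(\<lambda>w. (snd w ` {..<n}, fst w)) \<in> ?Q \<Otimes>\<^sub>M ?P \<rightarrow>\<^sub>M configurations ?Q \<Otimes>\<^sub>M ?Q" by measurable
    from measurable_compose[OF measurable_compose[OF this measurable_insert_mark] g]
    show "(\<lambda>w. g (insert (fst w) (snd w ` {..<n}))) \<in> borel_measurable (?Q \<Otimes>\<^sub>M ?P)" by simp
  qed simp
  finally show ?thesis .
qed

text \<open>Mecke's formula: weighting by the number of marks amounts to adding an independent mark, because
  \<open>n\<close> times the probability of \<open>n\<close> marks is \<open>t\<close> times that of \<open>n - 1\<close> marks.\<close>

lemma poisson_process_mecke:
  assumes t: "0 \<le> t" and g [measurable]: "g \<in> borel_measurable (configurations (mark_law u))"
  shows "(\<integral>\<^sup>+A. of_nat (card A) * g A \<partial>poisson_process t (mark_law u)) =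
    ennreal t * (\<integral>\<^sup>+A. \<integral>\<^sup>+z. g (insert z A) \<partial>mark_law u \<partial>poisson_process t (mark_law u))"
proof -
  let ?Q = "mark_law u" and ?P = "\<Pi>\<^sub>M i\<in>(UNIV :: nat set). mark_law u"
  let ?p = "\<lambda>n. ennreal (t ^ n / fact n * exp (- t))"
  let ?i = "\<lambda>n. \<integral>\<^sup>+X. \<integral>\<^sup>+z. g (insert z (X ` {..<n})) \<partial>?Q \<partial>?P"
  interpret Q: prob_space ?Q by (rule prob_space_mark_law)
  have ins: "(\<lambda>A. \<integral>\<^sup>+z. g (insert z A) \<partial>?Q) \<in> borel_measurable (configurations ?Q)"
    using measurable_compose[OF measurable_insert_mark g]
    by (intro Q.borel_measurable_nn_integral) (simp add: case_prod_beta)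
  have "(\<integral>\<^sup>+A. of_nat (card A) * g A \<partial>poisson_process t ?Q)
      = (\<Sum>n. ?p n * (\<integral>\<^sup>+X. of_nat (card (X ` {..<n})) * g (X ` {..<n}) \<partial>?P))"
    by (rule nn_integral_poisson_process[OF t]) measurable
  also have "\<dots> = (\<Sum>n. ?p n * of_nat n * (\<integral>\<^sup>+X. g (X ` {..<n}) \<partial>?P))"
  proof (intro suminf_cong)
    fix n
    have "(\<integral>\<^sup>+X. of_nat (card (X ` {..<n})) * g (X ` {..<n}) \<partial>?P) = (\<integral>\<^sup>+X. of_nat n * g (X ` {..<n}) \<partial>?P)"
      by (rule nn_integral_cong_AE, use AE_card_first_marks[of n u] in eventually_elim) simp
    also have "\<dots> = of_nat n * (\<integral>\<^sup>+X. g (X ` {..<n}) \<partial>?P)" by (rule nn_integral_cmult) measurable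
    finally show "?p n * (\<integral>\<^sup>+X. of_nat (card (X ` {..<n})) * g (X ` {..<n}) \<partial>?P)
        = ?p n * of_nat n * (\<integral>\<^sup>+X. g (X ` {..<n}) \<partial>?P)" by (simp only: mult.assoc)
  qed
  also have "\<dots> = (\<Sum>n. ?p (n + 1) * of_nat (n + 1) * (\<integral>\<^sup>+X. g (X ` {..<n + 1}) \<partial>?P))"
    by (subst suminf_offset[OF summableI, of _ 1]) simp
  also have "\<dots> = (\<Sum>n. ennreal t * (?p n * ?i n))"
  proof (intro suminf_cong)
    fix n
    have "t ^ (n + 1) / fact (n + 1) * exp (- t) * real (n + 1) = t * (t ^ n / fact n * exp (- t))"
      by (simp del: of_nat_Suc)
    moreover have "?p (n + 1) * of_nat (n + 1) = ennreal (t ^ (n + 1) / fact (n + 1) * exp (- t) * real (n + 1))"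
      unfolding ennreal_of_nat_eq_real_of_nat by (rule ennreal_mult[symmetric]) (use t in auto)
    moreover have "ennreal (t * (t ^ n / fact n * exp (- t))) = ennreal t * ?p n"
      by (rule ennreal_mult) (use t in auto)
    ultimately have "?p (n + 1) * of_nat (n + 1) = ennreal t * ?p n" by (simp only:)
    thus "?p (n + 1) * of_nat (n + 1) * (\<integral>\<^sup>+X. g (X ` {..<n + 1}) \<partial>?P)
        = ennreal t * (?p n * ?i n)"
      using nn_integral_insert_first_marks[OF g, of n] by (simp add: mult.assoc)
  qed
  also have "\<dots> = ennreal t * (\<Sum>n. ?p n * ?i n)" by simp
  also have "(\<Sum>n. ?p n * ?i n)
      = (\<integral>\<^sup>+A. \<integral>\<^sup>+z. g (insert z A) \<partial>?Q \<partial>poisson_process t ?Q)"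
    by (rule nn_integral_poisson_process[OF t ins, symmetric])
  finally show ?thesis .
qed

definition mark_count :: "'v set set \<Rightarrow> 'v config \<Rightarrow> nat" where
  "mark_count E \<omega> = (\<Sum>e\<in>E. card (\<omega> e))"

lemma measurable_mark_count [measurable]:
  "mark_count E \<in> measurable (config_space E u) (count_space UNIV)"
  unfolding mark_count_def by measurable

lemma loop_law_density:
  assumes t: "0 \<le> t" and E: "finite E"
  shows "loop_law E t u = density (loop_law E 1 u)
    (\<lambda>\<omega>. ennreal (exp ((1 - t) * real (card E)) * t ^ mark_count E \<omega>))"
proof -
  let ?PP = "\<lambda>t. poisson_process t (mark_law u)"
  define w where "w A = ennreal (exp (1 - t) * t ^ card A)" for A :: "(real \<times> mark) set"
  have w [measurable]: "w \<in> borel_measurable (configurations (mark_law u))"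
    unfolding w_def by measurable
  interpret P1: product_prob_space "\<lambda>_. ?PP 1" E
    by (intro product_prob_spaceI prob_space_poisson_process_marks)
  interpret Pt: product_prob_space "\<lambda>_. ?PP t" E
    by (intro product_prob_spaceI prob_space_poisson_process_marks)
  have prod_w: "ennreal (exp ((1 - t) * real (card E)) * t ^ mark_count E \<omega>) = (\<Prod>e\<in>E. w (\<omega> e))" for \<omega>
  proof -
    have "exp ((1 - t) * real (card E)) * t ^ mark_count E \<omega> = (\<Prod>e\<in>E. exp (1 - t) * t ^ card (\<omega> e))"
      by (simp add: mark_count_def prod.distrib power_sum mult.commute[of "1 - t"] exp_of_nat_mult)
    thus ?thesis using t by (simp add: w_def prod_ennreal)
  qed
  let ?D = "density (\<Pi>\<^sub>M e\<in>E. ?PP 1) (\<lambda>\<omega>. \<Prod>e\<in>E. w (\<omega> e))"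
  have "?D = (\<Pi>\<^sub>M e\<in>E. ?PP t)"
  proof (rule Pt.PiM_eqI[OF E])
    show "sets ?D = sets (\<Pi>\<^sub>M e\<in>E. ?PP t)"
      by (simp, intro sets_PiM_cong) auto
    fix A assume A: "\<And>e. e \<in> E \<Longrightarrow> A e \<in> sets (?PP t)"
    have [measurable]: "A e \<in> sets (configurations (mark_law u))" if "e \<in> E" for e using A[OF that] by simp
    have m: "(\<lambda>\<omega>. \<Prod>e\<in>E. w (\<omega> e)) \<in> borel_measurable (\<Pi>\<^sub>M e\<in>E. ?PP 1)" by measurable
    have "emeasure ?D (Pi\<^sub>E E A)
        = (\<integral>\<^sup>+\<omega>. (\<Prod>e\<in>E. w (\<omega> e)) * indicator (Pi\<^sub>E E A) \<omega> \<partial>(\<Pi>\<^sub>M e\<in>E. ?PP 1))"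
      by (rule emeasure_density[OF m]) (intro sets_PiM_I_finite E, simp add: A)
    also have "\<dots> = (\<integral>\<^sup>+\<omega>. (\<Prod>e\<in>E. w (\<omega> e) * indicator (A e) (\<omega> e)) \<partial>(\<Pi>\<^sub>M e\<in>E. ?PP 1))"
    proof (rule nn_integral_cong)
      fix \<omega> assume "\<omega> \<in> space (\<Pi>\<^sub>M e\<in>E. ?PP 1)"
      hence "\<omega> \<in> extensional E" by (auto simp: space_PiM PiE_def)
      hence "indicator (Pi\<^sub>E E A) \<omega> = (\<Prod>e\<in>E. indicator (A e) (\<omega> e) :: ennreal)"
        using E by (auto simp: indicator_def PiE_iff prod.If_cases intro!: prod_zero split: if_splits)
      thus "(\<Prod>e\<in>E. w (\<omega> e)) * indicator (Pi\<^sub>E E A) \<omega> = (\<Prod>e\<in>E. w (\<omega> e) * indicator (A e) (\<omega> e))"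
        by (simp add: prod.distrib)
    qed
    also have "\<dots> = (\<Prod>e\<in>E. \<integral>\<^sup>+B. w B * indicator (A e) B \<partial>?PP 1)"
      by (rule P1.product_nn_integral_prod[OF E]) measurable
    also have "\<dots> = (\<Prod>e\<in>E. emeasure (?PP t) (A e))"
    proof (rule prod.cong[OF refl])
      fix e assume "e \<in> E"
      thus "(\<integral>\<^sup>+B. w B * indicator (A e) B \<partial>?PP 1) = emeasure (?PP t) (A e)"
        unfolding poisson_process_density[OF t] w_def by (subst emeasure_density) auto
    qed
    finally show "emeasure ?D (Pi\<^sub>E E A)
        = (\<Prod>e\<in>E. emeasure (?PP t) (A e))" .
  qed
  thus ?thesis unfolding loop_law_def prod_w by simp
qed

abbreviation add_mark :: "'v set \<Rightarrow> real \<times> mark \<Rightarrow> 'v config \<Rightarrow> 'v config" where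
  "add_mark e z \<omega> \<equiv> \<omega> (e := insert z (\<omega> e))"

lemma measurable_nn_integral_add_mark:
  assumes e: "e \<in> E" and f: "f \<in> borel_measurable (config_space E u)"
  shows "(\<lambda>\<omega>. \<integral>\<^sup>+z. f (add_mark e z \<omega>) \<partial>mark_law u) \<in> borel_measurable (config_space E u)"
proof -
  interpret Q: prob_space "mark_law u" by (rule prob_space_mark_law)
  show ?thesis using measurable_compose[OF measurable_add_mark[OF e] f]
    by (intro Q.borel_measurable_nn_integral) (simp add: case_prod_beta)
qed

lemma loop_law_mecke:
  assumes t: "0 \<le> t" and E: "finite E" and e: "e \<in> E"
    and f: "f \<in> borel_measurable (config_space E u)"
  shows "(\<integral>\<^sup>+\<omega>. of_nat (card (\<omega> e)) * f \<omega> \<partial>loop_law E t u) =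
    ennreal t * (\<integral>\<^sup>+\<omega>. \<integral>\<^sup>+z. f (add_mark e z \<omega>) \<partial>mark_law u \<partial>loop_law E t u)"
proof -
  let ?PP = "poisson_process t (mark_law u)"
  define F where "F = E - {e}"
  have EF: "E = insert e F" "finite F" "e \<notin> F" using E e by (auto simp: F_def)
  interpret P: product_prob_space "\<lambda>_. ?PP" E
    by (intro product_prob_spaceI prob_space_poisson_process_marks)
  have sets: "sets (\<Pi>\<^sub>M e\<in>insert e F. ?PP) = sets (config_space E u)"
    unfolding EF(1)[symmetric] by (intro sets_PiM_cong) auto
  have f' [measurable]: "f \<in> borel_measurable (\<Pi>\<^sub>M e\<in>insert e F. ?PP)"
    using f by (simp cong: measurable_cong_sets add: measurable_cong_sets[OF sets refl])
  have card: "(\<lambda>\<omega>. of_nat (card (\<omega> e)) * f \<omega>) \<in> borel_measurable (\<Pi>\<^sub>M e\<in>insert e F. ?PP)"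
    by measurable
  have add: "(\<lambda>\<omega>. \<integral>\<^sup>+z. f (add_mark e z \<omega>) \<partial>mark_law u) \<in> borel_measurable (\<Pi>\<^sub>M e\<in>insert e F. ?PP)"
    using measurable_nn_integral_add_mark[OF e f] by (simp add: measurable_cong_sets[OF sets refl])
  have one: "(\<integral>\<^sup>+A. of_nat (card A) * f (\<omega> (e := A)) \<partial>?PP)
      = ennreal t * (\<integral>\<^sup>+A. \<integral>\<^sup>+z. f (\<omega> (e := insert z A)) \<partial>mark_law u \<partial>?PP)"
    if \<omega>: "\<omega> \<in> space (\<Pi>\<^sub>M e\<in>F. ?PP)" for \<omega>
  proof (rule poisson_process_mecke[OF t])
    have "(\<lambda>A. \<omega> (e := A)) \<in> ?PP \<rightarrow>\<^sub>M (\<Pi>\<^sub>M e\<in>insert e F. ?PP)"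
      by (rule measurable_fun_upd[where f = "\<lambda>_. \<omega>" and h = "\<lambda>A. A" and J = F and i = e])
         (use \<omega> in auto)
    from measurable_compose[OF this f']
    show "(\<lambda>A. f (\<omega> (e := A))) \<in> borel_measurable (configurations (mark_law u))"
      by (simp cong: measurable_cong_sets)
  qed
  have inner: "(\<lambda>\<omega>. \<integral>\<^sup>+A. \<integral>\<^sup>+z. f (\<omega> (e := insert z A)) \<partial>mark_law u \<partial>?PP) \<in> borel_measurable (\<Pi>\<^sub>M e\<in>F. ?PP)"
  proof -
    have "(\<lambda>(\<omega>, A). \<omega> (e := A)) \<in> (\<Pi>\<^sub>M e\<in>F. ?PP) \<Otimes>\<^sub>M ?PP \<rightarrow>\<^sub>M (\<Pi>\<^sub>M e\<in>insert e F. ?PP)"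
      using measurable_add_dim[of e F "\<lambda>_. ?PP"] by simp
    from measurable_compose[OF this add] show ?thesis
      by (intro P.M.borel_measurable_nn_integral) (simp add: case_prod_beta)
  qed
  have "(\<integral>\<^sup>+\<omega>. of_nat (card (\<omega> e)) * f \<omega> \<partial>loop_law E t u)
      = (\<integral>\<^sup>+\<omega>. \<integral>\<^sup>+A. of_nat (card A) * f (\<omega> (e := A)) \<partial>?PP \<partial>(\<Pi>\<^sub>M e\<in>F. ?PP))"
    unfolding loop_law_def EF(1) by (subst P.product_nn_integral_insert[OF EF(2,3) card]) simp
  also have "\<dots> = (\<integral>\<^sup>+\<omega>. ennreal t * (\<integral>\<^sup>+A. \<integral>\<^sup>+z. f (\<omega> (e := insert z A)) \<partial>mark_law u \<partial>?PP) \<partial>(\<Pi>\<^sub>M e\<in>F. ?PP))"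
    by (rule nn_integral_cong) (rule one)
  also have "\<dots> = ennreal t * (\<integral>\<^sup>+\<omega>. \<integral>\<^sup>+A. \<integral>\<^sup>+z. f (\<omega> (e := insert z A)) \<partial>mark_law u \<partial>?PP \<partial>(\<Pi>\<^sub>M e\<in>F. ?PP))"
    by (rule nn_integral_cmult[OF inner])
  also have "(\<integral>\<^sup>+\<omega>. \<integral>\<^sup>+A. \<integral>\<^sup>+z. f (\<omega> (e := insert z A)) \<partial>mark_law u \<partial>?PP \<partial>(\<Pi>\<^sub>M e\<in>F. ?PP))
      = (\<integral>\<^sup>+\<omega>. \<integral>\<^sup>+z. f (add_mark e z \<omega>) \<partial>mark_law u \<partial>loop_law E t u)"
    unfolding loop_law_def EF(1) by (subst P.product_nn_integral_insert[OF EF(2,3) add]) simp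
  finally show ?thesis .
qed

lemma finite_configuration:
  assumes "finite E" "\<omega> \<in> space (config_space E u)"
  shows "finite (mark_times E \<omega>)" "mark_times E \<omega> \<subseteq> {0..<1}"
    and "e \<in> E \<Longrightarrow> finite (\<omega> e)" and "card (mark_times E \<omega>) \<le> mark_count E \<omega>"
proof -
  have w: "finite (\<omega> e)" "\<omega> e \<subseteq> {0..<1} \<times> UNIV" if "e \<in> E" for e
    using assms(2) that by (auto simp: space_PiM space_configurations space_mark_law)
  show "e \<in> E \<Longrightarrow> finite (\<omega> e)" by (rule w)
  show "finite (mark_times E \<omega>)" using assms(1) w(1) by (auto simp: mark_times_def)
  show "mark_times E \<omega> \<subseteq> {0..<1}" using w(2) by (force simp: mark_times_def)
  have "card (mark_times E \<omega>) \<le> card (\<Union>e\<in>E. \<omega> e)"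
    unfolding mark_times_def using assms(1) w(1) by (intro card_image_le) auto
  also have "\<dots> \<le> mark_count E \<omega>" unfolding mark_count_def by (rule card_UN_le[OF assms(1)])
  finally show "card (mark_times E \<omega>) \<le> mark_count E \<omega>" .
qed

lemma AE_new_time:
  assumes "finite S"
  shows "AE z in mark_law u. fst z \<notin> S"
proof -
  have "AE z in mark_law u. \<forall>a\<in>S. fst z \<noteq> a" by (intro AE_finite_allI assms mark_law_time_null)
  thus ?thesis by eventually_elim blast
qed

lemma mark_count_add_mark:
  assumes "finite E" "\<omega> \<in> space (config_space E u)" "e \<in> E" "fst z \<notin> mark_times E \<omega>"
  shows "mark_count E (add_mark e z \<omega>) = Suc (mark_count E \<omega>)"
proof -
  have "z \<notin> \<omega> e" using assms(3,4) by (auto simp: mark_times_def)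
  hence "card (insert z (\<omega> e)) = Suc (card (\<omega> e))" using finite_configuration(3)[OF assms(1-3)] by simp
  thus ?thesis
    unfolding mark_count_def sum.remove[OF assms(1,3)] by simp
qed

lemma measurable_distinct_times [measurable]:
  assumes "finite E"
  shows "Measurable.pred (config_space E u) (distinct_times E)"
  unfolding pred_def by (rule time_invariant_measurable[OF assms time_invariant_distinct_times])

text \<open>An independent mark almost surely avoids finitely many given times.  By Mecke's formula the
  probability of a coincidence among \<open>k + 1\<close> marks is therefore controlled by that among \<open>k\<close> marks, and
  it vanishes by induction on the number of marks.\<close>

lemma AE_distinct_times:
  assumes t: "0 \<le> t" and E: "finite E"
  shows "AE \<omega> in loop_law E t u. distinct_times E \<omega>"
proof -
  let ?M = "config_space E u"
  note [measurable] = measurable_distinct_times[OF E, of u]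
  define f :: "nat \<Rightarrow> 'a config \<Rightarrow> ennreal" where
    "f k \<omega> = indicator {\<omega>. \<not> distinct_times E \<omega> \<and> mark_count E \<omega> = k} \<omega>" for k \<omega>
  have f [measurable]: "f k \<in> borel_measurable ?M" for k unfolding f_def by measurable
  have zero: "(\<integral>\<^sup>+\<omega>. f k \<omega> \<partial>loop_law E t u) = 0" for k
  proof (induction k)
    case 0
    have "f 0 \<omega> = 0" if "\<omega> \<in> space (loop_law E t u)" for \<omega>
    proof -
      have "\<omega> e = {}" if "mark_count E \<omega> = 0" "e \<in> E" for e
        using that finite_configuration(3)[OF E, of \<omega> u e] E \<open>\<omega> \<in> space (loop_law E t u)\<close>
        by (auto simp: mark_count_def card_eq_0_iff)
      hence "distinct_times E \<omega>" if "mark_count E \<omega> = 0" using that by (simp add: distinct_times_def)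
      thus ?thesis by (auto simp: f_def indicator_def)
    qed
    hence "(\<integral>\<^sup>+\<omega>. f 0 \<omega> \<partial>loop_law E t u) = (\<integral>\<^sup>+\<omega>. 0 \<partial>loop_law E t u)" by (rule nn_integral_cong)
    thus ?case by simp
  next
    case (Suc k)
    have "(\<integral>\<^sup>+z. f (Suc k) (add_mark e z \<omega>) \<partial>mark_law u) \<le> f k \<omega>"
      if \<omega>: "\<omega> \<in> space ?M" and e: "e \<in> E" for \<omega> e
    proof -
      interpret Q: prob_space "mark_law u" by (rule prob_space_mark_law)
      have "(\<integral>\<^sup>+z. f (Suc k) (add_mark e z \<omega>) \<partial>mark_law u) \<le> (\<integral>\<^sup>+z. f k \<omega> \<partial>mark_law u)"
      proof (rule nn_integral_mono_AE, use AE_new_time[OF finite_configuration(1)[OF E \<omega>]] in eventually_elim)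
        case (elim z)
        show ?case
          using mark_count_add_mark[OF E \<omega> e elim] distinct_times_insert[OF _ e elim, of "snd z"]
          by (auto simp: f_def split: split_indicator)
      qed
      thus ?thesis by (simp add: Q.emeasure_space_1)
    qed
    hence le: "(\<integral>\<^sup>+\<omega>. \<integral>\<^sup>+z. f (Suc k) (add_mark e z \<omega>) \<partial>mark_law u \<partial>loop_law E t u) \<le> (\<integral>\<^sup>+\<omega>. f k \<omega> \<partial>loop_law E t u)"
      if "e \<in> E" for e using that by (intro nn_integral_mono) simp
    have "(\<integral>\<^sup>+\<omega>. f (Suc k) \<omega> \<partial>loop_law E t u) \<le> (\<integral>\<^sup>+\<omega>. of_nat (mark_count E \<omega>) * f (Suc k) \<omega> \<partial>loop_law E t u)"
      by (rule nn_integral_mono) (auto simp: f_def split: split_indicator)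
    also have "\<dots> = (\<integral>\<^sup>+\<omega>. (\<Sum>e\<in>E. of_nat (card (\<omega> e)) * f (Suc k) \<omega>) \<partial>loop_law E t u)"
      by (simp add: mark_count_def sum_distrib_right)
    also have "\<dots> = (\<Sum>e\<in>E. \<integral>\<^sup>+\<omega>. of_nat (card (\<omega> e)) * f (Suc k) \<omega> \<partial>loop_law E t u)"
      by (rule nn_integral_sum) measurable
    also have "\<dots> = (\<Sum>e\<in>E. ennreal t * (\<integral>\<^sup>+\<omega>. \<integral>\<^sup>+z. f (Suc k) (add_mark e z \<omega>) \<partial>mark_law u \<partial>loop_law E t u))"
      by (rule sum.cong[OF refl]) (rule loop_law_mecke[OF t E _ f])
    also have "\<dots> = 0" using le Suc.IH by (intro sum.neutral) auto
    finally show ?case by simp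
  qed
  have "AE \<omega> in loop_law E t u. \<forall>k. f k \<omega> = 0"
    unfolding AE_all_countable
    by (intro allI) (subst nn_integral_0_iff_AE[symmetric], use zero in auto)
  thus ?thesis by eventually_elim (auto simp: f_def indicator_def split: if_splits)
qed

section \<open>Differentiating expectations in the intensity\<close>

text \<open>The density relative to intensity \<open>1\<close> depends on the number of marks only; sorting by this number
  gives a power series in \<open>t\<close>.\<close>

lemma nn_integral_loop_law_series:
  assumes t: "0 \<le> t" and E: "finite E"
    and g [measurable]: "g \<in> borel_measurable (config_space E u)"
  shows "(\<integral>\<^sup>+\<omega>. g \<omega> \<partial>loop_law E t u) = ennreal (exp ((1 - t) * real (card E))) *
    (\<Sum>k. ennreal (t ^ k) * (\<integral>\<^sup>+\<omega>. g \<omega> * indicator {\<omega>. mark_count E \<omega> = k} \<omega> \<partial>loop_law E 1 u))"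
proof -
  let ?x = "exp ((1 - t) * real (card E))"
  have "(\<integral>\<^sup>+\<omega>. g \<omega> \<partial>loop_law E t u)
      = (\<integral>\<^sup>+\<omega>. ennreal (?x * t ^ mark_count E \<omega>) * g \<omega> \<partial>loop_law E 1 u)"
    unfolding loop_law_density[OF t E] by (rule nn_integral_density) measurable
  also have "\<dots> = (\<integral>\<^sup>+\<omega>. ennreal ?x * (\<Sum>k. ennreal (t ^ k) * (g \<omega> * indicator {\<omega>. mark_count E \<omega> = k} \<omega>)) \<partial>loop_law E 1 u)"
  proof (rule nn_integral_cong)
    fix \<omega>
    have "(\<Sum>k. ennreal (t ^ k) * (g \<omega> * indicator {\<omega>. mark_count E \<omega> = k} \<omega>))
        = (\<Sum>k\<in>{mark_count E \<omega>}. ennreal (t ^ k) * (g \<omega> * indicator {\<omega>. mark_count E \<omega> = k} \<omega>))"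
      by (rule suminf_finite) auto
    also have "\<dots> = ennreal (t ^ mark_count E \<omega>) * g \<omega>" by simp
    finally show "ennreal (?x * t ^ mark_count E \<omega>) * g \<omega>
        = ennreal ?x * (\<Sum>k. ennreal (t ^ k) * (g \<omega> * indicator {\<omega>. mark_count E \<omega> = k} \<omega>))"
      using t by (simp add: ennreal_mult mult.assoc)
  qed
  also have "\<dots> = ennreal ?x * (\<integral>\<^sup>+\<omega>. (\<Sum>k. ennreal (t ^ k) * (g \<omega> * indicator {\<omega>. mark_count E \<omega> = k} \<omega>)) \<partial>loop_law E 1 u)"
    by (rule nn_integral_cmult) measurable
  also have "(\<integral>\<^sup>+\<omega>. (\<Sum>k. ennreal (t ^ k) * (g \<omega> * indicator {\<omega>. mark_count E \<omega> = k} \<omega>)) \<partial>loop_law E 1 u)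
      = (\<Sum>k. \<integral>\<^sup>+\<omega>. ennreal (t ^ k) * (g \<omega> * indicator {\<omega>. mark_count E \<omega> = k} \<omega>) \<partial>loop_law E 1 u)"
    by (rule nn_integral_suminf) measurable
  also have "\<dots> = (\<Sum>k. ennreal (t ^ k) * (\<integral>\<^sup>+\<omega>. g \<omega> * indicator {\<omega>. mark_count E \<omega> = k} \<omega> \<partial>loop_law E 1 u))"
    by (intro suminf_cong nn_integral_cmult) measurable
  finally show ?thesis .
qed

definition add_mark_sum :: "'v set set \<Rightarrow> real \<Rightarrow> ('v config \<Rightarrow> real) \<Rightarrow> 'v config \<Rightarrow> real" where
  "add_mark_sum E u f \<omega> = (\<Sum>e\<in>E. \<integral>z. f (add_mark e z \<omega>) \<partial>mark_law u)"

text \<open>The expectation is an exponential times a power series whose coefficients \<open>c k\<close> are the means of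
  \<open>f\<close> on configurations with \<open>k\<close> marks, at intensity \<open>1\<close>.  The differentiated series has the coefficients
  \<open>(k + 1) * c (k + 1)\<close>, and by Mecke's formula these are the corresponding means of
  \<open>add_mark_sum E u f\<close>.  The exponential bound on \<open>f\<close> makes the series converge for all \<open>t\<close>.\<close>

theorem
  fixes f :: "'v config \<Rightarrow> real"
  assumes E: "finite E" and K: "0 \<le> K"
    and f [measurable]: "f \<in> borel_measurable (config_space E u)"
    and f_nonneg: "\<And>\<omega>. 0 \<le> f \<omega>"
    and bound: "AE \<omega> in loop_law E 1 u. f \<omega> \<le> K ^ (mark_count E \<omega> + 1)"
    and t: "0 \<le> t"
  shows integrable_loop_law: "integrable (loop_law E t u) f"
    and integrable_add_mark_sum: "integrable (loop_law E t u) (add_mark_sum E u f)"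
    and has_derivative_loop_law: "((\<lambda>t. \<integral>\<omega>. f \<omega> \<partial>loop_law E t u) has_real_derivative
      (\<integral>\<omega>. add_mark_sum E u f \<omega> \<partial>loop_law E t u) - real (card E) * (\<integral>\<omega>. f \<omega> \<partial>loop_law E t u)) (at t within {0..})"
proof -
  let ?M = "config_space E u" and ?Q = "mark_law u"
  let ?I = "\<lambda>k \<omega>. indicator {\<omega>. mark_count E \<omega> = k} \<omega> :: ennreal"
  let ?m = "\<lambda>k. \<integral>\<^sup>+\<omega>. 1 * ?I k \<omega> \<partial>loop_law E 1 u"
  let ?x = "\<lambda>t. exp ((1 - t) * real (card E))"
  interpret Q: prob_space ?Q by (rule prob_space_mark_law)
  interpret P1: prob_space "loop_law E 1 u" by (rule prob_space_loop_law)
  define b where "b k = (\<integral>\<^sup>+\<omega>. ennreal (f \<omega>) * ?I k \<omega> \<partial>loop_law E 1 u)" for k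
  define c where "c k = enn2real (b k)" for k
  have b_le: "b k \<le> ennreal (K ^ (k + 1)) * ?m k" for k
  proof -
    have "b k \<le> (\<integral>\<^sup>+\<omega>. ennreal (K ^ (k + 1)) * (1 * ?I k \<omega>) \<partial>loop_law E 1 u)"
      unfolding b_def
      by (rule nn_integral_mono_AE, use bound in eventually_elim)
         (auto split: split_indicator intro: ennreal_leI)
    also have "\<dots> = ennreal (K ^ (k + 1)) * ?m k"
      by (rule nn_integral_cmult) measurable
    finally show ?thesis .
  qed
  have "?m k \<le> (\<integral>\<^sup>+\<omega>. 1 \<partial>loop_law E 1 u)" for k
    by (rule nn_integral_mono) (simp split: split_indicator)
  hence "?m k \<le> 1" for k by (simp add: P1.emeasure_space_1[unfolded space_loop_law])
  hence "b k \<le> ennreal (K ^ (k + 1)) * 1" for k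
    using b_le[of k] by (meson mult_left_mono order_trans zero_le)
  hence b_fin: "b k < top" for k using le_less_trans[of "b k" "ennreal (K ^ (k + 1)) * 1" top] by simp
  hence bc: "b k = ennreal (c k)" for k by (simp add: c_def)
  have c0: "0 \<le> c k" for k by (simp add: c_def)
  \<comment> \<open>Compare with the total mass at intensity \<open>y * K\<close>, which is finite.\<close>
  have sum_pos: "summable (\<lambda>k. c k * y ^ k)" if y: "0 \<le> y" for y
  proof (rule summable_suminf_not_top)
    interpret Py: prob_space "loop_law E (y * K) u" by (rule prob_space_loop_law)
    let ?s = "\<Sum>k. ennreal ((y * K) ^ k) * ?m k"
    have "ennreal (?x (y * K)) * ?s = (\<integral>\<^sup>+\<omega>. 1 \<partial>loop_law E (y * K) u)"
      by (rule nn_integral_loop_law_series[symmetric]) (use y K E in auto)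
    also have "\<dots> = 1" by (simp add: Py.emeasure_space_1[unfolded space_loop_law])
    finally have fin: "?s \<noteq> top" by (auto simp: ennreal_mult_top)
    have "(\<Sum>k. ennreal (c k * y ^ k)) \<le> (\<Sum>k. ennreal K * (ennreal ((y * K) ^ k) * ?m k))"
    proof (rule suminf_le)
      fix k
      have "ennreal (c k * y ^ k) = ennreal (y ^ k) * b k" using y c0 by (simp add: bc ennreal_mult mult.commute)
      also have "\<dots> \<le> ennreal (y ^ k) * (ennreal (K ^ (k + 1)) * ?m k)"
        by (intro mult_left_mono b_le) simp
      also have "\<dots> = ennreal K * (ennreal ((y * K) ^ k) * ?m k)"
        using y K by (simp add: power_mult_distrib ennreal_mult mult_ac)
      finally show "ennreal (c k * y ^ k) \<le> ennreal K * (ennreal ((y * K) ^ k) * ?m k)" .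
    qed auto
    also have "\<dots> = ennreal K * ?s" by simp
    also have "\<dots> < top" using fin by (simp add: ennreal_mult_less_top less_top)
    finally show "(\<Sum>k. ennreal (c k * y ^ k)) \<noteq> top" by simp
  qed (use y c0 in simp)
  have sum: "summable (\<lambda>k. c k * y ^ k)" for y
  proof (rule summable_rabs_cancel)
    show "summable (\<lambda>k. \<bar>c k * y ^ k\<bar>)"
      using sum_pos[of "\<bar>y\<bar>"] by (simp only: abs_mult power_abs abs_of_nonneg[OF c0] abs_ge_zero)
  qed
  have sum': "summable (\<lambda>k. diffs c k * y ^ k)" for y by (rule termdiff_converges_all[OF sum])
  have d0: "0 \<le> diffs c k" for k using c0 by (simp add: diffs_def)
  have series: "(\<integral>\<^sup>+\<omega>. g \<omega> \<partial>loop_law E t u) = ennreal (?x t * (\<Sum>k. a k * t ^ k))"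
    if g: "g \<in> borel_measurable ?M" and t: "0 \<le> t" and a: "\<And>k. 0 \<le> a k" "summable (\<lambda>k. a k * t ^ k)"
      and ga: "\<And>k. (\<integral>\<^sup>+\<omega>. g \<omega> * ?I k \<omega> \<partial>loop_law E 1 u) = ennreal (a k)" for g t a
  proof -
    have "(\<Sum>k. ennreal (t ^ k) * ennreal (a k)) = (\<Sum>k. ennreal (a k * t ^ k))"
      using t a(1) by (simp add: ennreal_mult mult.commute)
    also have "\<dots> = ennreal (\<Sum>k. a k * t ^ k)" using t a by (intro suminf_ennreal2) auto
    finally show ?thesis
      using t a suminf_nonneg[OF a(2)] by (simp add: nn_integral_loop_law_series[OF t E g] ga ennreal_mult)
  qed
  have f_int: "(\<integral>\<^sup>+\<omega>. ennreal (f \<omega>) \<partial>loop_law E t u) = ennreal (?x t * (\<Sum>k. c k * t ^ k))" if "0 \<le> t" for t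
    by (rule series) (use that c0 sum bc b_def in auto)
  have F: "(\<integral>\<omega>. f \<omega> \<partial>loop_law E t u) = ?x t * (\<Sum>k. c k * t ^ k)" if "0 \<le> t" for t
  proof -
    have "(\<integral>\<omega>. f \<omega> \<partial>loop_law E t u) = enn2real (\<integral>\<^sup>+\<omega>. ennreal (f \<omega>) \<partial>loop_law E t u)"
      by (rule integral_eq_nn_integral) (auto simp: f_nonneg)
    thus ?thesis unfolding f_int[OF that] using that c0 by (simp add: suminf_nonneg sum)
  qed
  show "integrable (loop_law E t u) f"
    by (rule integrableI_nonneg) (auto simp: f_nonneg f_int[OF t])
  define L where "L \<omega> = (\<Sum>e\<in>E. \<integral>\<^sup>+z. ennreal (f (add_mark e z \<omega>)) \<partial>?Q)" for \<omega>
  have L [measurable]: "L \<in> borel_measurable ?M"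
    unfolding L_def by (intro borel_measurable_sum measurable_nn_integral_add_mark) auto
  have L_k: "(\<integral>\<^sup>+\<omega>. L \<omega> * ?I k \<omega> \<partial>loop_law E 1 u) = ennreal (diffs c k)" for k
  proof -
    let ?g = "\<lambda>\<omega>. ennreal (f \<omega>) * ?I (Suc k) \<omega>"
    have g: "?g \<in> borel_measurable ?M" by measurable
    have "(\<integral>\<^sup>+\<omega>. L \<omega> * ?I k \<omega> \<partial>loop_law E 1 u) = (\<integral>\<^sup>+\<omega>. (\<Sum>e\<in>E. \<integral>\<^sup>+z. ?g (add_mark e z \<omega>) \<partial>?Q) \<partial>loop_law E 1 u)"
    proof (rule nn_integral_cong)
      fix \<omega> assume "\<omega> \<in> space (loop_law E 1 u)"
      hence \<omega>: "\<omega> \<in> space ?M" by simp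
      have "(\<integral>\<^sup>+z. ennreal (f (add_mark e z \<omega>)) \<partial>?Q) * ?I k \<omega> = (\<integral>\<^sup>+z. ?g (add_mark e z \<omega>) \<partial>?Q)" if e: "e \<in> E" for e
      proof -
        have "(\<lambda>z. add_mark e z \<omega>) \<in> ?Q \<rightarrow>\<^sub>M ?M"
          using measurable_compose[OF measurable_Pair1'[OF \<omega>] measurable_add_mark[OF e, of u]] by simp
        hence [measurable]: "(\<lambda>z. f (add_mark e z \<omega>)) \<in> borel_measurable ?Q" by measurable
        have "(\<integral>\<^sup>+z. ?g (add_mark e z \<omega>) \<partial>?Q) = (\<integral>\<^sup>+z. ennreal (f (add_mark e z \<omega>)) * ?I k \<omega> \<partial>?Q)"
        proof (rule nn_integral_cong_AE, use AE_new_time[OF finite_configuration(1)[OF E \<omega>]] in eventually_elim)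
          case (elim z)
          show ?case using mark_count_add_mark[OF E \<omega> e elim] by (simp split: split_indicator)
        qed
        thus ?thesis by (simp add: nn_integral_multc)
      qed
      thus "L \<omega> * ?I k \<omega> = (\<Sum>e\<in>E. \<integral>\<^sup>+z. ?g (add_mark e z \<omega>) \<partial>?Q)"
        by (simp add: L_def sum_distrib_right)
    qed
    also have "\<dots> = (\<Sum>e\<in>E. \<integral>\<^sup>+\<omega>. \<integral>\<^sup>+z. ?g (add_mark e z \<omega>) \<partial>?Q \<partial>loop_law E 1 u)"
      by (rule nn_integral_sum) (use measurable_nn_integral_add_mark[OF _ g] in simp)
    also have "\<dots> = (\<Sum>e\<in>E. \<integral>\<^sup>+\<omega>. of_nat (card (\<omega> e)) * ?g \<omega> \<partial>loop_law E 1 u)"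
      by (rule sum.cong[OF refl]) (use loop_law_mecke[OF _ E _ g, of 1] in simp)
    also have "\<dots> = (\<integral>\<^sup>+\<omega>. (\<Sum>e\<in>E. of_nat (card (\<omega> e)) * ?g \<omega>) \<partial>loop_law E 1 u)"
      by (rule nn_integral_sum[symmetric]) measurable
    also have "\<dots> = (\<integral>\<^sup>+\<omega>. of_nat (Suc k) * ?g \<omega> \<partial>loop_law E 1 u)"
    proof (rule nn_integral_cong)
      fix \<omega>
      have "(\<Sum>e\<in>E. of_nat (card (\<omega> e)) * ?g \<omega>) = of_nat (mark_count E \<omega>) * ?g \<omega>"
        by (simp add: mark_count_def sum_distrib_right)
      also have "\<dots> = of_nat (Suc k) * ?g \<omega>" by (simp split: split_indicator)
      finally show "(\<Sum>e\<in>E. of_nat (card (\<omega> e)) * ?g \<omega>) = of_nat (Suc k) * ?g \<omega>" .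
    qed
    also have "\<dots> = of_nat (Suc k) * b (Suc k)" unfolding b_def by (rule nn_integral_cmult) measurable
    also have "\<dots> = ennreal (diffs c k)"
      using c0 by (simp only: bc diffs_def ennreal_of_nat_eq_real_of_nat) (rule ennreal_mult[symmetric], auto)
    finally show ?thesis .
  qed
  have L_int: "(\<integral>\<^sup>+\<omega>. L \<omega> \<partial>loop_law E t u) = ennreal (?x t * (\<Sum>k. diffs c k * t ^ k))"
    by (rule series[OF L t d0 sum' L_k])
  \<comment> \<open>A finite mean makes the sum \<open>L\<close> finite almost surely, so that it is a sum of real integrals.\<close>
  have "AE \<omega> in loop_law E t u. L \<omega> \<noteq> \<infinity>"
    by (rule nn_integral_PInf_AE) (simp_all add: L_int)
  hence L_eq: "AE \<omega> in loop_law E t u. L \<omega> = ennreal (add_mark_sum E u f \<omega>)"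
  proof (rule AE_mp, intro AE_I2 impI)
    fix \<omega> assume "\<omega> \<in> space (loop_law E t u)" and fin: "L \<omega> \<noteq> \<infinity>"
    hence \<omega>: "\<omega> \<in> space ?M" by simp
    have one: "(\<integral>\<^sup>+z. ennreal (f (add_mark e z \<omega>)) \<partial>?Q) = ennreal (\<integral>z. f (add_mark e z \<omega>) \<partial>?Q)" if e: "e \<in> E" for e
    proof (rule nn_integral_eq_integral)
      have "(\<lambda>z. add_mark e z \<omega>) \<in> ?Q \<rightarrow>\<^sub>M ?M"
        using measurable_compose[OF measurable_Pair1'[OF \<omega>] measurable_add_mark[OF e, of u]] by simp
      hence [measurable]: "(\<lambda>z. f (add_mark e z \<omega>)) \<in> borel_measurable ?Q" by measurable
      have "(\<integral>\<^sup>+z. ennreal (f (add_mark e z \<omega>)) \<partial>?Q) \<le> L \<omega>"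
        unfolding L_def using E e by (intro member_le_sum) auto
      hence "(\<integral>\<^sup>+z. ennreal (f (add_mark e z \<omega>)) \<partial>?Q) < \<infinity>" using fin by (simp add: le_less_trans less_top)
      thus "integrable ?Q (\<lambda>z. f (add_mark e z \<omega>))" by (intro integrableI_nonneg) (auto simp: f_nonneg)
    qed (simp add: f_nonneg)
    show "L \<omega> = ennreal (add_mark_sum E u f \<omega>)"
      unfolding L_def add_mark_sum_def using one by (subst sum_ennreal[symmetric]) (auto simp: f_nonneg intro: sum.cong)
  qed
  have A0: "0 \<le> add_mark_sum E u f \<omega>" for \<omega>
    unfolding add_mark_sum_def by (intro sum_nonneg) (simp add: f_nonneg)
  have A [measurable]: "add_mark_sum E u f \<in> borel_measurable ?M"
  proof -
    have "(\<lambda>(\<omega>, z). f (add_mark e z \<omega>)) \<in> borel_measurable (?M \<Otimes>\<^sub>M ?Q)" if "e \<in> E" for e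
      using measurable_compose[OF measurable_add_mark[OF that, of u] f] by (simp add: case_prod_beta)
    thus ?thesis unfolding add_mark_sum_def
      by (intro borel_measurable_sum Q.borel_measurable_lebesgue_integral)
  qed
  have A_int: "(\<integral>\<^sup>+\<omega>. ennreal (add_mark_sum E u f \<omega>) \<partial>loop_law E t u) = ennreal (?x t * (\<Sum>k. diffs c k * t ^ k))"
    unfolding L_int[symmetric] by (rule nn_integral_cong_AE, use L_eq in eventually_elim) simp
  show "integrable (loop_law E t u) (add_mark_sum E u f)"
    by (rule integrableI_nonneg) (auto simp: A0 A_int)
  have LI: "(\<integral>\<omega>. add_mark_sum E u f \<omega> \<partial>loop_law E t u) = ?x t * (\<Sum>k. diffs c k * t ^ k)"
  proof -
    have "(\<integral>\<omega>. add_mark_sum E u f \<omega> \<partial>loop_law E t u) = enn2real (\<integral>\<^sup>+\<omega>. ennreal (add_mark_sum E u f \<omega>) \<partial>loop_law E t u)"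
      by (rule integral_eq_nn_integral) (auto simp: A0)
    thus ?thesis unfolding A_int using t d0 by (simp add: suminf_nonneg sum')
  qed
  have "((\<lambda>t. ?x t * (\<Sum>k. c k * t ^ k)) has_real_derivative
      ?x t * (\<Sum>k. diffs c k * t ^ k) - real (card E) * (?x t * (\<Sum>k. c k * t ^ k))) (at t within {0..})"
  proof -
    have "((\<lambda>t. \<Sum>k. c k * t ^ k) has_real_derivative (\<Sum>k. diffs c k * t ^ k)) (at t within {0..})"
      by (rule has_field_derivative_at_within[OF termdiffs_strong_converges_everywhere[OF sum]])
    moreover have "(?x has_real_derivative - real (card E) * ?x t) (at t within {0..})"
      by (auto intro!: derivative_eq_intros)
    ultimately show ?thesis
      by (auto dest: DERIV_mult simp: algebra_simps)
  qed
  hence "((\<lambda>t. \<integral>\<omega>. f \<omega> \<partial>loop_law E t u) has_real_derivative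
      ?x t * (\<Sum>k. diffs c k * t ^ k) - real (card E) * (?x t * (\<Sum>k. c k * t ^ k))) (at t within {0..})"
    by (rule has_field_derivative_transform_within[OF _ zero_less_one]) (use t F in auto)
  thus "((\<lambda>t. \<integral>\<omega>. f \<omega> \<partial>loop_law E t u) has_real_derivative
      (\<integral>\<omega>. add_mark_sum E u f \<omega> \<partial>loop_law E t u) - real (card E) * (\<integral>\<omega>. f \<omega> \<partial>loop_law E t u)) (at t within {0..})"
    by (simp only: LI F[OF t])
qed

section \<open>The derivative and its bound\<close>

text \<open>Chosen such that the derivative of its mean covers \<open>\<theta> = 1\<close> and \<open>\<theta> \<noteq> 1\<close> alike: it equals \<open>k\<close> for \<open>\<theta> = 1\<close>, and
  \<open>\<theta> / (\<theta> - 1) * (\<theta> ^ k - 1)\<close> otherwise.\<close>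

definition loop_weight_sum :: "real \<Rightarrow> nat \<Rightarrow> real" where
  "loop_weight_sum \<theta> k = (\<Sum>j=1..k. \<theta> ^ j)"

lemma loop_weight_sum_Suc: "loop_weight_sum \<theta> (Suc k) = loop_weight_sum \<theta> k + \<theta> * \<theta> ^ k"
  by (simp add: loop_weight_sum_def)

lemma loop_weight_sum_mono: "0 < \<theta> \<Longrightarrow> k \<le> l \<Longrightarrow> loop_weight_sum \<theta> k \<le> loop_weight_sum \<theta> l"
  unfolding loop_weight_sum_def by (intro sum_mono2) auto

lemma loop_weight_sum_nonneg: "0 < \<theta> \<Longrightarrow> 0 \<le> loop_weight_sum \<theta> k"
  unfolding loop_weight_sum_def by (intro sum_nonneg) auto

lemma power_eq_loop_weight_sum:
  assumes "0 < \<theta>"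
  shows "\<theta> ^ k = 1 + (\<theta> - 1) / \<theta> * loop_weight_sum \<theta> k"
proof (induction k)
  case (Suc k)
  have "1 + (\<theta> - 1) / \<theta> * loop_weight_sum \<theta> (Suc k)
      = (1 + (\<theta> - 1) / \<theta> * loop_weight_sum \<theta> k) + (\<theta> - 1) / \<theta> * (\<theta> * \<theta> ^ k)"
    unfolding loop_weight_sum_Suc by (simp add: distrib_left)
  also have "\<dots> = \<theta> ^ k + (\<theta> - 1) * \<theta> ^ k" using assms Suc.IH by simp
  also have "\<dots> = \<theta> ^ Suc k" by (simp add: algebra_simps)
  finally show ?case ..
qed (simp add: loop_weight_sum_def)

lemma loop_weight_sum_le:
  assumes "0 < \<theta>"
  shows "loop_weight_sum \<theta> k \<le> (2 * max 1 \<theta>) ^ k"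
proof (induction k)
  case (Suc k)
  let ?m = "max 1 \<theta>"
  have "\<theta> ^ k \<le> ?m ^ k" using assms by (intro power_mono) auto
  also have "\<dots> \<le> (2 * ?m) ^ k" using assms by (intro power_mono) auto
  finally have "\<theta> * \<theta> ^ k \<le> ?m * (2 * ?m) ^ k" using assms by (intro mult_mono) auto
  moreover have "loop_weight_sum \<theta> k \<le> ?m * (2 * ?m) ^ k"
  proof -
    have "1 * (2 * ?m) ^ k \<le> ?m * (2 * ?m) ^ k" by (intro mult_right_mono) auto
    thus ?thesis using Suc.IH by linarith
  qed
  ultimately show ?case by (simp add: loop_weight_sum_Suc)
qed (simp add: loop_weight_sum_def)

lemma measurable_num_loops [measurable]:
  assumes "finite E"
  shows "num_loops V E \<in> measurable (config_space E u) (count_space UNIV)"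
proof -
  let ?M = "config_space E u"
  have "num_loops V E -` {k} \<inter> space ?M \<in> sets ?M" for k
  proof -
    have "{\<omega> \<in> space ?M. num_loops V E \<omega> = k} \<in> sets ?M"
      by (rule time_invariant_measurable[OF assms time_invariant_num_loops])
    moreover have "num_loops V E -` {k} \<inter> space ?M = {\<omega> \<in> space ?M. num_loops V E \<omega> = k}" by blast
    ultimately show ?thesis by simp
  qed
  thus ?thesis by (simp add: measurable_count_space_eq2_countable)
qed

lemma trajectory_start: "(x, s) \<in> trajectory E \<omega> (x, s, d)"
  unfolding trajectory_def by blast

lemma integral_mark_law:
  fixes g :: "real \<times> mark \<Rightarrow> real"
  assumes u: "0 \<le> u" "u \<le> 1" and g: "integrable (mark_law u) g"
  shows "(\<integral>z. g z \<partial>mark_law u) = (\<integral>s. u * g (s, Cross) + (1 - u) * g (s, Bar) \<partial>circle)"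
    and "integrable circle (\<lambda>s. u * g (s, Cross) + (1 - u) * g (s, Bar))"
proof -
  let ?B = "measure_pmf (map_pmf (\<lambda>b. if b then Cross else Bar) (bernoulli_pmf u))"
  interpret C: prob_space circle
    by (auto simp: circle_def emeasure_restrict_space space_restrict_space intro!: prob_spaceI)
  interpret B: prob_space ?B by (rule prob_space_measure_pmf)
  interpret CB: pair_prob_space circle ?B ..
  have B: "(\<integral>m. h m \<partial>?B) = u * h Cross + (1 - u) * h Bar" for h :: "mark \<Rightarrow> real"
    using u by (simp add: mult.commute)
  have g': "integrable (circle \<Otimes>\<^sub>M ?B) g" using g by (simp only: mark_law_def)
  show "(\<integral>z. g z \<partial>mark_law u) = (\<integral>s. u * g (s, Cross) + (1 - u) * g (s, Bar) \<partial>circle)"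
    unfolding mark_law_def using CB.integral_fst'[OF g'] unfolding B by simp
  show "integrable circle (\<lambda>s. u * g (s, Cross) + (1 - u) * g (s, Bar))"
    using CB.integrable_fst'[OF g'] unfolding B .
qed

text \<open>For fixed \<open>\<omega>\<close>, the effect \<open>\<psi> e (s, m)\<close> of the new mark is averaged over the kind \<open>m\<close> of mark, then
  summed over the edges, and then averaged over the time \<open>s\<close>.  The average over kinds is
  \<open>- (\<theta> ^ \<lambda>)\<close> at most if the mark merges two loops; if the ends of \<open>e\<close> share a loop, it is at most
  \<open>max u (1 - u) * \<theta> * \<theta> ^ \<lambda> = (c - 1) * \<theta> ^ \<lambda>\<close>, since only one kind can create a loop.\<close>

lemma add_mark_sum_bound:
  fixes V :: "'v set" and \<theta> u \<eta> \<epsilon> c :: real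
  defines "\<kappa> \<equiv> loop_weight_sum \<theta>"
  assumes u: "0 \<le> u" "u \<le> 1" and \<theta>: "0 < \<theta>" and c: "c = 1 + \<theta> * max u (1 - u)"
    and graph: "simple_graph V E"
    and sparse: "\<And>S. S \<subseteq> V \<Longrightarrow> real (card S) \<le> \<eta> * real (card V) \<Longrightarrow>
           real (edges_within E S) \<le> (1 + \<epsilon>) * real (card S)"
    and \<omega>: "\<omega> \<in> space (config_space E u)" and dist: "distinct_times E \<omega>"
  shows "add_mark_sum E u (\<lambda>\<omega>. \<kappa> (num_loops V E \<omega>)) \<omega> - real (card E) * \<kappa> (num_loops V E \<omega>) \<le>
    \<theta> ^ num_loops V E \<omega> * (if \<exists>\<gamma>\<in>loops V E \<omega>. real (card (loop_support V \<gamma>)) > \<eta> * real (card V)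
       then \<theta> * real (card E) else c * (1 + \<epsilon>) * real (card V) - real (card E))"
    (is "_ \<le> _ * ?bound")
proof -
  let ?N = "num_loops V E" and ?M = "config_space E u"
  have V: "finite V" and EV: "\<And>e. e \<in> E \<Longrightarrow> e \<subseteq> V \<and> card e = 2"
    using graph by (auto simp: simple_graph_def)
  have E: "finite E" using V EV by (meson finite_Pow_iff finite_subset Pow_iff subsetI)
  note fin = finite_configuration(1,2)[OF E \<omega>]
  interpret Q: prob_space "mark_law u" by (rule prob_space_mark_law)
  interpret C: prob_space circle
    by (auto simp: circle_def emeasure_restrict_space space_restrict_space intro!: prob_spaceI)
  define \<psi> where "\<psi> e z = \<kappa> (?N (add_mark e z \<omega>)) - \<kappa> (?N \<omega>)" for e z
  let ?avg = "\<lambda>e s. u * \<psi> e (s, Cross) + (1 - u) * \<psi> e (s, Bar)"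
  define joined where "joined s e \<longleftrightarrow> (\<exists>\<gamma>. \<forall>x\<in>e. trajectory E \<omega> (x, s, 1) = \<gamma>)" for s e
  have add: "(\<not> joined s e \<longrightarrow> (\<forall>m. ?N (add_mark e (s, m) \<omega>) + 1 \<le> ?N \<omega>)) \<and>
      (\<exists>m. ?N (add_mark e (s, m) \<omega>) \<le> ?N \<omega> + 1 \<and> (\<forall>m'. m' \<noteq> m \<longrightarrow> ?N (add_mark e (s, m') \<omega>) \<le> ?N \<omega>))"
    if e: "e \<in> E" and s: "s \<in> {0..<1}" "s \<notin> mark_times E \<omega>" for s e
  proof -
    obtain x y where xy: "e = {x, y}" using EV[OF e] by (auto simp: card_2_iff)
    have "joined s e \<longleftrightarrow> trajectory E \<omega> (x, s, 1) = trajectory E \<omega> (y, s, 1)"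
      by (auto simp: joined_def xy)
    thus ?thesis
      using merge_loops[OF graph dist fin e[unfolded xy] s] split_loop[OF graph dist fin e[unfolded xy] s]
      unfolding xy by blast
  qed
  have up: "\<kappa> (Suc k) = \<kappa> k + \<theta> * \<theta> ^ k" for k unfolding \<kappa>_def by (rule loop_weight_sum_Suc)
  have mono: "\<kappa> k \<le> \<kappa> l" if "k \<le> l" for k l unfolding \<kappa>_def by (rule loop_weight_sum_mono[OF \<theta> that])
  have \<psi>_up: "\<psi> e (s, m) \<le> \<theta> * \<theta> ^ ?N \<omega>" if "?N (add_mark e (s, m) \<omega>) \<le> ?N \<omega> + 1" for e s m
    using mono[OF that] up[of "?N \<omega>"] by (simp add: \<psi>_def)
  have \<psi>_same: "\<psi> e (s, m) \<le> 0" if "?N (add_mark e (s, m) \<omega>) \<le> ?N \<omega>" for e s m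
    using mono[OF that] by (simp add: \<psi>_def)
  have \<psi>_down: "\<psi> e (s, m) \<le> - (\<theta> ^ ?N \<omega>)" if le: "?N (add_mark e (s, m) \<omega>) + 1 \<le> ?N \<omega>" for e s m
  proof -
    obtain l where l: "?N \<omega> = Suc l" using le by (cases "?N \<omega>") auto
    have "?N (add_mark e (s, m) \<omega>) \<le> l" using le l by simp
    from mono[OF this] show ?thesis using up[of l] by (simp add: \<psi>_def l)
  qed
  have one_edge: "?avg e s \<le> \<theta> ^ ?N \<omega> * (c * (if joined s e then 1 else 0) - 1)"
    if e: "e \<in> E" and s: "s \<in> {0..<1}" "s \<notin> mark_times E \<omega>" for s e
  proof (cases "joined s e")
    case False
    hence "\<psi> e (s, m) \<le> - (\<theta> ^ ?N \<omega>)" for m using add[OF e s] \<psi>_down by blast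
    hence "?avg e s \<le> u * - (\<theta> ^ ?N \<omega>) + (1 - u) * - (\<theta> ^ ?N \<omega>)"
      using u by (intro add_mono mult_left_mono) auto
    also have "\<dots> = - (\<theta> ^ ?N \<omega>)" by (simp add: algebra_simps)
    finally show ?thesis using False by simp
  next
    case True
    obtain m where m: "?N (add_mark e (s, m) \<omega>) \<le> ?N \<omega> + 1"
      "\<And>m'. m' \<noteq> m \<Longrightarrow> ?N (add_mark e (s, m') \<omega>) \<le> ?N \<omega>"
      using add[OF e s] by blast
    let ?w = "\<theta> * \<theta> ^ ?N \<omega>"
    have w: "0 \<le> ?w" using \<theta> by simp
    have "?avg e s \<le> max u (1 - u) * ?w"
    proof (cases m)
      case Cross
      have "u * \<psi> e (s, Cross) \<le> u * ?w" using m(1) u by (intro mult_left_mono \<psi>_up) (auto simp: Cross)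
      moreover have "(1 - u) * \<psi> e (s, Bar) \<le> 0"
        using \<psi>_same[OF m(2), of Bar] u by (simp add: Cross mult_nonneg_nonpos)
      moreover have "u * ?w \<le> max u (1 - u) * ?w" using w by (intro mult_right_mono) auto
      ultimately show ?thesis by linarith
    next
      case Bar
      have "(1 - u) * \<psi> e (s, Bar) \<le> (1 - u) * ?w" using m(1) u by (intro mult_left_mono \<psi>_up) (auto simp: Bar)
      moreover have "u * \<psi> e (s, Cross) \<le> 0"
        using \<psi>_same[OF m(2), of Cross] u by (simp add: Bar mult_nonneg_nonpos)
      moreover have "(1 - u) * ?w \<le> max u (1 - u) * ?w" using w by (intro mult_right_mono) auto
      ultimately show ?thesis by linarith
    qed
    also have "\<dots> = \<theta> ^ ?N \<omega> * (c - 1)" by (simp add: c)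
    finally show ?thesis using True by simp
  qed
  have c0: "0 \<le> c" using c \<theta> u by (simp add: max_def)
  have joined_bound: "c * real (card {e \<in> E. joined s e}) - real (card E) \<le> ?bound" if s: "s \<in> {0..<1}" for s
  proof (cases "\<exists>\<gamma>\<in>loops V E \<omega>. real (card (loop_support V \<gamma>)) > \<eta> * real (card V)")
    case True
    have "card {e \<in> E. joined s e} \<le> card E" using E by (intro card_mono) auto
    hence "c * real (card {e \<in> E. joined s e}) \<le> c * real (card E)" using c0 by (intro mult_left_mono) auto
    moreover have "c * real (card E) - real (card E) \<le> \<theta> * real (card E)"
    proof -
      have "\<theta> * max u (1 - u) \<le> \<theta> * 1" using u \<theta> by (intro mult_left_mono) auto
      hence "c - 1 \<le> \<theta>" by (simp add: c)
      hence "(c - 1) * real (card E) \<le> \<theta> * real (card E)" by (intro mult_right_mono) auto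
      thus ?thesis by (simp add: algebra_simps)
    qed
    ultimately show ?thesis using True by simp
  next
    case False
    have "real (card {e \<in> E. \<exists>\<gamma>. \<forall>x\<in>e. trajectory E \<omega> (x, s, 1) = \<gamma>}) \<le> (1 + \<epsilon>) * real (card V)"
    proof (rule edges_in_small_classes[OF graph])
      fix \<gamma>
      let ?S = "{x \<in> V. trajectory E \<omega> (x, s, 1) = \<gamma>}"
      assume "\<gamma> \<in> (\<lambda>x. trajectory E \<omega> (x, s, 1)) ` V"
      hence "\<gamma> \<in> loops V E \<omega>" unfolding loops_def using s by blast
      hence "real (card (loop_support V \<gamma>)) \<le> \<eta> * real (card V)" using False by (meson not_le)
      moreover have "?S \<subseteq> loop_support V \<gamma>"
        using s trajectory_start[of _ s E \<omega> 1] unfolding loop_support_def by blast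
      hence "card ?S \<le> card (loop_support V \<gamma>)"
        using V by (intro card_mono) (auto simp: loop_support_def)
      ultimately show "real (edges_within E ?S)
          \<le> (1 + \<epsilon>) * real (card ?S)"
        by (intro sparse) auto
    qed
    hence "c * real (card {e \<in> E. joined s e}) \<le> c * ((1 + \<epsilon>) * real (card V))"
      unfolding joined_def using c0 by (intro mult_left_mono) auto
    thus ?thesis using False by (simp add: mult.assoc)
  qed
  have at_time: "(\<Sum>e\<in>E. ?avg e s) \<le> \<theta> ^ ?N \<omega> * ?bound"
    if s: "s \<in> {0..<1}" "s \<notin> mark_times E \<omega>" for s
  proof -
    have "(\<Sum>e\<in>E. ?avg e s)
        \<le> (\<Sum>e\<in>E. \<theta> ^ ?N \<omega> * (c * (if joined s e then 1 else 0) - 1))"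
      by (intro sum_mono one_edge s)
    also have "\<dots> = \<theta> ^ ?N \<omega> * (c * (\<Sum>e\<in>E. if joined s e then 1 else 0) - real (card E))"
      by (simp add: sum_distrib_left[symmetric] sum_subtractf)
    also have "(\<Sum>e\<in>E. if joined s e then 1 else 0) = real (card {e \<in> E. joined s e})"
      using E by (simp add: sum.If_cases Int_def)
    also have "\<theta> ^ ?N \<omega> * (c * real (card {e \<in> E. joined s e}) - real (card E)) \<le> \<theta> ^ ?N \<omega> * ?bound"
      using \<theta> joined_bound[OF s(1)] by (intro mult_left_mono) auto
    finally show ?thesis .
  qed
  have meas: "(\<lambda>z. \<kappa> (?N (add_mark e z \<omega>))) \<in> borel_measurable (mark_law u)" if e: "e \<in> E" for e
  proof -
    have "(\<lambda>z. add_mark e z \<omega>) \<in> mark_law u \<rightarrow>\<^sub>M ?M"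
      using measurable_compose[OF measurable_Pair1'[OF \<omega>] measurable_add_mark[OF e, of u]] by simp
    from measurable_compose[OF this measurable_num_loops[OF E, of V u]] show ?thesis by measurable
  qed
  have int: "integrable (mark_law u) (\<lambda>z. \<kappa> (?N (add_mark e z \<omega>)))" if e: "e \<in> E" for e
  proof (rule Q.integrable_const_bound[where B = "\<kappa> (?N \<omega> + 1)"])
    have "AE z in mark_law u. fst z \<in> {0..<1}" by (rule AE_I2) (auto simp: space_mark_law)
    with AE_new_time[OF fin(1)]
    show "AE z in mark_law u. norm (\<kappa> (?N (add_mark e z \<omega>))) \<le> \<kappa> (?N \<omega> + 1)"
    proof eventually_elim
      case (elim z)
      obtain s m where z: "z = (s, m)" by (cases z)
      have s: "s \<in> {0..<1}" "s \<notin> mark_times E \<omega>" using elim z by auto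
      have "?N (add_mark e z \<omega>) \<le> ?N \<omega> + 1" using add[OF e s] unfolding z by (metis le_add1 order_trans)
      thus ?case using mono loop_weight_sum_nonneg[OF \<theta>] by (simp add: \<kappa>_def)
    qed
  qed (rule meas[OF e])
  have int\<psi>: "integrable (mark_law u) (\<psi> e)" if "e \<in> E" for e
    unfolding \<psi>_def[abs_def] using int[OF that] by simp
  have "add_mark_sum E u (\<lambda>\<omega>. \<kappa> (?N \<omega>)) \<omega> - real (card E) * \<kappa> (?N \<omega>) = (\<Sum>e\<in>E. \<integral>z. \<psi> e z \<partial>mark_law u)"
    unfolding add_mark_sum_def \<psi>_def using int by (simp add: sum_subtractf Q.prob_space)
  also have "\<dots> = (\<Sum>e\<in>E. \<integral>s. ?avg e s \<partial>circle)"
    by (intro sum.cong refl integral_mark_law(1) u int\<psi>)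
  also have "\<dots> = (\<integral>s. (\<Sum>e\<in>E. ?avg e s) \<partial>circle)"
    by (rule Bochner_Integration.integral_sum[symmetric]) (intro integral_mark_law(2) u int\<psi>)
  also have "\<dots> \<le> (\<integral>s. \<theta> ^ ?N \<omega> * ?bound \<partial>circle)"
  proof (rule integral_mono_AE)
    have "AE s in circle. s \<noteq> a" for a
      unfolding circle_def by (subst AE_restrict_space_iff) (auto intro: AE_mp[OF AE_lborel_singleton[of a]])
    hence "AE s in circle. \<forall>a\<in>mark_times E \<omega>. s \<noteq> a" by (intro AE_finite_allI fin(1))
    moreover have "AE s in circle. s \<in> {0..<1}"
      by (rule AE_I2) (simp add: circle_def space_restrict_space)
    ultimately show "AE s in circle. (\<Sum>e\<in>E. ?avg e s) \<le> \<theta> ^ ?N \<omega> * ?bound"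
      by eventually_elim (intro at_time, auto)
  qed (intro Bochner_Integration.integrable_sum integral_mark_law(2) u int\<psi>, simp_all)
  also have "\<dots> = \<theta> ^ ?N \<omega> * ?bound" by (simp add: C.prob_space)
  finally show ?thesis .
qed

theorem proposition3p1:
  fixes V :: "'v set" and E :: "'v set set" and u \<theta> \<eta> \<epsilon> c t :: real
  assumes "0 \<le> u" "u \<le> 1" "\<theta> > 0"
    and "c = 1 + \<theta> * max u (1 - u)"
    and "simple_graph V E"
    and "\<eta> > 0" "\<epsilon> > 0"
    and "\<And>S. S \<subseteq> V \<Longrightarrow> real (card S) \<le> \<eta> * real (card V) \<Longrightarrow>
           real (edges_within E S) \<le> (1 + \<epsilon>) * real (card S)"
    and "t \<ge> 0"
  shows "\<exists>D. has_loop_derivative V E \<theta> u t D \<and>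
    D \<le> (c * (1 + \<epsilon>) * real (card V) - real (card E))
        + ((1 + \<theta>) * real (card E) - c * (1 + \<epsilon>) * real (card V))
          * measure (weighted_law V E \<theta> t u) (large_loop_event V E \<theta> t u \<eta>)"
proof -
  note u = assms(1,2) and \<theta> = assms(3) and graph = assms(5) and t = assms(9)
  let ?N = "num_loops V E" and ?M = "config_space E u"
  define \<kappa> where "\<kappa> = loop_weight_sum \<theta>"
  define f where "f \<omega> = \<kappa> (?N \<omega>)" for \<omega>
  define Z where "Z = partition_function V E \<theta> t u"
  have V: "finite V" and EV: "\<And>e. e \<in> E \<Longrightarrow> e \<subseteq> V"
    using graph by (auto simp: simple_graph_def)
  have E: "finite E" using V EV by (meson finite_Pow_iff finite_subset Pow_iff subsetI)
  note [measurable] = measurable_num_loops[OF E, of V u]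
  have f [measurable]: "f \<in> borel_measurable ?M" unfolding f_def by measurable
  have f0: "0 \<le> f \<omega>" for \<omega> unfolding f_def \<kappa>_def by (rule loop_weight_sum_nonneg[OF \<theta>])
  \<comment> \<open>From \<open>loop_weight_sum_le\<close> and the linear bound on the number of loops.\<close>
  define K where "K = (2 * max 1 \<theta>) ^ (2 * card V)"
  have K0: "0 \<le> K" unfolding K_def by simp
  have bound: "AE \<omega> in loop_law E 1 u. f \<omega> \<le> K ^ (mark_count E \<omega> + 1)"
  proof (rule AE_mp[OF AE_distinct_times[OF zero_le_one E]], intro AE_I2 impI)
    fix \<omega> assume "\<omega> \<in> space (loop_law E 1 u)" and d: "distinct_times E \<omega>"
    hence \<omega>: "\<omega> \<in> space ?M" by simp
    have "?N \<omega> \<le> 2 * card V * (card (mark_times E \<omega>) + 1)"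
      by (rule num_loops_le_mark_times[OF graph d finite_configuration(1,2)[OF E \<omega>]])
    also have "\<dots> \<le> 2 * card V * (mark_count E \<omega> + 1)"
      using finite_configuration(4)[OF E \<omega>] by (intro mult_le_mono2) simp
    finally have le: "?N \<omega> \<le> 2 * card V * (mark_count E \<omega> + 1)" .
    have "f \<omega> \<le> (2 * max 1 \<theta>) ^ ?N \<omega>" unfolding f_def \<kappa>_def by (rule loop_weight_sum_le[OF \<theta>])
    also have "\<dots> \<le> (2 * max 1 \<theta>) ^ (2 * card V * (mark_count E \<omega> + 1))" by (rule power_increasing[OF le]) simp
    also have "\<dots> = K ^ (mark_count E \<omega> + 1)" by (simp only: K_def power_mult)
    finally show "f \<omega> \<le> K ^ (mark_count E \<omega> + 1)" .
  qed
  note int_f = integrable_loop_law[OF E K0 f f0 bound]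
    and int_L = integrable_add_mark_sum[OF E K0 f f0 bound t]
    and deriv = has_derivative_loop_law[OF E K0 f f0 bound t]
  interpret P: prob_space "loop_law E t u" by (rule prob_space_loop_law)
  define D0 where "D0 = (\<integral>\<omega>. add_mark_sum E u f \<omega> \<partial>loop_law E t u) - real (card E) * (\<integral>\<omega>. f \<omega> \<partial>loop_law E t u)"
  have power: "\<theta> ^ ?N \<omega> = 1 + (\<theta> - 1) / \<theta> * f \<omega>" for \<omega>
    unfolding f_def \<kappa>_def by (rule power_eq_loop_weight_sum[OF \<theta>])
  have int_w: "integrable (loop_law E t u) (\<lambda>\<omega>. \<theta> ^ ?N \<omega>)"
    unfolding power using int_f[OF t] by simp
  have Zt: "partition_function V E \<theta> t u = 1 + (\<theta> - 1) / \<theta> * (\<integral>\<omega>. f \<omega> \<partial>loop_law E t u)" if "0 \<le> t" for t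
  proof -
    interpret Pt: prob_space "loop_law E t u" by (rule prob_space_loop_law)
    show ?thesis unfolding partition_function_def power
      using int_f[OF that] by (simp add: Pt.prob_space[unfolded space_loop_law])
  qed
  have Z: "0 < Z"
  proof -
    have "(\<integral>\<omega>. 0 \<partial>loop_law E t u) < (\<integral>\<omega>. \<theta> ^ ?N \<omega> \<partial>loop_law E t u)"
      by (rule P.integral_less_AE_space) (use int_w \<theta> P.emeasure_space_1 in auto)
    thus ?thesis by (simp add: Z_def partition_function_def)
  qed
  have der: "has_loop_derivative V E \<theta> u t (D0 / Z)"
  proof (cases "\<theta> = 1")
    case True
    have \<kappa>1: "\<kappa> k = real k" for k by (simp add: \<kappa>_def loop_weight_sum_def True)
    have mean: "mean_loops V E t u = (\<integral>\<omega>. f \<omega> \<partial>loop_law E t u)" for t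
    proof -
      interpret Pt: prob_space "loop_law E t u" by (rule prob_space_loop_law)
      have "partition_function V E 1 t u = 1"
        by (simp add: partition_function_def Pt.prob_space[unfolded space_loop_law])
      hence "weighted_law V E 1 t u = loop_law E t u" by (simp add: weighted_law_def density_1)
      thus ?thesis by (simp add: mean_loops_def f_def \<kappa>1)
    qed
    have "Z = 1" using Zt[OF t] True by (simp add: Z_def)
    thus ?thesis using deriv True by (simp add: has_loop_derivative_def mean D0_def)
  next
    case False
    let ?r = "(\<theta> - 1) / \<theta>"
    have r: "\<theta> / (\<theta> - 1) * ?r = 1" using False \<theta> by simp
    have "((\<lambda>t. 1 + ?r * (\<integral>\<omega>. f \<omega> \<partial>loop_law E t u)) has_real_derivative ?r * D0) (at t within {0..})"
      using deriv \<theta> unfolding D0_def[symmetric] by (auto intro!: derivative_eq_intros)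
    hence "((\<lambda>t. partition_function V E \<theta> t u) has_real_derivative ?r * D0) (at t within {0..})"
      by (rule has_field_derivative_transform_within[OF _ zero_less_one]) (use t Zt in auto)
    hence "((\<lambda>t. ln (partition_function V E \<theta> t u)) has_real_derivative 1 / Z * (?r * D0)) (at t within {0..})"
      by (rule DERIV_chain') (use Z in \<open>auto simp: Z_def intro!: derivative_eq_intros\<close>)
    moreover have "D0 / Z = \<theta> / (\<theta> - 1) * (1 / Z * (?r * D0))"
    proof -
      have "\<theta> / (\<theta> - 1) * (1 / Z * (?r * D0)) = (\<theta> / (\<theta> - 1) * ?r) * (D0 / Z)" by simp
      thus ?thesis by (simp only: r mult_1)
    qed
    ultimately show ?thesis using False unfolding has_loop_derivative_def by (simp only: if_False) blast
  qed
  let ?A = "large_loop_event V E \<theta> t u \<eta>"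
  let ?h = "\<lambda>\<omega>. \<theta> ^ ?N \<omega> * indicator ?A \<omega>"
  have A: "?A = {\<omega> \<in> space ?M. \<exists>\<gamma>\<in>loops V E \<omega>. real (card (loop_support V \<gamma>)) > \<eta> * real (card V)}"
    by (simp add: large_loop_event_def weighted_law_def)
  have A_sets [measurable]: "?A \<in> sets ?M"
    unfolding A by (rule time_invariant_measurable[OF E time_invariant_large_loop])
  have int_wA: "integrable (loop_law E t u) ?h"
    by (rule integrable_real_mult_indicator[OF _ int_w]) simp
  have prob_A: "measure (weighted_law V E \<theta> t u) ?A = (\<integral>\<omega>. ?h \<omega> \<partial>loop_law E t u) / Z"
  proof -
    have "emeasure (weighted_law V E \<theta> t u) ?A
        = (\<integral>\<^sup>+\<omega>. ennreal (\<theta> ^ ?N \<omega> / Z) * indicator ?A \<omega> \<partial>loop_law E t u)"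
      unfolding weighted_law_def Z_def by (rule emeasure_density) auto
    also have "\<dots> = (\<integral>\<^sup>+\<omega>. ennreal (?h \<omega> / Z) \<partial>loop_law E t u)"
      by (rule nn_integral_cong) (simp split: split_indicator)
    also have "\<dots> = ennreal (\<integral>\<omega>. ?h \<omega> / Z \<partial>loop_law E t u)"
      using int_wA Z \<theta> by (intro nn_integral_eq_integral) (auto intro!: divide_nonneg_pos)
    finally have "measure (weighted_law V E \<theta> t u) ?A = (\<integral>\<omega>. ?h \<omega> / Z \<partial>loop_law E t u)"
      using Z \<theta> by (simp add: measure_def)
    thus ?thesis by simp
  qed
  let ?a = "c * (1 + \<epsilon>) * real (card V) - real (card E)" and ?b = "\<theta> * real (card E)"
  have "D0 = (\<integral>\<omega>. add_mark_sum E u f \<omega> - real (card E) * f \<omega> \<partial>loop_law E t u)"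
    unfolding D0_def using int_f[OF t] int_L by simp
  also have "\<dots> \<le> (\<integral>\<omega>. ?a * \<theta> ^ ?N \<omega> + (?b - ?a) * ?h \<omega> \<partial>loop_law E t u)"
  proof (rule integral_mono_AE)
    show "AE \<omega> in loop_law E t u. add_mark_sum E u f \<omega> - real (card E) * f \<omega>
        \<le> ?a * \<theta> ^ ?N \<omega> + (?b - ?a) * ?h \<omega>"
    proof (rule AE_mp[OF AE_distinct_times[OF t E]], intro AE_I2 impI)
      fix \<omega> assume "\<omega> \<in> space (loop_law E t u)" and d: "distinct_times E \<omega>"
      hence \<omega>: "\<omega> \<in> space ?M" by simp
      have "add_mark_sum E u f \<omega> - real (card E) * f \<omega> \<le> \<theta> ^ ?N \<omega> * (if \<omega> \<in> ?A then ?b else ?a)"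
        using add_mark_sum_bound[OF u \<theta> assms(4) graph assms(8) \<omega> d] \<omega>
        unfolding A mem_Collect_eq f_def[abs_def] \<kappa>_def by simp
      also have "\<dots> = ?a * \<theta> ^ ?N \<omega> + (?b - ?a) * ?h \<omega>"
        by (simp add: algebra_simps split: split_indicator)
      finally show "add_mark_sum E u f \<omega> - real (card E) * f \<omega>
        \<le> ?a * \<theta> ^ ?N \<omega> + (?b - ?a) * ?h \<omega>" .
    qed
  qed (use int_f[OF t] int_L int_w int_wA in auto)
  also have "\<dots> = ?a * Z + (?b - ?a) * (\<integral>\<omega>. ?h \<omega> \<partial>loop_law E t u)"
    using int_w int_wA by (simp add: Z_def partition_function_def)
  finally have "D0 / Z \<le> (?a * Z + (?b - ?a) * (\<integral>\<omega>. ?h \<omega> \<partial>loop_law E t u)) / Z"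
    using Z by (intro divide_right_mono) auto
  also have "\<dots> = ?a + (?b - ?a) * measure (weighted_law V E \<theta> t u) ?A"
    unfolding prob_A using Z by (simp add: field_simps)
  also have "?b - ?a = (1 + \<theta>) * real (card E) - c * (1 + \<epsilon>) * real (card V)"
    by (simp add: algebra_simps)
  finally show ?thesis using der by blast
qed

end
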